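(* There is $L_0>0$ such that for every $L>L_0$ there exists $k_1\in(0,1)$ such that for every $k\in(0,k_1)$ the $L$-periodic function $\phi=\phi_{k,L}$ defined in the context is a smooth solution of $(\phi-c)\phi''+\frac{(\phi')^2}{2}-\phi^3+c\phi=A$, depends smoothly on $k\in(0,k_1)$, satisfies $\phi-c<0$ on $[0,L]$ and $c^2-3c+\frac{32\pi^4}{L^4}<0$, and is orbitally stable in $X=H^1_{per}([0,L])$ by the flow of $$u_t-u_{txx}=uu_{xxx}+2u_xu_{xx}-3u^2u_x$$ in the following conditional sense: for every $\varepsilon>0$ there exists $\delta>0$ such that, for every $u_0\in X$ with $\|u_0-\phi\|_X<\delta$ for which the equation has a global solution $u\in C([0,\infty);X)$ with $u(0)=u_0$ along which $E$, $F$ and $V$ are conserved, one has $\rho(u(t),\phi)<\varepsilon$ for all $t\ge 0$.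
   Context: $X=H^1_{per}([0,L])$ is the Sobolev space of real $L$-periodic functions with norm $\|\cdot\|_X$. $\rho(u,\phi)=\inf_{y\in\mathbb{R}}\|u-\phi(\cdot+y)\|_X$. The equation is understood in the sense of distributions in the form $u_t-u_{txx}=\left(\left(\tfrac{u^2}{2}\right)_{xx}-\tfrac{u_x^2}{2}-u^3\right)_x$, with $u$ being $L$-periodic in $x$. Its (formally) conserved quantities are $$E(u)=-\int_0^L\Big[\frac{u^4}{4}+\frac{uu_x^2}{2}\Big]dx,\quad F(u)=\frac12\int_0^L(u^2+u_x^2)\,dx,\quad V(u)=\int_0^L u\,dx.$$ Let $K(k)$ and $E(k)$ (as functions of the modulus $k\in(0,1)$) be the complete elliptic integrals of the first and second kind, and $\mathrm{dn}(\cdot;k)$ the Jacobi dnoidal function. Put $R=9L^4-2048(1-k^2+k^4)K(k)^4$ (positive in the regime considered) and define $$\phi(x)=a+b\left(\mathrm{dn}^2\left(\frac{2K(k)x}{L};k\right)-\frac{E(k)}{K(k)}\right),$$ $$a=-\frac{1}{3L^2}\left[-32(2-k^2)K(k)^2+96E(k)K(k)+\frac32L^2-\frac12\sqrt{R}\right],\quad b=-\frac{32K(k)^2}{L^2},\quad c=\frac{\frac32L^2-\frac12\sqrt{R}}{L^2},$$ $$A=\frac{1}{27L^6}\Big[\big(9L^4-1280(1-k^2+k^4)K(k)^4\big)\sqrt{R}+(-16384+24576k^2+24576k^4-16384k^6)K(k)^6+6912L^2(1-k^2+k^4)K(k)^4-27L^6\Big].$$ A traveling wave of the equation is $u(x,t)=\phi(x-ct)$.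 *)

theory Defs
  imports "HOL-Analysis.Analysis"
begin

section \<open>Smooth functions on open sets\<close>

fun higher_differentiable_on ::
  "nat \<Rightarrow> 'a::real_normed_vector set \<Rightarrow> ('a \<Rightarrow> 'b::real_normed_vector) \<Rightarrow> bool"
where
  "higher_differentiable_on 0 S f \<longleftrightarrow> continuous_on S f"
| "higher_differentiable_on (Suc n) S f \<longleftrightarrow>
     (\<forall>x\<in>S. f differentiable (at x)) \<and>
     (\<forall>v. higher_differentiable_on n S (\<lambda>x. frechet_derivative f (at x) v))"

text \<open>Only meant for open \<open>S\<close>, where it says that \<open>f\<close> is \<open>C\<close>-infinity on \<open>S\<close>.\<close>

definition smooth_on :: "'a::real_normed_vector set \<Rightarrow> ('a \<Rightarrow> 'b::real_normed_vector) \<Rightarrow> bool"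
  where "smooth_on S f \<longleftrightarrow> (\<forall>n. higher_differentiable_on n S f)"

definition partial_t :: "(real \<times> real \<Rightarrow> real) \<Rightarrow> real \<times> real \<Rightarrow> real"
  where "partial_t \<psi> = (\<lambda>(t, x). deriv (\<lambda>s. \<psi> (s, x)) t)"

definition partial_x :: "(real \<times> real \<Rightarrow> real) \<Rightarrow> real \<times> real \<Rightarrow> real"
  where "partial_x \<psi> = (\<lambda>(t, x). deriv (\<lambda>y. \<psi> (t, y)) x)"

section \<open>The periodic Sobolev space\<close>

definition periodic :: "real \<Rightarrow> (real \<Rightarrow> real) \<Rightarrow> bool"
  where "periodic L f \<longleftrightarrow> (\<forall>x. f (x + L) = f x)"

text \<open>
  Elements of \<open>L2\<close> and \<open>H1\<close> are represented by periodic Borel functions; two functions that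
  agree almost everywhere represent the same element. Everything below depends on the
  representative only up to null sets.
\<close>

definition L2_per :: "real \<Rightarrow> (real \<Rightarrow> real) set"
  where "L2_per L = {f \<in> borel_measurable borel. periodic L f \<and>
           set_integrable lborel {0..L} (\<lambda>x. (f x)\<^sup>2)}"

definition has_weak_deriv :: "real \<Rightarrow> (real \<Rightarrow> real) \<Rightarrow> (real \<Rightarrow> real) \<Rightarrow> bool"
  where "has_weak_deriv L f g \<longleftrightarrow>
    (\<forall>\<psi>. smooth_on UNIV \<psi> \<and> periodic L \<psi> \<longrightarrow>
       (LINT x:{0..L}|lborel. f x * deriv \<psi> x) = - (LINT x:{0..L}|lborel. g x * \<psi> x))"

definition H1_per :: "real \<Rightarrow> (real \<Rightarrow> real) set"
  where "H1_per L = {f \<in> L2_per L. \<exists>g \<in> L2_per L. has_weak_deriv L f g}"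

text \<open>For \<open>f\<close> in \<open>H1_per L\<close> the weak derivative is unique up to null sets.\<close>

definition weak_deriv :: "real \<Rightarrow> (real \<Rightarrow> real) \<Rightarrow> real \<Rightarrow> real"
  where "weak_deriv L f = (SOME g. g \<in> L2_per L \<and> has_weak_deriv L f g)"

definition H1_norm :: "real \<Rightarrow> (real \<Rightarrow> real) \<Rightarrow> real"
  where "H1_norm L f = sqrt (LINT x:{0..L}|lborel. (f x)\<^sup>2 + (weak_deriv L f x)\<^sup>2)"

definition orbit_dist :: "real \<Rightarrow> (real \<Rightarrow> real) \<Rightarrow> (real \<Rightarrow> real) \<Rightarrow> real"
  where "orbit_dist L u \<phi> = (INF y. H1_norm L (\<lambda>x. u x - \<phi> (x + y)))"

section \<open>The equation and its conserved quantities\<close>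

definition energy_E :: "real \<Rightarrow> (real \<Rightarrow> real) \<Rightarrow> real"
  where "energy_E L u =
    - (LINT x:{0..L}|lborel. (u x)^4 / 4 + u x * (weak_deriv L u x)\<^sup>2 / 2)"

definition energy_F :: "real \<Rightarrow> (real \<Rightarrow> real) \<Rightarrow> real"
  where "energy_F L u = 1/2 * (LINT x:{0..L}|lborel. (u x)\<^sup>2 + (weak_deriv L u x)\<^sup>2)"

definition mass_V :: "real \<Rightarrow> (real \<Rightarrow> real) \<Rightarrow> real"
  where "mass_V L u = (LINT x:{0..L}|lborel. u x)"

definition H1_continuous :: "real \<Rightarrow> (real \<Rightarrow> real \<Rightarrow> real) \<Rightarrow> bool"
  where "H1_continuous L u \<longleftrightarrow> (\<forall>t\<ge>0. u t \<in> H1_per L) \<and>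
    (\<forall>t\<ge>0. ((\<lambda>s. H1_norm L (\<lambda>x. u s x - u t x)) \<longlongrightarrow> 0) (at t within {0..}))"

definition test_function :: "(real \<times> real \<Rightarrow> real) \<Rightarrow> bool"
  where "test_function \<psi> \<longleftrightarrow> smooth_on UNIV \<psi> \<and>
    (\<exists>K. compact K \<and> K \<subseteq> {0<..} \<times> UNIV \<and> (\<forall>z. z \<notin> K \<longrightarrow> \<psi> z = 0))"

text \<open>
  \<open>u_t - u_txx = ((u^2/2)_xx - u_x^2/2 - u^3)_x\<close> in the sense of distributions on
  \<open>(0,\<infinity>) \<times> \<real>\<close>. The integrals are iterated, so that no joint measurability of the chosen
  representatives is needed: for an \<open>H1\<close>-continuous \<open>u\<close> the inner integrals are continuous
  in \<open>t\<close>.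
\<close>

definition distributional_solution :: "real \<Rightarrow> (real \<Rightarrow> real \<Rightarrow> real) \<Rightarrow> bool"
  where "distributional_solution L u \<longleftrightarrow> (\<forall>\<psi>. test_function \<psi> \<longrightarrow>
    (LINT t:{0<..}|lborel. LINT x|lborel.
       u t x * (- partial_t \<psi> (t, x) + partial_x (partial_x (partial_t \<psi>)) (t, x))) =
    (LINT t:{0<..}|lborel. LINT x|lborel.
       - ((u t x)\<^sup>2 / 2) * partial_x (partial_x (partial_x \<psi>)) (t, x)
       + ((weak_deriv L (u t) x)\<^sup>2 / 2 + (u t x)^3) * partial_x \<psi> (t, x)))"

definition conservative_global_solution ::
  "real \<Rightarrow> (real \<Rightarrow> real) \<Rightarrow> (real \<Rightarrow> real \<Rightarrow> real) \<Rightarrow> bool"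
  where "conservative_global_solution L u0 u \<longleftrightarrow>
    H1_continuous L u \<and> (AE x in lborel. u 0 x = u0 x) \<and> distributional_solution L u \<and>
    (\<forall>t\<ge>0. energy_E L (u t) = energy_E L u0 \<and>
            energy_F L (u t) = energy_F L u0 \<and>
            mass_V L (u t) = mass_V L u0)"

definition conditionally_orbitally_stable :: "real \<Rightarrow> (real \<Rightarrow> real) \<Rightarrow> bool"
  where "conditionally_orbitally_stable L \<phi> \<longleftrightarrow>
    (\<forall>\<epsilon>>0. \<exists>\<delta>>0. \<forall>u0 \<in> H1_per L. H1_norm L (\<lambda>x. u0 x - \<phi> x) < \<delta> \<longrightarrow>
       (\<forall>u. conservative_global_solution L u0 u \<longrightarrow> (\<forall>t\<ge>0. orbit_dist L (u t) \<phi> < \<epsilon>)))"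

section \<open>Elliptic integrals and the dnoidal function\<close>

text \<open>The argument \<open>k\<close> is always the modulus (not the parameter \<open>m = k\<^sup>2\<close>).\<close>

definition ellF :: "real \<Rightarrow> real \<Rightarrow> real"
  where "ellF k \<theta> = (LBINT s=0..\<theta>. 1 / sqrt (1 - k\<^sup>2 * (sin s)\<^sup>2))"

definition ellK :: "real \<Rightarrow> real"
  where "ellK k = (LBINT s=0..pi/2. 1 / sqrt (1 - k\<^sup>2 * (sin s)\<^sup>2))"

definition ellE :: "real \<Rightarrow> real"
  where "ellE k = (LBINT s=0..pi/2. sqrt (1 - k\<^sup>2 * (sin s)\<^sup>2))"

definition jacobi_am :: "real \<Rightarrow> real \<Rightarrow> real"
  where "jacobi_am k v = (THE \<theta>. ellF k \<theta> = v)"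

definition dn :: "real \<Rightarrow> real \<Rightarrow> real"
  where "dn v k = sqrt (1 - k\<^sup>2 * (sin (jacobi_am k v))\<^sup>2)"

section \<open>The periodic waves\<close>

definition wave_R :: "real \<Rightarrow> real \<Rightarrow> real"
  where "wave_R L k = 9 * L^4 - 2048 * (1 - k^2 + k^4) * (ellK k)^4"

definition wave_a :: "real \<Rightarrow> real \<Rightarrow> real"
  where "wave_a L k = - (1 / (3 * L^2)) *
    (- 32 * (2 - k^2) * (ellK k)^2 + 96 * ellE k * ellK k + 3/2 * L^2 - 1/2 * sqrt (wave_R L k))"

definition wave_b :: "real \<Rightarrow> real \<Rightarrow> real"
  where "wave_b L k = - (32 * (ellK k)^2 / L^2)"

definition wave_c :: "real \<Rightarrow> real \<Rightarrow> real"
  where "wave_c L k = (3/2 * L^2 - 1/2 * sqrt (wave_R L k)) / L^2"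

definition wave_A :: "real \<Rightarrow> real \<Rightarrow> real"
  where "wave_A L k = 1 / (27 * L^6) *
    ((9 * L^4 - 1280 * (1 - k^2 + k^4) * (ellK k)^4) * sqrt (wave_R L k)
     + (- 16384 + 24576 * k^2 + 24576 * k^4 - 16384 * k^6) * (ellK k)^6
     + 6912 * L^2 * (1 - k^2 + k^4) * (ellK k)^4 - 27 * L^6)"

definition wave_phi :: "real \<Rightarrow> real \<Rightarrow> real \<Rightarrow> real"
  where "wave_phi L k x =
    wave_a L k + wave_b L k * ((dn (2 * ellK k * x / L) k)^2 - ellE k / ellK k)"

end

theory Submission
  imports Defs
begin

text \<open>
  As \<open>k \<rightarrow> 0\<close> the wave bifurcates from a constant \<open>a\<close>: with \<open>\<kappa> = 2 \<pi> / L\<close> it is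
  \<open>\<phi> = m + \<beta> (cos (\<kappa> x) + r)\<close> with \<open>\<beta> \<noteq> 0\<close>, where \<open>r\<close> and \<open>r'\<close> tend to \<open>0\<close> uniformly.

  The wave is a critical point of \<open>E + c F - A V\<close>. At \<open>k = 0\<close> the second variation has the eigenvalue
  \<open>(c - a) \<kappa>\<^sup>2 (n\<^sup>2 - 1)\<close> on the Fourier modes \<open>\<plusminus>n\<close>, so that only the modes \<open>0\<close> and \<open>\<plusminus>1\<close> are
  not coercive, and for small \<open>k\<close> this remains true up to a small error. Conservation of \<open>V\<close> controls
  mode \<open>0\<close>. To leading order the differential of \<open>F\<close> at \<open>\<phi>\<close> on mean-free functions is
  \<open>\<beta> (1 + \<kappa>\<^sup>2)\<close> times the first cosine coefficient, hence conservation of \<open>F\<close> controls that mode. The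
  sine mode is removed by choosing the translate of \<open>\<phi>\<close> through the phase of the first Fourier mode of
  \<open>u\<close>.

  The estimates confine the distance to the orbit either to a small neighbourhood of \<open>0\<close> or away from
  it; as this distance is continuous in time, it stays small.
\<close>

section \<open>Smoothness by coinduction\<close>

text \<open>The decomposition is exact rather than an expansion in k:
  \<open>dn^2 = 1 - k^2 sin^2(am)\<close> makes \<phi> affine in \<open>cos (2 am)\<close>, with
  amplitude \<beta> = - 16 K^2 k^2 / L^2. Hence r = cos (2 am) - cos (\<kappa> x) is jointly
  continuous in (k, x), and compactness replaces every estimate of a rate in k.

  The eigenvalue of the cosine mode is zero at k = 0, and its sign for small k would be delicate.
  The conservation of F bypasses that sign, and with it the counting of negative directions.
  Dividing by \<beta> to recover the cosine coefficient produces factors 1 / \<beta>^2, but only in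
  front of deviations of conserved quantities; the error due to r is relative to \<beta> and hence
  small uniformly in k. The large factors affect \<delta>, which is chosen after k.

  The threshold L0 = 2 \<pi> makes R positive at k = 0. Norm and energies use a weak derivative
  obtained by choice, so its uniqueness is indispensable. This is the reason for proving
  completeness of the Hartley system, on which the sup bound also rests.\<close>

inductive_set gen_algebra :: "('a \<Rightarrow> real) set \<Rightarrow> ('a \<Rightarrow> real) set" for G where
  gen: "g \<in> G \<Longrightarrow> g \<in> gen_algebra G"
| const: "(\<lambda>x. c) \<in> gen_algebra G"
| add: "f \<in> gen_algebra G \<Longrightarrow> g \<in> gen_algebra G \<Longrightarrow> (\<lambda>x. f x + g x) \<in> gen_algebra G"
| mult: "f \<in> gen_algebra G \<Longrightarrow> g \<in> gen_algebra G \<Longrightarrow> (\<lambda>x. f x * g x) \<in> gen_algebra G"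

lemma gen_algebra_minus:
  assumes "f \<in> gen_algebra G" shows "(\<lambda>x. - f x) \<in> gen_algebra G"
  using gen_algebra.mult[OF gen_algebra.const[of "-1"] assms] by simp

lemma gen_algebra_diff:
  assumes "f \<in> gen_algebra G" "g \<in> gen_algebra G"
  shows "(\<lambda>x. f x - g x) \<in> gen_algebra G"
  using gen_algebra.add[OF assms(1) gen_algebra_minus[OF assms(2)]] by simp

lemma gen_algebra_power:
  assumes "f \<in> gen_algebra G" shows "(\<lambda>x. f x ^ n) \<in> gen_algebra G"
  by (induction n) (auto intro: gen_algebra.const gen_algebra.mult assms)

lemmas gen_algebra_intros = gen_algebra.const gen_algebra.add gen_algebra.mult
  gen_algebra_minus gen_algebra_diff gen_algebra_power

lemma frechet_derivative_cong_open:
  assumes "open S" "x \<in> S" "\<And>y. y \<in> S \<Longrightarrow> f y = g y"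
  shows "frechet_derivative f (at x) = frechet_derivative g (at x)"
proof -
  have "(f has_derivative D) (at x) \<longleftrightarrow> (g has_derivative D) (at x)" for D
    using has_derivative_transform_within_open[OF _ assms(1,2)] assms(3) by metis
  then show ?thesis by (simp add: frechet_derivative_def)
qed

lemma higher_differentiable_on_cong:
  assumes "open S" "\<And>y. y \<in> S \<Longrightarrow> f y = g y" "higher_differentiable_on n S f"
  shows "higher_differentiable_on n S g"
  using assms(2,3)
proof (induction n arbitrary: f g)
  case 0
  then show ?case by (simp cong: continuous_on_cong)
next
  case (Suc n)
  show ?case unfolding higher_differentiable_on.simps
  proof (intro conjI ballI allI)
    fix x assume x: "x \<in> S"
    then obtain D where "(f has_derivative D) (at x)"
      using Suc.prems(2) by (auto simp: differentiable_def)
    then have "(g has_derivative D) (at x)"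
      using has_derivative_transform_within_open[OF _ assms(1) x] Suc.prems(1) by metis
    then show "g differentiable at x" by (auto simp: differentiable_def)
  next
    fix v
    show "higher_differentiable_on n S (\<lambda>x. frechet_derivative g (at x) v)"
    proof (rule Suc.IH)
      show "higher_differentiable_on n S (\<lambda>x. frechet_derivative f (at x) v)"
        using Suc.prems by simp
      show "frechet_derivative f (at y) v = frechet_derivative g (at y) v" if "y \<in> S" for y
        using frechet_derivative_cong_open[OF assms(1) that Suc.prems(1)] by simp
    qed
  qed
qed

lemma smooth_on_cong:
  assumes "open S" "\<And>y. y \<in> S \<Longrightarrow> f y = g y" "smooth_on S f"
  shows "smooth_on S g"
  using assms higher_differentiable_on_cong unfolding smooth_on_def by metis

lemma higher_differentiable_on_subset:
  "higher_differentiable_on n S f \<Longrightarrow> T \<subseteq> S \<Longrightarrow> higher_differentiable_on n T f"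
  by (induction n arbitrary: f) (auto intro: continuous_on_subset)

lemma smooth_on_subset: "smooth_on S f \<Longrightarrow> T \<subseteq> S \<Longrightarrow> smooth_on T f"
  using higher_differentiable_on_subset unfolding smooth_on_def by metis

text \<open>Coinduction for smoothness: it suffices that the directional derivatives of the generators
  are again polynomials in the generators.\<close>

lemma smooth_on_gen_algebra:
  fixes G :: "('a::real_normed_vector \<Rightarrow> real) set"
  assumes "open S"
    and gen: "\<And>g. g \<in> G \<Longrightarrow> \<exists>g'. (\<forall>x\<in>S. (g has_derivative (\<lambda>v. g' v x)) (at x)) \<and> (\<forall>v. g' v \<in> gen_algebra G)"
    and f: "f \<in> gen_algebra G"
  shows "smooth_on S f"
proof -
  \<comment> \<open>Sum and product rule carry the assumption on the generators to the whole
    algebra, with derivatives that stay inside it; the induction on the order below then never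
    leaves the algebra.\<close>
  have der: "\<exists>f'. (\<forall>x\<in>S. (f has_derivative (\<lambda>v. f' v x)) (at x)) \<and> (\<forall>v. f' v \<in> gen_algebra G)"
    if "f \<in> gen_algebra G" for f
    using that
  proof induction
    case (gen g)
    then show ?case using assms(2) by blast
  next
    case (const c)
    show ?case
      by (rule exI[of _ "\<lambda>v x. 0"]) (auto intro: gen_algebra.const)
  next
    case (add f g)
    then obtain f' g' where f': "\<forall>x\<in>S. (f has_derivative (\<lambda>v. f' v x)) (at x)" "\<And>v. f' v \<in> gen_algebra G"
      and g': "\<forall>x\<in>S. (g has_derivative (\<lambda>v. g' v x)) (at x)" "\<And>v. g' v \<in> gen_algebra G"
      by blast
    show ?case
      by (rule exI[of _ "\<lambda>v x. f' v x + g' v x"])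
        (use f' g' in \<open>auto intro!: gen_algebra_intros derivative_intros\<close>)
  next
    case (mult f g)
    then obtain f' g' where f': "\<forall>x\<in>S. (f has_derivative (\<lambda>v. f' v x)) (at x)" "\<And>v. f' v \<in> gen_algebra G"
      and g': "\<forall>x\<in>S. (g has_derivative (\<lambda>v. g' v x)) (at x)" "\<And>v. g' v \<in> gen_algebra G"
      by blast
    show ?case
      by (rule exI[of _ "\<lambda>v x. f x * g' v x + f' v x * g x"])
        (use f' g' mult in \<open>auto intro!: gen_algebra_intros derivative_intros\<close>)
  qed
  have "higher_differentiable_on n S f" if "f \<in> gen_algebra G" for n
    using that
  proof (induction n arbitrary: f)
    case 0
    then obtain f' where "\<forall>x\<in>S. (f has_derivative (\<lambda>v. f' v x)) (at x)"
      using der by blast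
    then show ?case
      by (auto simp: continuous_on_eq_continuous_at[OF assms(1)] intro: has_derivative_continuous)
  next
    case (Suc n)
    from der[OF Suc.prems] obtain f' where
      f': "\<forall>x\<in>S. (f has_derivative (\<lambda>v. f' v x)) (at x)" "\<And>v. f' v \<in> gen_algebra G"
      by blast
    show ?case unfolding higher_differentiable_on.simps
    proof (intro conjI ballI allI)
      show "f differentiable at x" if "x \<in> S" for x
        using f'(1) that by (auto simp: differentiable_def)
      fix v
      show "higher_differentiable_on n S (\<lambda>x. frechet_derivative f (at x) v)"
      proof (rule higher_differentiable_on_cong[OF assms(1)])
        show "higher_differentiable_on n S (f' v)" using Suc.IH f'(2) by blast
        show "f' v x = frechet_derivative f (at x) v" if "x \<in> S" for x
          using frechet_derivative_at f'(1) that by metis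
      qed
    qed
  qed
  then show ?thesis using f by (simp add: smooth_on_def)
qed

text \<open>A directional derivative on the real line is the ordinary derivative times the constant
  \<open>v\<close>, so one derivative per generator suffices.\<close>

lemma smooth_on_gen_algebra_real:
  fixes G :: "(real \<Rightarrow> real) set"
  assumes gen: "\<And>g. g \<in> G \<Longrightarrow> \<exists>g'\<in>gen_algebra G. \<forall>x. (g has_real_derivative g' x) (at x)"
    and f: "f \<in> gen_algebra G"
  shows "smooth_on UNIV f"
proof (rule smooth_on_gen_algebra[OF open_UNIV _ f])
  fix g assume "g \<in> G"
  then obtain g' where g': "g' \<in> gen_algebra G" "\<forall>x. (g has_real_derivative g' x) (at x)"
    using gen by blast
  show "\<exists>g'. (\<forall>x\<in>UNIV. (g has_derivative (\<lambda>v. g' v x)) (at x)) \<and> (\<forall>v. g' v \<in> gen_algebra G)"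
    by (rule exI[of _ "\<lambda>v x. g' x * v"])
      (use g' in \<open>auto intro!: gen_algebra_intros simp: has_field_derivative_def\<close>)
qed

lemma smooth_on_frechet_derivative:
  assumes "smooth_on S f"
  shows "smooth_on S (\<lambda>x. frechet_derivative f (at x) v)"
  unfolding smooth_on_def
proof
  fix n
  have "higher_differentiable_on (Suc n) S f" using assms by (simp add: smooth_on_def)
  then show "higher_differentiable_on n S (\<lambda>x. frechet_derivative f (at x) v)" by simp
qed

lemma smooth_on_differentiable:
  "smooth_on S f \<Longrightarrow> x \<in> S \<Longrightarrow> f differentiable (at x)"
  unfolding smooth_on_def using higher_differentiable_on.simps(2)[of 0] by metis

text \<open>Here all smooth functions serve as generators.\<close>

lemma smooth_on_algebra:
  fixes f :: "'a::real_normed_vector \<Rightarrow> real"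
  assumes "open S" "f \<in> gen_algebra {g. smooth_on S g}"
  shows "smooth_on S f"
proof (rule smooth_on_gen_algebra[OF assms(1) _ assms(2)])
  fix g :: "'a \<Rightarrow> real" assume "g \<in> {g. smooth_on S g}"
  then have g: "smooth_on S g" by simp
  show "\<exists>g'. (\<forall>x\<in>S. (g has_derivative (\<lambda>v. g' v x)) (at x)) \<and> (\<forall>v. g' v \<in> gen_algebra {g. smooth_on S g})"
    by (rule exI[of _ "\<lambda>v x. frechet_derivative g (at x) v"])
      (use smooth_on_differentiable[OF g] smooth_on_frechet_derivative[OF g] in
        \<open>auto simp: frechet_derivative_works intro: gen_algebra.gen\<close>)
qed

lemma smooth_on_has_deriv:
  fixes f :: "real \<Rightarrow> real"
  assumes "smooth_on UNIV f"
  shows "(f has_real_derivative deriv f x) (at x)"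
  using smooth_on_differentiable[OF assms, of x]
  by (simp add: DERIV_deriv_iff_real_differentiable)

lemma smooth_on_deriv:
  fixes f :: "real \<Rightarrow> real"
  assumes "smooth_on UNIV f"
  shows "smooth_on UNIV (deriv f)"
proof -
  have "frechet_derivative f (at x) 1 = deriv f x" for x
    using smooth_on_has_deriv[OF assms, of x] frechet_derivative_at[of f "(*) (deriv f x)" x]
    by (metis has_field_derivative_def mult.right_neutral)
  then show ?thesis using smooth_on_frechet_derivative[OF assms, of 1] by simp
qed

section \<open>Elliptic integrals and the Jacobi amplitude\<close>

definition ellw :: "real \<Rightarrow> real \<Rightarrow> real" where
  "ellw k s = 1 / sqrt (1 - k\<^sup>2 * (sin s)\<^sup>2)"

text \<open>A family closed under differentiation in \<open>k\<close>: each derivative raises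
  \<open>j\<close> by one and contributes the factor \<open>(1 + 2 j) k\<close>. The case
  \<open>j = 0\<close> is the integrand of \<open>ellF\<close>.\<close>

definition elle :: "nat \<Rightarrow> real \<Rightarrow> real \<Rightarrow> real" where
  "elle j k s = sin s ^ (2 * j) * ellw k s ^ (2 * j + 1)"

definition ellI :: "nat \<Rightarrow> real \<Rightarrow> real \<Rightarrow> real" where
  "ellI j k \<theta> = (LBINT s=0..\<theta>. elle j k s)"

lemma modulus_pos:
  fixes k s :: real
  assumes "\<bar>k\<bar> < 1" shows "0 < 1 - k\<^sup>2 * (sin s)\<^sup>2"
proof -
  have "k\<^sup>2 < 1" using assms abs_square_less_1[of k] by blast
  moreover have "(sin s)\<^sup>2 \<le> 1" by (simp add: abs_square_le_1)
  ultimately have "k\<^sup>2 * (sin s)\<^sup>2 < 1"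
    by (metis less_eq_real_def mult_left_le mult_eq_0_iff order_le_less_trans zero_le_power2)
  then show ?thesis by simp
qed

lemma ellw_pos: "\<bar>k\<bar> < 1 \<Longrightarrow> 0 < ellw k s"
  using modulus_pos by (simp add: ellw_def)

lemma ellw_ge_1: "\<bar>k\<bar> < 1 \<Longrightarrow> 1 \<le> ellw k s"
proof -
  assume "\<bar>k\<bar> < 1"
  then have "0 < sqrt (1 - k\<^sup>2 * (sin s)\<^sup>2)" "sqrt (1 - k\<^sup>2 * (sin s)\<^sup>2) \<le> 1"
    using modulus_pos by simp_all
  then show ?thesis by (simp add: ellw_def)
qed

lemma ellw_has_derivative:
  assumes "\<bar>k\<bar> < 1"
  shows "((\<lambda>k. ellw k s) has_real_derivative k * (sin s)\<^sup>2 * ellw k s ^ 3) (at k within S)"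
proof -
  define D where "D = 1 - k\<^sup>2 * (sin s)\<^sup>2"
  have D: "D > 0" using modulus_pos[OF assms] by (simp add: D_def)
  then have "sqrt D ^ 3 = D * sqrt D" by (simp add: power3_eq_cube)
  then show ?thesis
    unfolding ellw_def
    using D by (auto intro!: derivative_eq_intros simp flip: D_def simp: field_simps)
qed

lemma elle_has_derivative:
  assumes "\<bar>k\<bar> < 1"
  shows "((\<lambda>k. elle j k s) has_real_derivative (1 + 2 * real j) * k * elle (Suc j) k s) (at k within S)"
proof -
  have "((\<lambda>k. ellw k s ^ Suc (2 * j)) has_real_derivative
      (2 * j + 1) * (k * (sin s)\<^sup>2 * ellw k s ^ 3) * ellw k s ^ (2 * j)) (at k within S)"
    using DERIV_power_Suc[OF ellw_has_derivative[OF assms], where n = "2 * j"] by (simp add: mult_ac)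
  from DERIV_cmult[OF this, of "sin s ^ (2 * j)"] show ?thesis
    unfolding elle_def by (simp add: algebra_simps power_add power2_eq_square power3_eq_cube)
qed

lemma continuous_on_ellw:
  fixes f g :: "'a::real_normed_vector \<Rightarrow> real"
  assumes "\<And>x. x \<in> A \<Longrightarrow> \<bar>f x\<bar> < 1" "continuous_on A f" "continuous_on A g"
  shows "continuous_on A (\<lambda>x. ellw (f x) (g x))"
proof -
  have "sqrt (1 - (f x)\<^sup>2 * (sin (g x))\<^sup>2) \<noteq> 0" if "x \<in> A" for x
    using modulus_pos[OF assms(1)[OF that], of "g x"] by simp
  then show ?thesis
    unfolding ellw_def by (auto intro!: continuous_intros assms)
qed

lemma continuous_on_elle:
  fixes f g :: "'a::real_normed_vector \<Rightarrow> real"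
  assumes "\<And>x. x \<in> A \<Longrightarrow> \<bar>f x\<bar> < 1" "continuous_on A f" "continuous_on A g"
  shows "continuous_on A (\<lambda>x. elle j (f x) (g x))"
  unfolding elle_def by (intro continuous_intros continuous_on_ellw assms; assumption)

lemma ellI_has_derivative_theta:
  assumes "\<bar>k\<bar> < 1"
  shows "(ellI j k has_real_derivative elle j k \<theta>) (at \<theta>)"
proof -
  \<comment> \<open>\<open>\<theta>\<close> has to be an interior point, so that the derivative
    within \<open>{-M..M}\<close> is a full derivative; the interval also contains the base point
    \<open>0\<close>.\<close>
  define M where "M = \<bar>\<theta>\<bar> + 1"
  have "((\<lambda>u. LBINT y=0..u. elle j k y) has_vector_derivative elle j k \<theta>) (at \<theta> within {-M..M})"
    unfolding zero_ereal_def
    by (rule interval_integral_FTC2) (auto simp: M_def intro!: continuous_on_elle continuous_intros assms)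
  then have "(ellI j k has_real_derivative elle j k \<theta>) (at \<theta> within {-M..M})"
    by (simp add: has_real_derivative_iff_has_vector_derivative ellI_def[abs_def])
  moreover have "\<theta> \<in> interior {-M..M}" by (auto simp: M_def)
  ultimately show ?thesis by (metis at_within_interior)
qed

lemma ellI_eq_integral:
  assumes "\<bar>k\<bar> < 1" "0 \<le> \<theta>"
  shows "ellI j k \<theta> = integral {0..\<theta>} (elle j k)"
proof -
  have "set_integrable lborel {0..\<theta>} (elle j k)"
    unfolding set_integrable_def
    by (intro borel_integrable_compact continuous_on_elle continuous_intros assms) auto
  then show ?thesis
    unfolding ellI_def zero_ereal_def using assms(2) by (intro interval_integral_eq_integral)
qed

lemma elle_minus: "elle j k (- s) = elle j k s"
  by (simp add: elle_def ellw_def)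

lemma ellI_minus: "ellI j k (- \<theta>) = - ellI j k \<theta>"
proof -
  have "(LBINT s=0..-\<theta>. elle j k s) = (LBINT s=\<theta>..0. elle j k (- s))"
    using interval_integral_reflect[of 0 "ereal (-\<theta>)" "elle j k"] by (simp)
  also have "\<dots> = - (LBINT s=0..\<theta>. elle j k s)"
    by (subst interval_integral_endpoints_reverse) (simp add: elle_minus)
  finally show ?thesis by (simp add: ellI_def)
qed

text \<open>Differentiation under the integral is applied on \<open>{0..\<theta>}\<close>, that is,
  for nonnegative \<open>\<theta>\<close>; oddness in \<open>\<theta>\<close> transfers the result
  to negative arguments.\<close>

lemma ellI_has_derivative_k:
  assumes k: "\<bar>k\<bar> < 1"
  shows "((\<lambda>k. ellI j k \<theta>) has_real_derivative (1 + 2 * real j) * k * ellI (Suc j) k \<theta>) (at k)"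
proof -
  have *: "((\<lambda>k. ellI j k \<theta>) has_real_derivative (1 + 2 * real j) * k * ellI (Suc j) k \<theta>) (at k)"
    if \<theta>: "0 \<le> \<theta>" for \<theta>
  proof -
    have "((\<lambda>k. integral (cbox 0 \<theta>) (elle j k)) has_real_derivative
        integral (cbox 0 \<theta>) (\<lambda>s. (1 + 2 * real j) * k * elle (Suc j) k s)) (at k within {-1<..<1})"
    proof (rule leibniz_rule_field_derivative)
      show "((\<lambda>k. elle j k s) has_real_derivative (1 + 2 * real j) * k * elle (Suc j) k s) (at k within {-1<..<1})"
        if "k \<in> {-1<..<1}" for k s
        using that by (intro elle_has_derivative) auto
      show "elle j k integrable_on cbox 0 \<theta>" if "k \<in> {-1<..<1}" for k
        using that by (intro integrable_continuous continuous_on_elle continuous_intros) auto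
      show "continuous_on ({-1<..<1} \<times> cbox 0 \<theta>) (\<lambda>(k, s). (1 + 2 * real j) * k * elle (Suc j) k s)"
        unfolding case_prod_unfold by (intro continuous_intros continuous_on_elle) auto
    qed (use k in auto)
    moreover have "k \<in> {-1<..<1}" using k by auto
    ultimately have "((\<lambda>k. integral {0..\<theta>} (elle j k)) has_real_derivative
        (1 + 2 * real j) * k * integral {0..\<theta>} (elle (Suc j) k)) (at k)"
      by (simp add: at_within_open[of k "{-1<..<1}"])
    then have "((\<lambda>k. integral {0..\<theta>} (elle j k)) has_real_derivative
        (1 + 2 * real j) * k * ellI (Suc j) k \<theta>) (at k)"
      by (simp add: ellI_eq_integral[OF k \<theta>])
    then show ?thesis
      by (rule has_field_derivative_transform_within_open[of _ _ _ "{-1<..<1}"])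
        (use k in \<open>auto simp: ellI_eq_integral \<theta>\<close>)
  qed
  show ?thesis
  proof (cases "0 \<le> \<theta>")
    case False
    then have "((\<lambda>k. - ellI j k (-\<theta>)) has_real_derivative - ((1 + 2 * real j) * k * ellI (Suc j) k (-\<theta>))) (at k)"
      by (intro derivative_intros *) auto
    then show ?thesis by (simp add: ellI_minus)
  qed (rule *)
qed

text \<open>Both partial derivatives exist, and continuity of the one in \<open>\<theta>\<close>
  yields the total derivative.\<close>

lemma ellI_has_derivative:
  assumes k: "\<bar>k\<bar> < 1"
  shows "((\<lambda>(k, \<theta>). ellI j k \<theta>) has_derivative
    (\<lambda>(dk, d\<theta>). (1 + 2 * real j) * k * ellI (Suc j) k \<theta> * dk + elle j k \<theta> * d\<theta>)) (at (k, \<theta>))"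
proof -
  have "((\<lambda>(k, \<theta>). ellI j k \<theta>) has_derivative
    (\<lambda>(dk, d\<theta>). ((1 + 2 * real j) * k * ellI (Suc j) k \<theta>) * dk + blinfun_apply (blinfun_mult_right (elle j k \<theta>)) d\<theta>))
      (at (k, \<theta>) within {-1<..<1} \<times> UNIV)"
  proof (rule has_derivative_partialsI)
    show "((\<lambda>k. ellI j k \<theta>) has_derivative (*) ((1 + 2 * real j) * k * ellI (Suc j) k \<theta>)) (at k within {-1<..<1})"
      using ellI_has_derivative_k[OF k] by (simp add: has_field_derivative_def has_derivative_at_withinI)
    show "(ellI j k has_derivative blinfun_apply (blinfun_mult_right (elle j k \<theta>))) (at \<theta> within UNIV)"
      if "k \<in> {-1<..<1}" for k \<theta>
      using ellI_has_derivative_theta[of k] that by (auto simp: has_field_derivative_def)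
    have "continuous_on ({-1<..<1} \<times> UNIV) (\<lambda>x. blinfun_mult_right (elle j (fst x) (snd x)))"
      by (intro continuous_intros continuous_on_elle) auto
    then show "continuous (at (k, \<theta>) within {-1<..<1} \<times> UNIV) (\<lambda>(k, \<theta>). blinfun_mult_right (elle j k \<theta>))"
      using k by (simp add: continuous_on_eq_continuous_within case_prod_unfold abs_less_iff)
  qed auto
  moreover have "(k, \<theta>) \<in> {-1<..<1} \<times> UNIV" using k by auto
  ultimately show ?thesis
    by (subst (asm) at_within_open) (auto intro!: open_Times)
qed

lemma ellF_eq_ellI: "ellF k = ellI 0 k"
  by (simp add: ellF_def ellI_def elle_def ellw_def fun_eq_iff)

lemma ellK_eq_ellI: "ellK k = ellI 0 k (pi / 2)"
  by (simp add: ellK_def ellI_def elle_def ellw_def)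

lemma ellI_0 [simp]: "ellI j k 0 = 0"
  by (simp add: ellI_def zero_ereal_def)

lemma ellF_has_derivative:
  assumes "\<bar>k\<bar> < 1" shows "(ellF k has_real_derivative ellw k \<theta>) (at \<theta>)"
  using ellI_has_derivative_theta[OF assms, of 0] by (simp add: ellF_eq_ellI elle_def)

text \<open>The integrand is at least \<open>1\<close>. This one monotonicity gives injectivity of
  \<open>ellF k\<close>, its growth in both directions, and
  \<open>pi / 2 \<le> ellK k\<close>.\<close>

lemma ellF_minus_mono:
  assumes "\<bar>k\<bar> < 1" "x \<le> y" shows "ellF k x - x \<le> ellF k y - y"
  by (rule DERIV_nonneg_imp_nondecreasing[OF assms(2)])
    (use ellF_has_derivative[OF assms(1)] ellw_ge_1[OF assms(1)] in \<open>force intro!: derivative_eq_intros\<close>)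

lemma ellF_0 [simp]: "ellF k 0 = 0"
  by (simp add: ellF_eq_ellI)

lemma ellF_strict_mono:
  assumes "\<bar>k\<bar> < 1" shows "strict_mono (ellF k)"
  using ellF_minus_mono[OF assms] by (intro strict_monoI) (smt (verit))

lemma ellF_surj:
  assumes k: "\<bar>k\<bar> < 1" shows "\<exists>\<theta>. ellF k \<theta> = v"
proof -
  have "continuous_on UNIV (ellF k)"
    using ellF_has_derivative[OF k] by (intro DERIV_continuous_on) auto
  moreover have "ellF k (-\<bar>v\<bar>) \<le> v" "v \<le> ellF k \<bar>v\<bar>"
    using ellF_minus_mono[OF k, of 0 "\<bar>v\<bar>"] ellF_minus_mono[OF k, of "-\<bar>v\<bar>" 0] by auto
  ultimately show ?thesis
    using IVT'[of "ellF k" "-\<bar>v\<bar>" v "\<bar>v\<bar>"] continuous_on_subset[of UNIV] by auto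
qed

lemma jacobi_am_ellF:
  assumes "\<bar>k\<bar> < 1" shows "jacobi_am k (ellF k \<theta>) = \<theta>"
  unfolding jacobi_am_def
  using ellF_strict_mono[OF assms, THEN strict_mono_eq] by auto

lemma ellF_jacobi_am:
  assumes "\<bar>k\<bar> < 1" shows "ellF k (jacobi_am k v) = v"
  using ellF_surj[OF assms, of v] jacobi_am_ellF[OF assms] by auto

text \<open>Inverse function theorem for
  \<open>(k, \<theta>) \<mapsto> (k, ellF k \<theta>)\<close>: carrying \<open>k\<close> along makes
  this a bijection of the strip onto itself, with a triangular derivative that is invertible because
  \<open>ellw\<close> is positive.\<close>

lemma jacobi_am_has_derivative:
  fixes k v :: real
  assumes k: "\<bar>k\<bar> < 1"
  defines "\<theta> \<equiv> jacobi_am k v"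
  shows "((\<lambda>(k, v). jacobi_am k v) has_derivative
    (\<lambda>(dk, dv). (dv - k * ellI 1 k \<theta> * dk) / ellw k \<theta>)) (at (k, v))"
proof -
  let ?f = "\<lambda>(k, \<theta>). (k, ellF k \<theta>)" and ?g = "\<lambda>(k, v). (k, jacobi_am k v)"
  let ?f' = "\<lambda>(dk, d\<theta>). (dk, k * ellI 1 k \<theta> * dk + ellw k \<theta> * d\<theta>)"
  let ?g' = "\<lambda>(dk, dv). (dk, (dv - k * ellI 1 k \<theta> * dk) / ellw k \<theta>)"
  let ?S = "({-1<..<1} :: real set) \<times> (UNIV :: real set)"
  have f': "(?f has_derivative (\<lambda>(dk, d\<theta>). (dk, k * ellI 1 k \<theta> * dk + ellw k \<theta> * d\<theta>))) (at (k, \<theta>))"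
    if "\<bar>k\<bar> < 1" for k \<theta>
  proof -
    have "((\<lambda>z. (fst z, ellI 0 (fst z) (snd z))) has_derivative
        (\<lambda>h. (fst h, k * ellI 1 k \<theta> * fst h + ellw k \<theta> * snd h))) (at (k, \<theta>))"
      using ellI_has_derivative[OF that, of 0 \<theta>]
      by (intro has_derivative_Pair has_derivative_fst has_derivative_ident)
        (simp add: case_prod_unfold elle_def)
    then show ?thesis by (simp add: case_prod_unfold ellF_eq_ellI)
  qed
  have "(?g has_derivative ?g') (at (?f (k, \<theta>)))"
  proof (rule has_derivative_inverse_strong[where S = ?S and f = ?f and x = "(k, \<theta>)" and g = ?g])
    show "open ?S" by (auto intro!: open_Times)
    show "(k, \<theta>) \<in> ?S" using k by auto
    show "continuous_on ?S ?f"
    proof (rule continuous_at_imp_continuous_on, rule ballI)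
      fix x assume "x \<in> ?S"
      then show "isCont ?f x" using f'[of "fst x" "snd x"] has_derivative_continuous by fastforce
    qed
    show "?g (?f x) = x" if "x \<in> ?S" for x
      using that jacobi_am_ellF[of "fst x"] by (auto simp: case_prod_unfold)
    show "(?f has_derivative ?f') (at (k, \<theta>))" by (rule f'[OF k])
    show "?f' \<circ> ?g' = id" using ellw_pos[OF k, of \<theta>] by (auto simp: fun_eq_iff)
  qed
  moreover have "?f (k, \<theta>) = (k, v)" by (simp add: \<theta>_def ellF_jacobi_am[OF k])
  ultimately have "(?g has_derivative ?g') (at (k, v))" by metis
  from has_derivative_snd[OF this] show ?thesis by (simp add: case_prod_unfold)
qed

lemma jacobi_am_has_real_derivative:
  assumes k: "\<bar>k\<bar> < 1"
  shows "(jacobi_am k has_real_derivative 1 / ellw k (jacobi_am k v)) (at v)"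
proof -
  have "((\<lambda>v. (\<lambda>(k, v). jacobi_am k v) (k, v)) has_derivative
      (\<lambda>h. (\<lambda>(dk, dv). (dv - k * ellI 1 k (jacobi_am k v) * dk) / ellw k (jacobi_am k v)) (0, h))) (at v)"
  proof (rule has_derivative_compose[where f = "Pair k" and g = "\<lambda>(k, v). jacobi_am k v"])
    show "(Pair k has_derivative (\<lambda>h. (0, h))) (at v)"
      by (auto intro!: derivative_eq_intros)
  qed (rule jacobi_am_has_derivative[OF k])
  moreover have "(\<lambda>h. h / ellw k (jacobi_am k v)) = (*) (1 / ellw k (jacobi_am k v))" by auto
  ultimately show ?thesis by (simp add: has_field_derivative_def)
qed

lemma dn_eq: "dn v k = 1 / ellw k (jacobi_am k v)"
  by (simp add: dn_def ellw_def)

lemma dn_pos: "\<bar>k\<bar> < 1 \<Longrightarrow> 0 < dn v k"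
  by (simp add: dn_eq ellw_pos)

lemma dn_sq: "\<bar>k\<bar> < 1 \<Longrightarrow> (dn v k)\<^sup>2 = 1 - k\<^sup>2 * (sin (jacobi_am k v))\<^sup>2"
  using modulus_pos[of k "jacobi_am k v"] by (simp add: dn_def)

lemma am_has_derivative [derivative_intros]:
  assumes "\<bar>k\<bar> < 1" "(f has_real_derivative f') (at x within S)"
  shows "((\<lambda>x. jacobi_am k (f x)) has_real_derivative dn (f x) k * f') (at x within S)"
  using DERIV_chain2[OF jacobi_am_has_real_derivative[OF assms(1)] assms(2)] by (simp add: dn_eq)

lemma dn_has_derivative [derivative_intros]:
  assumes k: "\<bar>k\<bar> < 1" and f: "(f has_real_derivative f') (at x within S)"
  shows "((\<lambda>x. dn (f x) k) has_real_derivative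
    - k\<^sup>2 * sin (jacobi_am k (f x)) * cos (jacobi_am k (f x)) * f') (at x within S)"
  unfolding dn_def using dn_pos[OF k, of "f x"] modulus_pos[OF k, of "jacobi_am k (f x)"]
  by (auto intro!: derivative_eq_intros k f simp: dn_def field_simps)

text \<open>The integrand has period \<open>pi\<close>, so the increment over \<open>pi\<close> does
  not depend on the starting point; from \<open>- pi / 2\<close> it equals \<open>2 * ellK k\<close>
  by oddness.\<close>

lemma ellF_add_pi:
  assumes k: "\<bar>k\<bar> < 1" shows "ellF k (\<theta> + pi) = ellF k \<theta> + 2 * ellK k"
proof -
  have "((\<lambda>\<theta>. ellF k (\<theta> + pi) - ellF k \<theta>) has_real_derivative 0) (at \<theta>)" for \<theta>
  proof -
    have "((\<lambda>\<theta>. ellF k (\<theta> + pi)) has_real_derivative ellw k (\<theta> + pi)) (at \<theta>)"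
      using ellF_has_derivative[OF k, of "\<theta> + pi"] DERIV_shift by blast
    from DERIV_diff[OF this ellF_has_derivative[OF k]] show ?thesis by (simp add: ellw_def)
  qed
  then have "ellF k (\<theta> + pi) - ellF k \<theta> = ellF k (- (pi / 2) + pi) - ellF k (- (pi / 2))"
    using DERIV_isconst_all[of "\<lambda>\<theta>. ellF k (\<theta> + pi) - ellF k \<theta>"] by blast
  then show ?thesis by (simp add: ellK_eq_ellI ellF_eq_ellI ellI_minus)
qed

lemma jacobi_am_add_2K:
  assumes k: "\<bar>k\<bar> < 1" shows "jacobi_am k (v + 2 * ellK k) = jacobi_am k v + pi"
  by (metis assms ellF_add_pi ellF_jacobi_am jacobi_am_ellF)

lemma jacobi_am_minus:
  assumes k: "\<bar>k\<bar> < 1" shows "jacobi_am k (- v) = - jacobi_am k v"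
  by (metis assms ellF_eq_ellI ellI_minus ellF_jacobi_am jacobi_am_ellF)

lemma ellK_ge: "\<bar>k\<bar> < 1 \<Longrightarrow> pi / 2 \<le> ellK k"
  using ellF_minus_mono[of k 0 "pi / 2"] by (simp add: ellK_eq_ellI ellF_eq_ellI)

lemma ellK_pos: "\<bar>k\<bar> < 1 \<Longrightarrow> 0 < ellK k"
  using ellK_ge[of k] pi_gt_zero by linarith

lemma ellF_0_left: "ellF 0 \<theta> = \<theta>"
proof -
  have "((\<lambda>\<theta>. ellF 0 \<theta> - \<theta>) has_real_derivative 0) (at \<theta>)" for \<theta>
    by (auto intro!: derivative_eq_intros ellF_has_derivative simp: ellw_def)
  then have "ellF 0 \<theta> - \<theta> = ellF 0 0 - 0"
    using DERIV_isconst_all[of "\<lambda>\<theta>. ellF 0 \<theta> - \<theta>"] by blast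
  then show ?thesis by simp
qed

lemma jacobi_am_0_left: "jacobi_am 0 v = v"
  by (metis abs_zero ellF_0_left jacobi_am_ellF zero_less_one)

lemma ellK_0: "ellK 0 = pi / 2"
  by (simp add: ellK_eq_ellI flip: ellF_eq_ellI add: ellF_0_left)

text \<open>The Wallis integral of \<open>sin\<^sup>2\<close> supplies the first correction to \<open>K(k)\<close>.\<close>

lemma ellK_lower_bound:
  assumes k: "\<bar>k\<bar> < 1" shows "pi / 2 * (1 + k\<^sup>2 / 4) \<le> ellK k"
proof -
  \<comment> \<open>\<open>k^2 / 4 * (\<theta> - sin \<theta> * cos \<theta>)\<close> is the
    antiderivative of \<open>k^2 sin^2 / 2\<close>, the linear term in the binomial series of the
    integrand; its value at \<open>pi / 2\<close> is \<open>k^2 * pi / 8\<close>.\<close>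
  let ?h = "\<lambda>\<theta>. ellF k \<theta> - \<theta> - k\<^sup>2 / 4 * (\<theta> - sin \<theta> * cos \<theta>)"
  have "?h 0 \<le> ?h (pi / 2)"
  proof (rule DERIV_nonneg_imp_nondecreasing[where f = ?h])
    fix \<theta> :: real
    define z where "z = k\<^sup>2 * (sin \<theta>)\<^sup>2"
    have z: "0 \<le> z" "z < 1" using modulus_pos[OF k, of \<theta>] by (auto simp: z_def)
    have "(1 + z / 2) * sqrt (1 - z) \<le> 1"
    proof (rule power2_le_imp_le)
      have "((1 + z / 2) * sqrt (1 - z))\<^sup>2 = (1 + z / 2)\<^sup>2 * (1 - z)" using z by (simp add: power_mult_distrib)
      also have "\<dots> = 1 - z\<^sup>2 * (3 + z) / 4" by (simp add: power2_eq_square field_simps)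
      also have "\<dots> \<le> 1\<^sup>2" using z by simp
      finally show "((1 + z / 2) * sqrt (1 - z))\<^sup>2 \<le> 1\<^sup>2" .
    qed simp
    then have w: "1 + z / 2 \<le> ellw k \<theta>" using z by (simp add: ellw_def z_def field_simps)
    have h': "(?h has_real_derivative ellw k \<theta> - 1 - k\<^sup>2 / 4 * (1 - (cos \<theta> * cos \<theta> - sin \<theta> * sin \<theta>))) (at \<theta>)"
      by (auto intro!: derivative_eq_intros ellF_has_derivative k)
    have "cos \<theta> * cos \<theta> = 1 - sin \<theta> * sin \<theta>"
      using sin_cos_squared_add[of \<theta>] by (simp add: power2_eq_square)
    then have "k\<^sup>2 / 4 * (1 - (cos \<theta> * cos \<theta> - sin \<theta> * sin \<theta>)) = z / 2"
      by (simp add: z_def power2_eq_square)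
    with h' w show "\<exists>y. (?h has_real_derivative y) (at \<theta>) \<and> 0 \<le> y" by fastforce
  qed simp
  then show ?thesis by (simp add: ellK_eq_ellI ellF_eq_ellI field_simps)
qed

section \<open>The wave profile\<close>

text \<open>The terms containing \<open>ellE\<close> in \<open>wave_a\<close> and \<open>wave_phi\<close> cancel.\<close>

lemma wave_phi_eq:
  assumes k: "\<bar>k\<bar> < 1" and L: "L \<noteq> 0"
  shows "wave_phi L k x = - (1 / (3 * L\<^sup>2)) * (- 32 * (2 - k\<^sup>2) * (ellK k)\<^sup>2 + 3/2 * L\<^sup>2 - 1/2 * sqrt (wave_R L k))
    - 32 * (ellK k)\<^sup>2 / L\<^sup>2 * (dn (2 * ellK k * x / L) k)\<^sup>2"
  using ellK_pos[OF k] L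
  by (simp add: wave_phi_def wave_a_def wave_b_def power2_eq_square field_simps)

text \<open>Admitting all \<open>\<bar>k\<bar> < 1\<close> makes the degenerate case
  \<open>k = 0\<close>, where the wave is constant, an instance that can serve as the limit.\<close>

locale wave_param =
  fixes L k :: real
  assumes L: "L > 0" and k: "\<bar>k\<bar> < 1"
begin

definition wave_am :: "real \<Rightarrow> real" where
  "wave_am x = jacobi_am k (2 * ellK k * x / L)"

definition wave_dn :: "real \<Rightarrow> real" where
  "wave_dn x = dn (2 * ellK k * x / L) k"

definition lam :: real where "lam = 2 * ellK k / L"

lemma wave_am_has_derivative:
  "(wave_am has_real_derivative wave_dn x * lam) (at x)"
  unfolding wave_am_def[abs_def] wave_dn_def lam_def using L
  by (auto intro!: derivative_eq_intros k)

lemma wave_dn_has_derivative: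
  "(wave_dn has_real_derivative - k\<^sup>2 * sin (wave_am x) * cos (wave_am x) * lam) (at x)"
  unfolding wave_am_def wave_dn_def[abs_def] lam_def using L
  by (auto intro!: derivative_eq_intros k)

lemma wave_dn_sq: "(wave_dn x)\<^sup>2 = 1 - k\<^sup>2 * (sin (wave_am x))\<^sup>2"
  unfolding wave_am_def wave_dn_def by (rule dn_sq[OF k])

lemma wave_am_periodic: "wave_am (x + L) = wave_am x + pi"
proof -
  have "2 * ellK k * (x + L) / L = 2 * ellK k * x / L + 2 * ellK k" using L by (simp add: field_simps)
  then show ?thesis by (simp add: wave_am_def jacobi_am_add_2K[OF k])
qed

lemma wave_am_minus: "wave_am (- x) = - wave_am x"
  by (simp add: wave_am_def jacobi_am_minus[OF k])

text \<open>Both this and \<open>wave_mean\<close> come from inserting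
  \<open>dn^2 = 1 - k^2 / 2 + k^2 / 2 * cos (2 am)\<close> into the term
  \<open>- 32 K^2 / L^2 * dn^2\<close>; \<open>wave_mean\<close> is the constant term of the
  result.\<close>

definition "wave_beta = - 16 * (ellK k)\<^sup>2 * k\<^sup>2 / L\<^sup>2"

definition "wave_mean = - (1 / (3 * L\<^sup>2)) * (- 32 * (2 - k\<^sup>2) * (ellK k)\<^sup>2 + 3/2 * L\<^sup>2 - 1/2 * sqrt (wave_R L k))
    - 32 * (ellK k)\<^sup>2 / L\<^sup>2 - wave_beta"

text \<open>The factor \<open>wave_beta\<close>, of order \<open>k^2\<close>, is split off exactly
  from a profile \<open>cos (2 am)\<close> that stays nontrivial at \<open>k = 0\<close>. This
  allows errors to be measured relative to the amplitude.\<close>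

lemma wave_phi_cos: "wave_phi L k x = wave_mean + wave_beta * cos (2 * wave_am x)"
proof -
  have "wave_phi L k x = wave_mean + wave_beta + 32 * (ellK k)\<^sup>2 / L\<^sup>2 * (1 - (wave_dn x)\<^sup>2)"
    using L by (simp add: wave_phi_eq[OF k] wave_mean_def wave_dn_def right_diff_distrib)
  also have "\<dots> = wave_mean + wave_beta * (1 - 2 * (sin (wave_am x))\<^sup>2)"
    unfolding wave_dn_sq wave_beta_def by (simp add: field_simps) (simp add: diff_divide_distrib)
  finally show ?thesis by (simp add: cos_double_sin)
qed

definition wave_phi' :: "real \<Rightarrow> real" where
  "wave_phi' x = - wave_beta * sin (2 * wave_am x) * (2 * (wave_dn x * lam))"

text \<open>With \<open>y = dn^2\<close> and \<open>P(y) = (1 - y) (y - (1 - k^2)) y\<close> one has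
  \<open>y'^2 = 4 lam^2 P(y)\<close>, hence \<open>y'' = 2 lam^2 P'(y)\<close>; the three products
  are the terms of \<open>P'\<close>. In this form the profile equation becomes polynomial in
  \<open>y\<close>.\<close>

definition wave_phi'' :: "real \<Rightarrow> real" where
  "wave_phi'' x = - 32 * (ellK k)\<^sup>2 / L\<^sup>2 * lam\<^sup>2 * (2 * ((1 - (wave_dn x)\<^sup>2) * (wave_dn x)\<^sup>2
    + (1 - (wave_dn x)\<^sup>2) * ((wave_dn x)\<^sup>2 - (1 - k\<^sup>2)) - ((wave_dn x)\<^sup>2 - (1 - k\<^sup>2)) * (wave_dn x)\<^sup>2))"

lemma wave_phi_has_derivative: "(wave_phi L k has_real_derivative wave_phi' x) (at x)"
  unfolding wave_phi_cos[abs_def] wave_phi'_def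
  by (auto intro!: derivative_eq_intros wave_am_has_derivative)

lemma wave_phi'_has_derivative: "(wave_phi' has_real_derivative wave_phi'' x) (at x)"
proof -
  define s c d where "s = sin (wave_am x)" and "c = cos (wave_am x)" and "d = wave_dn x"
  have "(wave_phi' has_real_derivative
     - wave_beta * (cos (2 * wave_am x) * (2 * (d * lam))) * (2 * (d * lam)) +
     - wave_beta * sin (2 * wave_am x) * (2 * ((- k\<^sup>2 * s * c * lam) * lam))) (at x)"
    unfolding wave_phi'_def[abs_def]
    unfolding s_def c_def d_def
    by (rule derivative_eq_intros wave_am_has_derivative wave_dn_has_derivative refl | simp)+
  moreover have "- wave_beta * (cos (2 * wave_am x) * (2 * (d * lam))) * (2 * (d * lam)) +
     - wave_beta * sin (2 * wave_am x) * (2 * ((- k\<^sup>2 * s * c * lam) * lam)) = wave_phi'' x"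
  proof -
    define z where "z = s\<^sup>2"
    have c2: "c\<^sup>2 = 1 - z" by (simp add: z_def s_def c_def cos_squared_eq)
    have cs: "cos (2 * wave_am x) = 1 - 2 * z" by (simp add: cos_double_sin z_def s_def)
    have sn: "sin (2 * wave_am x) = 2 * s * c" by (simp add: sin_double s_def c_def)
    have d2: "d\<^sup>2 = 1 - k\<^sup>2 * z" by (simp add: wave_dn_sq z_def d_def s_def)
    have "- wave_beta * (cos (2 * wave_am x) * (2 * (d * lam))) * (2 * (d * lam)) +
     - wave_beta * sin (2 * wave_am x) * (2 * ((- k\<^sup>2 * s * c * lam) * lam))
     = - wave_beta * lam\<^sup>2 * (4 * (1 - 2 * z) * d\<^sup>2 - 4 * k\<^sup>2 * (s\<^sup>2 * c\<^sup>2))"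
      unfolding cs sn by (simp add: algebra_simps power2_eq_square)
    also have "\<dots> = wave_phi'' x"
      unfolding wave_phi''_def d_def[symmetric] d2 c2 z_def[symmetric] wave_beta_def
      by (simp add: algebra_simps power2_eq_square)
    finally show ?thesis .
  qed
  ultimately show ?thesis by simp
qed

lemma deriv_wave_phi: "deriv (wave_phi L k) = wave_phi'"
  using DERIV_imp_deriv[OF wave_phi_has_derivative] by blast

lemma deriv_wave_phi': "deriv wave_phi' = wave_phi''"
  using DERIV_imp_deriv[OF wave_phi'_has_derivative] by blast

text \<open>The square, unlike \<open>wave_phi'\<close> itself, is a polynomial in
  \<open>dn^2\<close>, and only the square occurs in the profile equation.\<close>

lemma wave_phi'_sq: "(wave_phi' x)\<^sup>2 = (32 * (ellK k)\<^sup>2 / L\<^sup>2)\<^sup>2 * lam\<^sup>2 *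
   (4 * (1 - (wave_dn x)\<^sup>2) * ((wave_dn x)\<^sup>2 - (1 - k\<^sup>2)) * (wave_dn x)\<^sup>2)"
proof -
  define s c d where "s = sin (wave_am x)" and "c = cos (wave_am x)" and "d = wave_dn x"
  have c2: "1 - s\<^sup>2 = c\<^sup>2" by (simp add: s_def c_def cos_squared_eq)
  have d1: "1 - d\<^sup>2 = k\<^sup>2 * s\<^sup>2" by (simp add: wave_dn_sq d_def s_def)
  have d2: "d\<^sup>2 - (1 - k\<^sup>2) = k\<^sup>2 * c\<^sup>2" by (simp add: wave_dn_sq d_def s_def algebra_simps flip: c2)
  show ?thesis
    unfolding wave_phi'_def sin_double d_def[symmetric] s_def[symmetric] c_def[symmetric] d1 d2 wave_beta_def
    by (simp add: power_mult_distrib power_divide field_simps)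
qed

text \<open>\<open>sin am\<close>, \<open>cos am\<close> and \<open>dn\<close> form a closed
  differential system, because \<open>am'\<close> is a multiple of \<open>dn\<close> and
  \<open>dn'\<close> a multiple of \<open>sin am * cos am\<close>.\<close>

lemma smooth_wave_phi: "smooth_on UNIV (wave_phi L k)"
proof -
  let ?G = "{\<lambda>x. sin (wave_am x), \<lambda>x. cos (wave_am x), wave_dn}"
  have G: "(\<lambda>x. sin (wave_am x)) \<in> gen_algebra ?G" "(\<lambda>x. cos (wave_am x)) \<in> gen_algebra ?G"
     "wave_dn \<in> gen_algebra ?G" by (auto intro: gen_algebra.gen)
  show ?thesis
  proof (rule smooth_on_gen_algebra_real[where G = ?G])
    fix g assume "g \<in> ?G"
    then consider "g = (\<lambda>x. sin (wave_am x))" | "g = (\<lambda>x. cos (wave_am x))" | "g = wave_dn" by blast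
    then show "\<exists>g'\<in>gen_algebra ?G. \<forall>x. (g has_real_derivative g' x) (at x)"
    proof cases
      case 1
      show ?thesis unfolding 1
        by (rule bexI[of _ "\<lambda>x. cos (wave_am x) * (wave_dn x * lam)"])
          (auto intro!: derivative_eq_intros wave_am_has_derivative gen_algebra.const gen_algebra.mult G)
    next
      case 2
      show ?thesis unfolding 2
        by (rule bexI[of _ "\<lambda>x. - (sin (wave_am x) * (wave_dn x * lam))"])
          (auto intro!: derivative_eq_intros wave_am_has_derivative gen_algebra.const gen_algebra.mult gen_algebra_minus G)
    next
      case 3
      show ?thesis unfolding 3
        by (rule bexI[of _ "\<lambda>x. - k\<^sup>2 * sin (wave_am x) * cos (wave_am x) * lam"])
          (use wave_dn_has_derivative in \<open>auto intro!: gen_algebra.const gen_algebra.mult gen_algebra_minus G\<close>)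
    qed
  next
    have "L \<noteq> 0" using L by simp
    show "wave_phi L k \<in> gen_algebra ?G"
      unfolding wave_phi_eq[OF k \<open>L \<noteq> 0\<close>, abs_def] wave_dn_def[symmetric] by (intro gen_algebra_intros G)
  qed
qed

lemma periodic_wave_phi: "periodic L (wave_phi L k)"
  using cos_periodic by (simp add: periodic_def wave_phi_cos wave_am_periodic distrib_left)

lemma wave_phi_minus: "wave_phi L k (- x) = wave_phi L k x"
  by (simp add: wave_phi_cos wave_am_minus)

end

text \<open>Here \<open>u = K^2 / L^2\<close>, \<open>m = k^2\<close> and \<open>y = dn^2\<close>.
  The defect \<open>27 (?l - A)\<close> is divisible by the quadratic polynomial that
  \<open>c\<close> annihilates, with cofactor \<open>c - 3 p - 6\<close>; so the square root in
  \<open>c\<close> enters only through that relation.\<close>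

lemma ode_identity:
  fixes u c m y :: real
  assumes c: "c\<^sup>2 - 3 * c = - 512 * (1 - m + m\<^sup>2) * u\<^sup>2"
    and \<phi>: "3 * \<phi> = 32 * (2 - m) * u - c - 96 * u * y"
    and A: "27 * A = (9 - 1280 * (1 - m + m\<^sup>2) * u\<^sup>2) * (3 - 2 * c)
      + (- 16384 + 24576 * m + 24576 * m\<^sup>2 - 16384 * m^3) * u^3 + 6912 * (1 - m + m\<^sup>2) * u\<^sup>2 - 27"
  shows "(\<phi> - c) * (-32 * u * (4 * u) * (2 * ((1 - y) * y + (1 - y) * (y - (1 - m)) - (y - (1 - m)) * y)))
    + (32 * u)\<^sup>2 * (4 * u) * (4 * (1 - y) * (y - (1 - m)) * y) / 2 - \<phi>^3 + c * \<phi> = A" (is "?l = A")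
proof -
  define p where "p = 32 * (2 - m) * u - 96 * u * y"
  define X where "X = p - c"
  define Y where "Y = (1 - y) * y + (1 - y) * (y - (1 - m)) - (y - (1 - m)) * y"
  define Z where "Z = (1 - y) * (y - (1 - m)) * y"
  have \<phi>': "\<phi> = X / 3" using \<phi> by (simp add: X_def p_def)
  have 1: "27 * ?l = - 9 * (X - 3 * c) * (256 * u\<^sup>2 * Y) + 27 * (8192 * u^3 * Z) - X^3 + 9 * c * X"
    unfolding \<phi>' Y_def[symmetric]
    by (simp add: Z_def[symmetric] field_simps power2_eq_square power3_eq_cube) (simp add: Z_def algebra_simps)
  have "- 9 * (X - 3 * c) * (256 * u\<^sup>2 * Y) + 27 * (8192 * u^3 * Z) - X^3 + 9 * c * X - 27 * A
    = (c\<^sup>2 - 3 * c + 512 * (1 - m + m\<^sup>2) * u\<^sup>2) * (c - 3 * p - 6)"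
    unfolding A X_def p_def Y_def Z_def by algebra
  also have "c\<^sup>2 - 3 * c + 512 * (1 - m + m\<^sup>2) * u\<^sup>2 = 0" using c by linarith
  finally have "27 * ?l - 27 * A = 0" unfolding 1 by simp
  moreover have "a = b" if "27 * a - 27 * b = 0" for a b :: real using that by simp
  ultimately show ?thesis by blast
qed

text \<open>\<open>wave_c\<close> is the smaller root in the quadratic formula with discriminant
  \<open>wave_R L k / L^4\<close>.\<close>

lemma wave_c_relation:
  assumes "L > 0" "wave_R L k \<ge> 0"
  shows "(wave_c L k)\<^sup>2 - 3 * wave_c L k = - 512 * (1 - k\<^sup>2 + k^4) * (ellK k)^4 / L^4"
proof -
  define s where "s = sqrt (wave_R L k)"
  have "s\<^sup>2 = 9 * L^4 - 2048 * (1 - k\<^sup>2 + k^4) * (ellK k)^4"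
    using assms(2) by (simp add: s_def wave_R_def)
  moreover have "((wave_c L k)\<^sup>2 - 3 * wave_c L k) * L^4 = s\<^sup>2 / 4 - 9 / 4 * L^4"
    unfolding wave_c_def s_def[symmetric] using assms(1)
    by (simp add: field_simps power2_eq_square power4_eq_xxxx)
  ultimately have "((wave_c L k)\<^sup>2 - 3 * wave_c L k) * L^4 = - 512 * (1 - k\<^sup>2 + k^4) * (ellK k)^4"
    by (simp add: algebra_simps)
  then show ?thesis using assms(1) by (simp add: eq_divide_eq)
qed

lemma (in wave_param) wave_ode:
  assumes R: "wave_R L k \<ge> 0"
  shows "(wave_phi L k x - wave_c L k) * wave_phi'' x + (wave_phi' x)\<^sup>2 / 2 - (wave_phi L k x)^3
             + wave_c L k * wave_phi L k x = wave_A L k"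
proof -
  define u where "u = (ellK k)\<^sup>2 / L\<^sup>2"
  have lam: "lam\<^sup>2 = 4 * u" by (simp add: lam_def u_def power_divide power_mult_distrib)
  have u2: "(ellK k)^4 / L^4 = u\<^sup>2" by (simp add: u_def power_divide flip: power_mult)
  have u3: "(ellK k)^6 / L^6 = u^3" by (simp add: u_def power_divide flip: power_mult)
  have b: "- 32 * (ellK k)\<^sup>2 / L\<^sup>2 = - 32 * u" "32 * (ellK k)\<^sup>2 / L\<^sup>2 = 32 * u" by (auto simp: u_def)
  have k4: "k^4 = (k\<^sup>2)\<^sup>2" "k^6 = (k\<^sup>2)^3" by (simp_all flip: power_mult)
  have s: "sqrt (wave_R L k) = L\<^sup>2 * (3 - 2 * wave_c L k)"
    using L by (simp add: wave_c_def field_simps)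
  have 1: "(wave_c L k)\<^sup>2 - 3 * wave_c L k = - 512 * (1 - k\<^sup>2 + (k\<^sup>2)\<^sup>2) * u\<^sup>2"
    using wave_c_relation[OF L R] by (simp add: times_divide_eq_right[symmetric] u2 del: times_divide_eq_right)
  have L0: "L \<noteq> 0" using L by simp
  have 2: "3 * wave_phi L k x = 32 * (2 - k\<^sup>2) * u - wave_c L k - 96 * u * (wave_dn x)\<^sup>2"
    unfolding wave_phi_eq[OF k L0] s u_def wave_dn_def using L by (simp add: field_simps)
  have 3: "27 * wave_A L k = (9 - 1280 * (1 - k\<^sup>2 + (k\<^sup>2)\<^sup>2) * u\<^sup>2) * (3 - 2 * wave_c L k)
      + (- 16384 + 24576 * k\<^sup>2 + 24576 * (k\<^sup>2)\<^sup>2 - 16384 * (k\<^sup>2)^3) * u^3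
      + 6912 * (1 - k\<^sup>2 + (k\<^sup>2)\<^sup>2) * u\<^sup>2 - 27" (is "_ = ?r")
  proof -
    define S where "S = 3 - 2 * wave_c L k"
    have gen: "27 * (1 / (27 * L^6) * X) = X / L^6" for X by simp
    have K4: "(ellK k)^4 = u\<^sup>2 * L^4" "(ellK k)^6 = u^3 * L^6" using u2 u3 L0 by (simp_all add: field_simps)
    have "27 * wave_A L k = ((9 * L^4 - 1280 * (1 - k\<^sup>2 + (k\<^sup>2)\<^sup>2) * (u\<^sup>2 * L^4)) * (L\<^sup>2 * S)
        + (- 16384 + 24576 * k\<^sup>2 + 24576 * (k\<^sup>2)\<^sup>2 - 16384 * (k\<^sup>2)^3) * (u^3 * L^6)
        + 6912 * L\<^sup>2 * (1 - k\<^sup>2 + (k\<^sup>2)\<^sup>2) * (u\<^sup>2 * L^4) - 27 * L^6) / L^6"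
      unfolding wave_A_def s K4 k4 S_def[symmetric] by (rule gen)
    also have "\<dots> = (L^6 * ?r) / L^6"
      unfolding S_def[symmetric] by (rule arg_cong[where f = "\<lambda>x. x / L^6"]) algebra
    finally show ?thesis using L0 by simp
  qed
  show ?thesis
    unfolding wave_phi''_def wave_phi'_sq lam b by (rule ode_identity[OF 1 2 3])
qed

text \<open>By \<open>wave_c_relation\<close> the claim is
  \<open>pi^4 / 16 < (1 - m + m^2) K^4\<close> with \<open>m = k^2\<close>. The bound
  \<open>pi / 2 \<le> K\<close> is too weak, since \<open>1 - m + m^2 < 1\<close>. With the
  corrected bound the terms linear in \<open>m\<close> cancel in
  \<open>(1 - m + m^2) (1 + m / 4)^4\<close>, and all further terms are positive.\<close>

lemma wave_c_inequality:
  assumes L: "L > 0" and R: "wave_R L k \<ge> 0" and k: "0 < k" "k < 1"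
  shows "(wave_c L k)\<^sup>2 - 3 * wave_c L k + 32 * pi^4 / L^4 < 0"
proof -
  define m where "m = k\<^sup>2"
  have m: "0 < m" "m < 1" using k by (auto simp: m_def power2_less_1_iff abs_less_iff power_less_one_iff)
  have "pi / 2 * (1 + m / 4) \<le> ellK k" using ellK_lower_bound[of k] k by (simp add: m_def)
  then have "(pi / 2 * (1 + m / 4))^4 \<le> (ellK k)^4" using m by (intro power_mono) auto
  have "1 < (1 - m + m\<^sup>2) * (1 + m / 4)^4"
  proof -
    have "(1 - m + m\<^sup>2) * (1 + m / 4)^4 - 1 = m\<^sup>2 * (3/8 + 11/16 * m + 81/256 * m\<^sup>2 + 15/256 * m^3 + 1/256 * m^4)"
      by (simp add: power2_eq_square power4_eq_xxxx power3_eq_cube field_simps)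
    also have "\<dots> > 0" using m by (intro mult_pos_pos add_pos_pos) auto
    finally show ?thesis by simp
  qed
  have mm: "0 < 1 - m + m\<^sup>2" using m by (simp add: add_pos_pos)
  have "pi^4 / 16 < pi^4 / 16 * ((1 - m + m\<^sup>2) * (1 + m / 4)^4)"
    using \<open>1 < (1 - m + m\<^sup>2) * (1 + m / 4)^4\<close> by (simp add: )
  also have "\<dots> = (1 - m + m\<^sup>2) * (pi / 2 * (1 + m / 4))^4"
    by (simp add: power_mult_distrib power_divide)
  also have "\<dots> \<le> (1 - m + m\<^sup>2) * (ellK k)^4"
    using \<open>(pi / 2 * (1 + m / 4))^4 \<le> (ellK k)^4\<close> mm by (intro mult_left_mono) auto
  finally have "pi^4 / 16 < (1 - m + m\<^sup>2) * (ellK k)^4" .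
  moreover have "m\<^sup>2 = k^4" by (simp add: m_def flip: power_mult)
  ultimately have "pi^4 / 16 < (1 - k\<^sup>2 + k^4) * (ellK k)^4" by (simp only: m_def)
  then have "32 * pi^4 < 512 * ((1 - k\<^sup>2 + k^4) * (ellK k)^4)" by linarith
  then have "32 * pi^4 / L^4 < 512 * ((1 - k\<^sup>2 + k^4) * (ellK k)^4) / L^4"
    using L by (intro divide_strict_right_mono) auto
  moreover have "- 512 * (1 - k\<^sup>2 + k^4) * (ellK k)^4 / L^4 = - (512 * ((1 - k\<^sup>2 + k^4) * (ellK k)^4) / L^4)"
    by (simp only: mult_minus_left minus_divide_left mult.assoc)
  ultimately show ?thesis unfolding wave_c_relation[OF L R] by linarith
qed

section \<open>Smooth dependence on the modulus\<close>

lemma has_derivative_compose_fst: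
  fixes F :: "real \<Rightarrow> real \<Rightarrow> real" and a :: "real \<times> real \<Rightarrow> real"
  assumes "((\<lambda>(k, \<theta>). F k \<theta>) has_derivative (\<lambda>(dk, d\<theta>). A * dk + B * d\<theta>)) (at (fst z, a z))"
    and "(a has_derivative a') (at z)"
  shows "((\<lambda>z. F (fst z) (a z)) has_derivative (\<lambda>v. A * fst v + B * a' v)) (at z)"
proof -
  have "((\<lambda>z. (fst z, a z)) has_derivative (\<lambda>v. (fst v, a' v))) (at z)"
    by (intro derivative_intros assms)
  from has_derivative_compose[OF this assms(1)] show ?thesis by simp
qed

lemma has_derivative_inverse_real:
  fixes f :: "'a::real_normed_vector \<Rightarrow> real"
  assumes "(f has_derivative f') (at z)" "f z \<noteq> 0"
  shows "((\<lambda>z. inverse (f z)) has_derivative (\<lambda>v. - (f' v * (inverse (f z))\<^sup>2))) (at z)"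
  using Deriv.has_derivative_inverse[OF assms(2,1)] by (simp add: power2_eq_square mult_ac)

text \<open>\<open>T\<close> will be a neighbourhood of \<open>0\<close> on which
  \<open>wave_R\<close> is positive, so that its square root is smooth there.\<close>

locale wave_family =
  fixes L :: real and T :: "real set"
  assumes L: "L > 0" and T: "open T" "T \<subseteq> {-1<..<1}" and R: "\<And>k. k \<in> T \<Longrightarrow> wave_R L k > 0"
begin

definition "j_am z = jacobi_am (fst z) (2 * ellK (fst z) * snd z / L)"
definition "j_sin z = sin (j_am z)"
definition "j_cos z = cos (j_am z)"
definition "j_dn z = dn (2 * ellK (fst z) * snd z / L) (fst z)"
definition "j_nd z = inverse (j_dn z)"
definition "j_K j z = ellI j (fst z) (pi / 2)" for z :: "real \<times> real"
definition "j_I j z = ellI j (fst z) (j_am z)"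
definition "j_R z = sqrt (wave_R L (fst z))" for z :: "real \<times> real"
definition "j_iR z = inverse (j_R z)"

text \<open>A system closed under differentiation in \<open>(k, x)\<close>. Each
  \<open>k\<close>-derivative of an elliptic integral raises \<open>j\<close>, hence the whole
  sequences \<open>j_K\<close> and \<open>j_I\<close>; the reciprocals come from
  \<open>ellw = 1 / dn\<close> and from differentiating the square roots.\<close>

definition "gens = {fst, snd, j_sin, j_cos, j_dn, j_nd, j_R, j_iR} \<union> range j_K \<union> range j_I"

text \<open>The derivative of the amplitude along \<open>v = (dk, dx)\<close>: the derivative of the
  argument \<open>2 K x / L\<close> minus the \<open>k\<close>-derivative of \<open>ellF\<close>,
  divided by \<open>ellw\<close>, which means multiplied by \<open>dn\<close>.\<close>

definition "d_am v z = j_dn z * ((2 * (fst z * j_K 1 z * fst v) * snd z + 2 * j_K 0 z * snd v) * (1 / L) - fst z * j_I 1 z * fst v)"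
definition "d_dn v z = - ((fst z * fst v * j_sin z ^ 2 + fst z ^ 2 * j_sin z * j_cos z * d_am v z) * j_nd z)"
definition "d_R v z = - 1024 * (((4 * fst z ^ 3 - 2 * fst z) * fst v) * j_K 0 z ^ 4
   + (1 - fst z ^ 2 + fst z ^ 4) * (4 * j_K 0 z ^ 3 * (fst z * j_K 1 z * fst v))) * j_iR z" for z :: "real \<times> real"

lemma gens_alg:
  "fst \<in> gen_algebra gens" "snd \<in> gen_algebra gens" "j_sin \<in> gen_algebra gens" "j_cos \<in> gen_algebra gens"
  "j_dn \<in> gen_algebra gens" "j_nd \<in> gen_algebra gens" "j_R \<in> gen_algebra gens" "j_iR \<in> gen_algebra gens"
  "j_K j \<in> gen_algebra gens" "j_I j \<in> gen_algebra gens"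
  unfolding gens_def by (auto intro!: gen_algebra.gen)

lemma d_alg: "d_am v \<in> gen_algebra gens" "d_dn v \<in> gen_algebra gens" "d_R v \<in> gen_algebra gens"
proof -
  show am: "d_am v \<in> gen_algebra gens"
    unfolding d_am_def[abs_def] by (intro gen_algebra_intros gens_alg)
  show "d_dn v \<in> gen_algebra gens"
    unfolding d_dn_def[abs_def] by (intro gen_algebra_intros gens_alg am)
  show "d_R v \<in> gen_algebra gens"
    unfolding d_R_def[abs_def] by (intro gen_algebra_intros gens_alg)
qed

context
  fixes z :: "real \<times> real"
  assumes z: "z \<in> T \<times> UNIV"
begin

lemma abs_fst: "\<bar>fst z\<bar> < 1"
  using z T(2) by (auto simp: mem_Times_iff abs_less_iff)

lemma K_deriv: "(j_K j has_derivative (\<lambda>v. (1 + 2 * real j) * fst z * j_K (Suc j) z * fst v)) (at z)"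
  unfolding j_K_def[abs_def]
  using has_derivative_compose_fst[OF ellI_has_derivative[OF abs_fst, of j "pi / 2"], where a' = "\<lambda>v. 0"]
  by simp

lemma am_deriv: "(j_am has_derivative (\<lambda>v. d_am v z)) (at z)"
proof -
  have K: "((\<lambda>z. ellK (fst z)) has_derivative (\<lambda>v. fst z * j_K 1 z * fst v)) (at z)"
    using K_deriv[of 0] by (simp add: ellK_eq_ellI j_K_def[abs_def])
  have "((\<lambda>z. 2 * ellK (fst z) * snd z / L) has_derivative
      (\<lambda>v. (2 * (fst z * j_K 1 z * fst v) * snd z + 2 * j_K 0 z * snd v) * (1 / L))) (at z)"
    using L by (auto intro!: derivative_eq_intros K simp: j_K_def field_simps simp flip: ellK_eq_ellI)
  moreover have w: "inverse (ellw (fst z) (j_am z)) = j_dn z"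
    by (simp add: j_am_def j_dn_def dn_eq inverse_eq_divide)
  have "((\<lambda>(k, v). jacobi_am k v) has_derivative
    (\<lambda>(dk, dv). (- (fst z * j_I 1 z * j_dn z)) * dk + j_dn z * dv)) (at (fst z, 2 * ellK (fst z) * snd z / L))"
    using jacobi_am_has_derivative[OF abs_fst, of "2 * ellK (fst z) * snd z / L"]
    unfolding j_am_def[symmetric] divide_inverse[of _ "ellw (fst z) (j_am z)"] w j_I_def
    by (simp add: algebra_simps del: times_divide_eq_left times_divide_eq_right)
  ultimately have "((\<lambda>z. jacobi_am (fst z) (2 * ellK (fst z) * snd z / L)) has_derivative
     (\<lambda>v. (- (fst z * j_I 1 z * j_dn z)) * fst v + j_dn z *
      ((2 * (fst z * j_K 1 z * fst v) * snd z + 2 * j_K 0 z * snd v) * (1 / L)))) (at z)"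
    by (intro has_derivative_compose_fst)
  then show ?thesis
    unfolding j_am_def[abs_def, symmetric] d_am_def by (simp add: algebra_simps)
qed

lemma I_deriv: "(j_I j has_derivative (\<lambda>v. (1 + 2 * real j) * fst z * j_I (Suc j) z * fst v
    + j_sin z ^ (2 * j) * j_nd z ^ (2 * j + 1) * d_am v z)) (at z)"
proof -
  have w: "ellw (fst z) (j_am z) = j_nd z"
    by (simp add: j_am_def j_dn_def j_nd_def dn_eq)
  show ?thesis
    unfolding j_I_def[abs_def]
    using has_derivative_compose_fst[OF ellI_has_derivative[OF abs_fst] am_deriv, of j]
    by (simp add: elle_def w j_sin_def)
qed

lemma sin_deriv: "(j_sin has_derivative (\<lambda>v. j_cos z * d_am v z)) (at z)"
  unfolding j_sin_def[abs_def] j_cos_def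
  by (auto intro!: derivative_eq_intros am_deriv)

lemma cos_deriv: "(j_cos has_derivative (\<lambda>v. - (j_sin z * d_am v z))) (at z)"
  unfolding j_cos_def[abs_def] j_sin_def
  by (auto intro!: derivative_eq_intros am_deriv)

lemma dn_deriv: "(j_dn has_derivative (\<lambda>v. d_dn v z)) (at z)"
proof -
  have j: "j_dn = (\<lambda>z. sqrt (1 - fst z ^ 2 * j_sin z ^ 2))"
    by (simp add: fun_eq_iff j_dn_def dn_def j_sin_def j_am_def)
  have p: "0 < 1 - fst z ^ 2 * j_sin z ^ 2"
    using modulus_pos[OF abs_fst] by (simp add: j_sin_def)
  have "((\<lambda>z. sqrt (1 - fst z ^ 2 * j_sin z ^ 2)) has_derivative
     (\<lambda>v. - (2 * fst v * fst z * j_sin z ^ 2 + fst z ^ 2 * (2 * (j_cos z * d_am v z) * j_sin z))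
       * (inverse (j_dn z) / 2))) (at z)"
    unfolding j using p
    by (auto intro!: derivative_eq_intros sin_deriv simp: field_simps)
  then show ?thesis
    unfolding j[symmetric]
    by (rule has_derivative_eq_rhs) (simp add: fun_eq_iff d_dn_def j_nd_def algebra_simps)
qed

lemma dn_nz: "j_dn z \<noteq> 0"
  using dn_pos[OF abs_fst] by (simp add: j_dn_def less_imp_neq[symmetric])

lemma nd_deriv: "(j_nd has_derivative (\<lambda>v. - (d_dn v z * (j_nd z)\<^sup>2))) (at z)"
  unfolding j_nd_def[abs_def]
  using has_derivative_inverse_real[OF dn_deriv dn_nz] by simp

lemma R_nz: "wave_R L (fst z) > 0"
  using R z by (auto simp: mem_Times_iff)

lemma R_deriv: "(j_R has_derivative (\<lambda>v. d_R v z)) (at z)"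
proof -
  have j: "j_R = (\<lambda>z. sqrt (9 * L^4 - 2048 * (1 - fst z^2 + fst z^4) * (j_K 0 z)^4))"
    by (simp add: fun_eq_iff j_R_def wave_R_def j_K_def ellK_eq_ellI)
  have p: "0 < 9 * L^4 - 2048 * (1 - fst z^2 + fst z^4) * (j_K 0 z)^4"
    using R_nz by (simp add: wave_R_def j_K_def ellK_eq_ellI)
  have "((\<lambda>z. sqrt (9 * L^4 - 2048 * (1 - fst z^2 + fst z^4) * (j_K 0 z)^4)) has_derivative
     (\<lambda>v. - (2048 * ((4 * fst z ^ 3 * fst v - 2 * fst z * fst v)) * j_K 0 z ^ 4
   + 2048 * (1 - fst z ^ 2 + fst z ^ 4) * (4 * j_K 0 z ^ 3 * (fst z * j_K 1 z * fst v)))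
       * (inverse (j_R z) / 2))) (at z)"
    unfolding j using p
    by (auto intro!: derivative_eq_intros K_deriv simp: field_simps)
  then show ?thesis
    unfolding j[symmetric]
    by (rule has_derivative_eq_rhs) (simp add: fun_eq_iff d_R_def j_iR_def algebra_simps)
qed

lemma iR_deriv: "(j_iR has_derivative (\<lambda>v. - (d_R v z * (j_iR z)\<^sup>2))) (at z)"
  unfolding j_iR_def[abs_def]
  using has_derivative_inverse_real[OF R_deriv] R_nz by (simp add: j_R_def)

end

lemma open_dom: "open (T \<times> (UNIV :: real set))"
  using T by (simp add: open_Times)

lemma smooth_alg:
  assumes "f \<in> gen_algebra gens" shows "smooth_on (T \<times> UNIV) f"
proof (rule smooth_on_gen_algebra[OF open_dom _ assms])
  fix g assume "g \<in> gens"
  then consider "g = fst" | "g = snd" | "g = j_sin" | "g = j_cos" | "g = j_dn" | "g = j_nd"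
    | "g = j_R" | "g = j_iR" | j where "g = j_K j" | j where "g = j_I j" by (auto simp: gens_def)
  then show "\<exists>g'. (\<forall>x\<in>T \<times> UNIV. (g has_derivative (\<lambda>v. g' v x)) (at x)) \<and> (\<forall>v. g' v \<in> gen_algebra gens)"
  proof cases
    case 1
    show ?thesis unfolding 1
      by (rule exI[of _ "\<lambda>v z. fst v"]) (auto intro!: gen_algebra.const derivative_intros)
  next
    case 2
    show ?thesis unfolding 2
      by (rule exI[of _ "\<lambda>v z. snd v"]) (auto intro!: gen_algebra.const derivative_intros)
  next
    case 3
    show ?thesis unfolding 3
      by (intro exI conjI ballI allI, erule sin_deriv) (intro gen_algebra_intros gens_alg d_alg)
  next
    case 4
    show ?thesis unfolding 4
      by (intro exI conjI ballI allI, erule cos_deriv) (intro gen_algebra_intros gens_alg d_alg)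
  next
    case 5
    show ?thesis unfolding 5
      by (intro exI conjI ballI allI, erule dn_deriv) (intro gen_algebra_intros gens_alg d_alg)
  next
    case 6
    show ?thesis unfolding 6
      by (intro exI conjI ballI allI, erule nd_deriv) (intro gen_algebra_intros gens_alg d_alg)
  next
    case 7
    show ?thesis unfolding 7
      by (intro exI conjI ballI allI, erule R_deriv) (intro gen_algebra_intros gens_alg d_alg)
  next
    case 8
    show ?thesis unfolding 8
      by (intro exI conjI ballI allI, erule iR_deriv) (intro gen_algebra_intros gens_alg d_alg)
  next
    case 9
    show ?thesis unfolding 9
      by (intro exI conjI ballI allI, erule K_deriv) (intro gen_algebra_intros gens_alg d_alg)
  next
    case 10
    show ?thesis unfolding 10
      by (intro exI conjI ballI allI, erule I_deriv) (intro gen_algebra_intros gens_alg d_alg)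
  qed
qed

lemma smooth_wave_family: "smooth_on (T \<times> UNIV) (\<lambda>(k, x). wave_phi L k x)"
proof (rule smooth_on_cong[OF open_dom])
  let ?f = "\<lambda>z. - (1 / (3 * L\<^sup>2)) * (- 32 * (2 - fst z ^ 2) * j_K 0 z ^ 2 + 3/2 * L\<^sup>2 - 1/2 * j_R z)
    - 32 * j_K 0 z ^ 2 * (1 / L\<^sup>2) * j_dn z ^ 2"
  show "smooth_on (T \<times> UNIV) ?f"
    by (rule smooth_alg) (intro gen_algebra_intros gens_alg)
  fix z assume z: "z \<in> T \<times> (UNIV :: real set)"
  then show "?f z = (\<lambda>(k, x). wave_phi L k x) z"
    using L by (simp add: wave_phi_eq[OF abs_fst[OF z]] case_prod_unfold j_K_def ellK_eq_ellI j_R_def j_dn_def)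
qed

lemma continuous_alg: "f \<in> gen_algebra gens \<Longrightarrow> continuous_on (T \<times> UNIV) f"
  using smooth_alg[of f] unfolding smooth_on_def by (metis higher_differentiable_on.simps(1))

end

section \<open>Integration over one period\<close>

text \<open>Integrals over a period become integrals for one finite measure, so bounded measurable
  functions are integrable and values outside \<open>{0..L}\<close> are invisible.\<close>

definition per_measure :: "real \<Rightarrow> real measure" where
  "per_measure L = restrict_space lborel {0..L}"

abbreviation "pint L f \<equiv> integral\<^sup>L (per_measure L) f"

abbreviation "pintegrable L f \<equiv> integrable (per_measure L) f"

lemma space_per_measure [simp]: "space (per_measure L) = {0..L}"
  by (simp add: per_measure_def space_restrict_space)

lemma set_integrable_eq_per_measure:
  fixes f :: "real \<Rightarrow> real"
  shows "set_integrable lborel {0..L} f \<longleftrightarrow> pintegrable L f"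
  unfolding set_integrable_def per_measure_def by (subst integrable_restrict_space) auto

lemma set_lebesgue_integral_eq_per_measure:
  fixes f :: "real \<Rightarrow> real"
  shows "(LINT x:{0..L}|lborel. f x) = pint L f"
  unfolding set_lebesgue_integral_def per_measure_def by (subst integral_restrict_space) auto

lemma AE_per_measure: "(AE x in per_measure L. P x) \<longleftrightarrow> (AE x in lborel. x \<in> {0..L} \<longrightarrow> P x)"
  unfolding per_measure_def by (subst AE_restrict_space_iff) auto

lemma AE_per_measureI: "(\<And>x. x \<in> {0..L} \<Longrightarrow> P x) \<Longrightarrow> AE x in per_measure L. P x"
  by (rule AE_I2) simp

lemma borel_measurable_per_measure:
  "f \<in> borel_measurable borel \<Longrightarrow> f \<in> borel_measurable (per_measure L)"
  unfolding per_measure_def by (simp add: measurable_restrict_space1)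

lemma continuous_measurable_per_measure:
  assumes "continuous_on {0..L} f" shows "f \<in> borel_measurable (per_measure L)"
proof -
  have "sets (per_measure L) = sets (restrict_space borel {0..L})"
    unfolding per_measure_def by (rule sets_restrict_space_cong) (rule sets_lborel)
  then show ?thesis
    using borel_measurable_continuous_on_restrict[OF assms] measurable_cong_sets by blast
qed

lemma finite_measure_per_measure: "finite_measure (per_measure L)"
  unfolding per_measure_def
  by (rule finite_measureI) (auto simp: space_restrict_space emeasure_restrict_space emeasure_lborel_Icc_eq)

interpretation per_measure: finite_measure "per_measure L" for L
  by (rule finite_measure_per_measure)

lemma measure_per_measure: "L \<ge> 0 \<Longrightarrow> measure (per_measure L) {0..L} = L"
  unfolding per_measure_def by (subst measure_restrict_space) auto

lemma continuous_integrable_per_measure: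
  fixes f :: "real \<Rightarrow> real"
  assumes "continuous_on {0..L} f" shows "pintegrable L f"
  using borel_integrable_atLeastAtMost'[OF assms] by (simp add: set_integrable_eq_per_measure)

lemma integral_per_measure_const: "L \<ge> 0 \<Longrightarrow> pint L (\<lambda>x. c) = c * L"
  by (simp add: measure_per_measure)

lemma integral_per_measure_Icc:
  fixes f :: "real \<Rightarrow> real"
  assumes "pintegrable L f" "0 \<le> a" "b \<le> L"
  shows "(\<integral>x. indicator {a..b} x * f x \<partial>per_measure L) = integral {a..b} f"
proof -
  have "set_integrable lborel {0..L} f" using assms(1) by (simp add: set_integrable_eq_per_measure)
  then have *: "set_integrable lborel {a..b} f"
    by (rule set_integrable_subset) (use assms in auto)
  have "(\<integral>x. indicator {a..b} x * f x \<partial>per_measure L) = (LINT x:{a..b}|lborel. f x)"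
    unfolding set_lebesgue_integral_eq_per_measure[symmetric] set_lebesgue_integral_def
    using assms by (intro Bochner_Integration.integral_cong) (auto simp: indicator_def)
  also have "\<dots> = integral {a..b} f"
    by (rule set_borel_integral_eq_integral(2)[OF *])
  finally show ?thesis .
qed

lemma integral_per_measure_FTC:
  fixes f F :: "real \<Rightarrow> real"
  assumes ab: "0 \<le> a" "a \<le> b" "b \<le> L" and f: "continuous_on {0..L} f"
    and F: "\<And>x. x \<in> {a..b} \<Longrightarrow> (F has_real_derivative f x) (at x within {a..b})"
  shows "(\<integral>x. indicator {a..b} x * f x \<partial>per_measure L) = F b - F a"
proof -
  have "(f has_integral (F b - F a)) {a..b}"
    by (rule fundamental_theorem_of_calculus[OF ab(2)])
      (use F in \<open>simp add: has_real_derivative_iff_has_vector_derivative\<close>)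
  then show ?thesis
    using integral_per_measure_Icc[OF continuous_integrable_per_measure[OF f] ab(1,3)]
    by (simp add: integral_unique)
qed

lemma integral_per_measure_FTC_full:
  fixes f F :: "real \<Rightarrow> real"
  assumes "0 \<le> L" "continuous_on {0..L} f"
    and "\<And>x. x \<in> {0..L} \<Longrightarrow> (F has_real_derivative f x) (at x within {0..L})"
  shows "pint L f = F L - F 0"
proof -
  have "pint L f = (\<integral>x. indicator {0..L} x * f x \<partial>per_measure L)"
    by (intro Bochner_Integration.integral_cong) auto
  also have "\<dots> = F L - F 0" by (rule integral_per_measure_FTC) (use assms in auto)
  finally show ?thesis .
qed

section \<open>Square-integrable functions over a period\<close>

definition sq_int :: "real \<Rightarrow> (real \<Rightarrow> real) \<Rightarrow> bool" where
  "sq_int L f \<longleftrightarrow> f \<in> borel_measurable (per_measure L) \<and> pintegrable L (\<lambda>x. (f x)\<^sup>2)"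

lemma sq_int_mult:
  assumes "sq_int L f" "sq_int L g" shows "pintegrable L (\<lambda>x. f x * g x)"
proof (rule Bochner_Integration.integrable_bound[where f = "\<lambda>x. (f x)\<^sup>2 + (g x)\<^sup>2"])
  have "\<bar>a * b\<bar> \<le> a\<^sup>2 + b\<^sup>2" for a b :: real
  proof -
    have "0 \<le> \<bar>a\<bar> * \<bar>b\<bar>" by simp
    moreover have "2 * (\<bar>a\<bar> * \<bar>b\<bar>) \<le> a\<^sup>2 + b\<^sup>2"
      using sum_squares_bound[of "\<bar>a\<bar>" "\<bar>b\<bar>"] by (simp add: mult.assoc)
    ultimately show ?thesis unfolding abs_mult by linarith
  qed
  then show "AE x in per_measure L. norm (f x * g x) \<le> norm ((f x)\<^sup>2 + (g x)\<^sup>2)"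
    by (intro AE_I2) simp
qed (use assms in \<open>auto simp: sq_int_def\<close>)

lemma sq_int_continuous:
  assumes "continuous_on {0..L} f" shows "sq_int L f"
  unfolding sq_int_def
  by (intro conjI continuous_measurable_per_measure continuous_integrable_per_measure continuous_intros assms)

lemma sq_int_const [simp]: "sq_int L (\<lambda>x. c)"
  by (intro sq_int_continuous continuous_intros)

lemma sq_int_integrable: "sq_int L f \<Longrightarrow> pintegrable L f"
  using sq_int_mult[of L f "\<lambda>x. 1"] by simp

lemma sq_int_add:
  assumes "sq_int L f" "sq_int L g" shows "sq_int L (\<lambda>x. f x + g x)"
proof -
  have "pintegrable L (\<lambda>x. (f x)\<^sup>2 + (g x)\<^sup>2 + 2 * (f x * g x))"
    using assms sq_int_mult[OF assms] by (auto simp: sq_int_def)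
  then show ?thesis using assms by (auto simp: sq_int_def power2_sum mult_ac)
qed

lemma sq_int_cmult: "sq_int L f \<Longrightarrow> sq_int L (\<lambda>x. c * f x)"
  by (auto simp: sq_int_def power_mult_distrib)

lemma sq_int_diff:
  assumes "sq_int L f" "sq_int L g" shows "sq_int L (\<lambda>x. f x - g x)"
  using sq_int_add[OF assms(1) sq_int_cmult[OF assms(2), of "-1"]] by simp

lemma sq_int_sum: "(\<And>i. i \<in> S \<Longrightarrow> sq_int L (f i)) \<Longrightarrow> sq_int L (\<lambda>x. \<Sum>i\<in>S. f i x)"
  by (induction S rule: infinite_finite_induct) (auto intro: sq_int_add)

text \<open>The discriminant argument behind Cauchy-Schwarz, stated once for the scalar products of
  \<open>L2\<close> and of \<open>H1\<close>.\<close>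

lemma nonneg_quadratic_form:
  fixes a b c :: real
  assumes pos: "\<And>s t. 0 \<le> s\<^sup>2 * a + 2 * s * t * b + t\<^sup>2 * c"
  shows "b\<^sup>2 \<le> a * c"
proof (cases "c = 0")
  case True
  have a: "0 \<le> a" using pos[of 1 0] by simp
  have "b = 0"
  proof (rule ccontr)
    assume b: "b \<noteq> 0"
    \<comment> \<open>At this point the form takes the value
      \<open>a - (a + 1) = -1\<close>.\<close>
    show False using pos[of 1 "- (a + 1) / (2 * b)"] b True by (simp add: field_simps)
  qed
  then show ?thesis using True by simp
next
  case False
  then have c: "c > 0" using pos[of 0 1] by simp
  \<comment> \<open>The form at \<open>(c, - b)\<close> equals \<open>c (a c - b^2)\<close>.\<close>
  have "0 \<le> c * (a * c - b\<^sup>2)" using pos[of c "- b"] by (simp add: power2_eq_square algebra_simps)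
  then show ?thesis using c by (simp add: zero_le_mult_iff)
qed

lemma sq_int_Cauchy_Schwarz:
  assumes "sq_int L f" "sq_int L g"
  shows "(pint L (\<lambda>x. f x * g x))\<^sup>2
    \<le> pint L (\<lambda>x. (f x)\<^sup>2) * pint L (\<lambda>x. (g x)\<^sup>2)"
proof (rule nonneg_quadratic_form)
  fix s t
  have i: "pintegrable L (\<lambda>x. (f x)\<^sup>2)" "pintegrable L (\<lambda>x. (g x)\<^sup>2)"
    "pintegrable L (\<lambda>x. f x * g x)"
    using assms sq_int_mult[OF assms] by (auto simp: sq_int_def)
  have "0 \<le> pint L (\<lambda>x. (s * f x + t * g x)\<^sup>2)" by simp
  also have "\<dots> = pint L (\<lambda>x. s\<^sup>2 * (f x)\<^sup>2 + (2 * s * t) * (f x * g x) + t\<^sup>2 * (g x)\<^sup>2)"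
    by (intro Bochner_Integration.integral_cong) (auto simp: power2_eq_square algebra_simps)
  finally show "0 \<le> s\<^sup>2 * pint L (\<lambda>x. (f x)\<^sup>2)
      + 2 * s * t * pint L (\<lambda>x. f x * g x)
      + t\<^sup>2 * pint L (\<lambda>x. (g x)\<^sup>2)"
    using i by simp
qed

lemma integral_abs_le:
  assumes "sq_int L f" "L \<ge> 0"
  shows "pint L (\<lambda>x. \<bar>f x\<bar>) \<le> sqrt (L * pint L (\<lambda>x. (f x)\<^sup>2))"
proof (rule real_le_rsqrt)
  have "sq_int L (\<lambda>x. \<bar>f x\<bar>)" using assms by (auto simp: sq_int_def)
  from sq_int_Cauchy_Schwarz[OF this sq_int_const[of L 1]]
  show "(pint L (\<lambda>x. \<bar>f x\<bar>))\<^sup>2 \<le> L * pint L (\<lambda>x. (f x)\<^sup>2)"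
    using assms(2) by (simp add: measure_per_measure mult.commute)
qed

lemma continuous_on_Icc_bounded:
  fixes f :: "real \<Rightarrow> real"
  assumes "continuous_on {a..b} f"
  obtains C where "\<And>x. x \<in> {a..b} \<Longrightarrow> \<bar>f x\<bar> \<le> C"
proof -
  have "bounded (f ` {a..b})"
    using assms by (intro compact_imp_bounded compact_continuous_image compact_Icc)
  then obtain C where "\<forall>y\<in>f ` {a..b}. norm y \<le> C" unfolding bounded_iff by blast
  then show ?thesis using that[of C] by simp
qed

section \<open>Primitives and integration by parts\<close>

definition prim :: "real \<Rightarrow> (real \<Rightarrow> real) \<Rightarrow> real \<Rightarrow> real" where
  "prim L f x = pint L (\<lambda>s. indicator {0..x} s * f s)"

lemma prim_eq_integral:
  assumes "pintegrable L f" "x \<le> L"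
  shows "prim L f x = integral {0..x} f"
  unfolding prim_def by (rule integral_per_measure_Icc) (use assms in auto)

lemma prim_L: "prim L f L = pint L f"
  unfolding prim_def by (intro Bochner_Integration.integral_cong) auto

lemma prim_0:
  assumes "pintegrable L f" "0 \<le> L" shows "prim L f 0 = 0"
  using prim_eq_integral[OF assms] by simp

lemma continuous_prim:
  assumes "pintegrable L f"
  shows "continuous_on {0..L} (prim L f)"
proof -
  have "f integrable_on {0..L}"
    using assms set_borel_integral_eq_integral(1) set_integrable_eq_per_measure by blast
  then have "continuous_on {0..L} (\<lambda>x. integral {0..x} f)"
    by (rule indefinite_integral_continuous_1)
  then show ?thesis
    by (rule continuous_on_eq) (simp add: prim_eq_integral[OF assms])
qed

lemma prim_diff_le:
  assumes "pintegrable L f"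
  shows "\<bar>prim L f x - prim L f y\<bar> \<le> pint L (\<lambda>s. \<bar>f s\<bar>)"
proof -
  have i: "pintegrable L (\<lambda>s. indicator {0..x} s * f s)" for x
  proof (rule Bochner_Integration.integrable_bound[OF assms])
    show "(\<lambda>s. indicator {0..x} s * f s) \<in> borel_measurable (per_measure L)"
      using borel_measurable_integrable[OF assms]
        borel_measurable_per_measure[of "indicator {0..x} :: real \<Rightarrow> real" L] by simp
  qed (auto simp: indicator_def)
  have "\<bar>prim L f x - prim L f y\<bar> = \<bar>pint L (\<lambda>s. indicator {0..x} s * f s - indicator {0..y} s * f s)\<bar>"
    unfolding prim_def by (simp add: i)
  also have "\<dots> \<le> pint L (\<lambda>s. \<bar>indicator {0..x} s * f s - indicator {0..y} s * f s\<bar>)"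
    by (rule integral_abs_bound)
  also have "\<dots> \<le> pint L (\<lambda>s. \<bar>f s\<bar>)"
    by (intro integral_mono integrable_abs Bochner_Integration.integrable_diff i assms) (auto simp: indicator_def)
  finally show ?thesis .
qed

text \<open>Integration by parts against an absolutely continuous function is Fubini on the
  triangle \<open>s \<le> x\<close>.\<close>

lemma prim_by_parts:
  assumes L: "0 \<le> L" and f: "pintegrable L f"
    and \<psi>: "\<And>x. x \<in> {0..L} \<Longrightarrow> (\<psi> has_real_derivative \<psi>' x) (at x within {0..L})"
    and c: "continuous_on {0..L} \<psi>'"
  shows "pint L (\<lambda>x. prim L f x * \<psi>' x) = \<psi> L * pint L f - pint L (\<lambda>x. f x * \<psi> x)"
proof -
  let ?M = "per_measure L"
  interpret pair_sigma_finite ?M ?M ..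
  have fm [measurable]: "f \<in> borel_measurable ?M" using f by simp
  have cm [measurable]: "\<psi>' \<in> borel_measurable ?M" by (rule continuous_measurable_per_measure[OF c])
  have [measurable]: "(\<lambda>x. x) \<in> borel_measurable ?M" by (rule borel_measurable_per_measure) simp
  obtain C where C: "\<And>x. x \<in> {0..L} \<Longrightarrow> \<bar>\<psi>' x\<bar> \<le> C"
    using continuous_on_Icc_bounded[OF c] by blast
  define F where "F = (\<lambda>s x. of_bool (s \<le> x) * (f s * \<psi>' x))"
  have Fm: "case_prod F \<in> borel_measurable (?M \<Otimes>\<^sub>M ?M)"
    unfolding F_def by measurable
  have bound: "norm (F s x) \<le> C * \<bar>f s\<bar>" if "x \<in> {0..L}" for s x
    using mult_right_mono[OF C[OF that], of "\<bar>f s\<bar>"] C[OF that] by (auto simp: F_def abs_mult mult_ac)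
  have Fi: "integrable (?M \<Otimes>\<^sub>M ?M) (case_prod F)"
  proof (rule Fubini_integrable[OF Fm])
    show "integrable ?M (\<lambda>s. \<integral>x. norm (case_prod F (s, x)) \<partial>?M)"
    proof (rule Bochner_Integration.integrable_bound[where f = "\<lambda>s. C * \<bar>f s\<bar> * L"])
      show "AE s in ?M. norm (\<integral>x. norm (case_prod F (s, x)) \<partial>?M) \<le> norm (C * \<bar>f s\<bar> * L)"
      proof (rule AE_I2)
        fix s
        have "(\<integral>x. norm (F s x) \<partial>?M) \<le> (\<integral>x. C * \<bar>f s\<bar> \<partial>?M)"
          by (rule integral_mono') (use bound order_trans[OF norm_ge_zero bound] in auto)
        also have "\<dots> = C * \<bar>f s\<bar> * L" by (rule integral_per_measure_const[OF L])
        also have "\<dots> \<le> norm (C * \<bar>f s\<bar> * L)" by simp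
        finally show "norm (\<integral>x. norm (case_prod F (s, x)) \<partial>?M) \<le> norm (C * \<bar>f s\<bar> * L)"
          by simp
      qed
      show "(\<lambda>s. \<integral>x. norm (case_prod F (s, x)) \<partial>?M) \<in> borel_measurable ?M"
        using Fm by measurable
    qed (use f in auto)
    show "AE s in ?M. integrable ?M (\<lambda>x. case_prod F (s, x))"
    proof (rule AE_I2)
      fix s assume "s \<in> space ?M"
      then have "(\<lambda>x. F s x) \<in> borel_measurable ?M"
        unfolding F_def by measurable
      then show "integrable ?M (\<lambda>x. case_prod F (s, x))"
        by (intro per_measure.integrable_const_bound[where B = "C * \<bar>f s\<bar>"])
          (use bound in \<open>auto intro!: AE_I2\<close>)
    qed
  qed
  have "pint L (\<lambda>x. prim L f x * \<psi>' x) = (\<integral>x. (\<integral>s. F s x \<partial>?M) \<partial>?M)"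
  proof (rule Bochner_Integration.integral_cong[OF refl])
    fix x assume "x \<in> space ?M"
    have "prim L f x * \<psi>' x = (\<integral>s. indicator {0..x} s * f s * \<psi>' x \<partial>?M)"
      unfolding prim_def by simp
    also have "\<dots> = (\<integral>s. F s x \<partial>?M)"
      by (intro Bochner_Integration.integral_cong) (auto simp: F_def indicator_def)
    finally show "prim L f x * \<psi>' x = (\<integral>s. F s x \<partial>?M)" .
  qed
  also have "\<dots> = (\<integral>s. (\<integral>x. F s x \<partial>?M) \<partial>?M)" by (rule Fubini_integral[OF Fi])
  also have "\<dots> = (\<integral>s. f s * (\<psi> L - \<psi> s) \<partial>?M)"
  proof (rule Bochner_Integration.integral_cong[OF refl])
    fix s assume s: "s \<in> space ?M"
    have "(\<integral>x. F s x \<partial>?M) = (\<integral>x. f s * (indicator {s..L} x * \<psi>' x) \<partial>?M)"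
      by (intro Bochner_Integration.integral_cong) (auto simp: F_def indicator_def)
    also have "\<dots> = f s * (\<integral>x. indicator {s..L} x * \<psi>' x \<partial>?M)" by simp
    also have "(\<integral>x. indicator {s..L} x * \<psi>' x \<partial>?M) = \<psi> L - \<psi> s"
      by (rule integral_per_measure_FTC)
        (use s c in \<open>auto intro: has_field_derivative_subset[OF \<psi>]\<close>)
    finally show "(\<integral>x. F s x \<partial>?M) = f s * (\<psi> L - \<psi> s)" .
  qed
  also have "\<dots> = (\<integral>s. \<psi> L * f s - f s * \<psi> s \<partial>?M)"
    by (simp add: algebra_simps)
  also have "\<dots> = \<psi> L * pint L f - pint L (\<lambda>x. f x * \<psi> x)"
  proof -
    have "continuous_on {0..L} \<psi>" using \<psi> by (rule DERIV_continuous_on)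
    then obtain B where B: "\<And>x. x \<in> {0..L} \<Longrightarrow> \<bar>\<psi> x\<bar> \<le> B"
      using continuous_on_Icc_bounded by blast
    have "integrable ?M (\<lambda>x. f x * \<psi> x)"
    proof (rule Bochner_Integration.integrable_bound[where f = "\<lambda>x. f x * B"])
      show "AE x in ?M. norm (f x * \<psi> x) \<le> norm (f x * B)"
        using B by (intro AE_per_measureI) (fastforce simp: abs_mult intro!: mult_left_mono)
      show "(\<lambda>x. f x * \<psi> x) \<in> borel_measurable ?M"
        using continuous_measurable_per_measure[OF \<open>continuous_on {0..L} \<psi>\<close>] by measurable
    qed (use f in auto)
    then show ?thesis using f by simp
  qed
  finally show ?thesis .
qed

section \<open>Hartley series\<close>

definition kap :: "real \<Rightarrow> real" where "kap L = 2 * pi / L"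

text \<open>The Hartley functions replace the exponentials, so that all coefficients stay real.\<close>

definition cas :: "real \<Rightarrow> int \<Rightarrow> real \<Rightarrow> real" where
  "cas L n x = cos (of_int n * kap L * x) + sin (of_int n * kap L * x)"

lemma cas_has_derivative:
  "(cas L n has_real_derivative of_int n * kap L * cas L (- n) x) (at x within S)"
  unfolding cas_def[abs_def] by (auto intro!: derivative_eq_intros simp: algebra_simps)

lemma continuous_cas [continuous_intros]: "continuous_on S (cas L n)"
  by (rule DERIV_continuous_on) (rule cas_has_derivative)

lemma cas_abs_le: "\<bar>cas L n x\<bar> \<le> 2"
  using abs_triangle_ineq[of "cos (of_int n * kap L * x)" "sin (of_int n * kap L * x)"]
    abs_cos_le_one[of "of_int n * kap L * x"] abs_sin_le_one[of "of_int n * kap L * x"]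
  unfolding cas_def by linarith

text \<open>With \<open>a\<close> and \<open>b\<close> the two phases the product is
  \<open>cos (a - b) + sin (a + b)\<close>, and each summand combines \<open>cas\<close> at two
  opposite indices. So trigonometric polynomials form an algebra, and orthogonality reduces to
  integrals of single modes.\<close>

lemma cas_mult: "cas L m x * cas L n x = (cas L (m - n) x + cas L (n - m) x) / 2 + (cas L (m + n) x - cas L (- m - n) x) / 2"
proof -
  define a b where "a = of_int m * kap L * x" and "b = of_int n * kap L * x"
  have "cas L m x * cas L n x = cos (a - b) + sin (a + b)"
    unfolding cas_def a_def[symmetric] b_def[symmetric] by (simp add: cos_diff sin_add algebra_simps)
  moreover have "cos (b - a) = cos (a - b)" "sin (b - a) = - sin (a - b)"
    by (metis cos_minus minus_diff_eq, metis sin_minus minus_diff_eq)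
  moreover have "- (a + b) = - a - b" by simp
  then have "cos (- a - b) = cos (a + b)" "sin (- a - b) = - sin (a + b)"
    by (metis cos_minus, metis sin_minus)
  ultimately show ?thesis
    unfolding cas_def by (simp add: a_def[symmetric] b_def[symmetric] left_diff_distrib distrib_right)
qed

definition trig_poly :: "real \<Rightarrow> (real \<Rightarrow> real) \<Rightarrow> bool" where
  "trig_poly L f \<longleftrightarrow> (\<exists>S c. finite S \<and> f = (\<lambda>x. \<Sum>n\<in>S. c n * cas L n x))"

text \<open>Unnormalised: as \<open>cas L n\<close> has squared norm \<open>L\<close>, the expansion
  coefficient is \<open>hart L f n / L\<close>.\<close>

definition hart :: "real \<Rightarrow> (real \<Rightarrow> real) \<Rightarrow> int \<Rightarrow> real" where
  "hart L f n = pint L (\<lambda>x. f x * cas L n x)"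

context
  fixes L :: real assumes L: "L > 0"
begin

lemma kap_pos: "kap L > 0" using L by (simp add: kap_def)

lemma kap_L: "kap L * L = 2 * pi" using L by (simp add: kap_def)

lemma cas_0_x: "cas L n 0 = 1" by (simp add: cas_def)

lemma cas_L: "cas L n L = 1"
proof -
  have "of_int n * kap L * L = (2 * pi) * of_int n" using kap_L by (simp add: mult.assoc)
  then show ?thesis
    unfolding cas_def by (simp only: cos_int_2pin sin_int_2pin)
qed

lemma pint_cas: "pint L (cas L n) = (if n = 0 then L else 0)"
proof (cases "n = 0")
  case True
  then have "cas L n = (\<lambda>x. 1)" by (simp add: cas_def fun_eq_iff)
  then show ?thesis using True L by (simp add: measure_per_measure)
next
  case False
  have "pint L (cas L n) = (\<lambda>x. cas L (- n) x / (- of_int n * kap L)) L - (\<lambda>x. cas L (- n) x / (- of_int n * kap L)) 0"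
  proof (rule integral_per_measure_FTC_full)
    show "((\<lambda>x. cas L (- n) x / (- of_int n * kap L)) has_real_derivative cas L n x) (at x within {0..L})" for x
      using False kap_pos by (auto intro!: derivative_eq_intros cas_has_derivative)
  qed (use L in \<open>auto intro: continuous_intros\<close>)
  then show ?thesis using False by (simp add: cas_L cas_0_x)
qed

lemma integrable_cas [simp]: "pintegrable L (cas L n)"
  by (intro continuous_integrable_per_measure continuous_intros)

lemma pint_cas_mult: "pint L (\<lambda>x. cas L m x * cas L n x) = (if m = n then L else 0)"
proof -
  have "m + n = 0 \<longleftrightarrow> - m - n = 0" by auto
  then show ?thesis unfolding cas_mult by (auto simp: pint_cas)
qed

lemma trig_polyI:
  assumes "finite S" "\<And>x. f x = (\<Sum>n\<in>S. c n * cas L n x)" shows "trig_poly L f"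
  unfolding trig_poly_def using assms by (intro exI[of _ S] exI[of _ c]) auto

lemma trig_poly_cas: "trig_poly L (cas L n)"
  by (rule trig_polyI[of "{n}" _ "\<lambda>_. 1"]) auto

lemma trig_poly_add:
  assumes "trig_poly L f" "trig_poly L g" shows "trig_poly L (\<lambda>x. f x + g x)"
proof -
  obtain S c T d where f: "finite S" "f = (\<lambda>x. \<Sum>n\<in>S. c n * cas L n x)"
    and g: "finite T" "g = (\<lambda>x. \<Sum>n\<in>T. d n * cas L n x)"
    using assms unfolding trig_poly_def by blast
  have "f x = (\<Sum>n\<in>S \<union> T. (if n \<in> S then c n else 0) * cas L n x)" for x
    unfolding f(2) by (rule sum.mono_neutral_cong_left) (use f g in auto)
  moreover have "g x = (\<Sum>n\<in>S \<union> T. (if n \<in> T then d n else 0) * cas L n x)" for x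
    unfolding g(2) by (rule sum.mono_neutral_cong_left) (use f g in auto)
  ultimately have "f x + g x = (\<Sum>n\<in>S \<union> T. ((if n \<in> S then c n else 0) + (if n \<in> T then d n else 0)) * cas L n x)" for x
    by (simp add: distrib_right sum.distrib)
  then show ?thesis using f g by (intro trig_polyI[of "S \<union> T"]) auto
qed

lemma trig_poly_cmult:
  assumes "trig_poly L f" shows "trig_poly L (\<lambda>x. a * f x)"
proof -
  obtain S c where f: "finite S" "f = (\<lambda>x. \<Sum>n\<in>S. c n * cas L n x)"
    using assms unfolding trig_poly_def by blast
  then have "a * f x = (\<Sum>n\<in>S. (a * c n) * cas L n x)" for x
    by (simp add: sum_distrib_left mult_ac)
  then show ?thesis using f by (intro trig_polyI[of S])
qed

lemma trig_poly_const: "trig_poly L (\<lambda>x. a)"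
  using trig_poly_cmult[OF trig_poly_cas[of 0], of a] by (simp add: cas_def)

lemma trig_poly_sum:
  "(\<And>n. n \<in> S \<Longrightarrow> trig_poly L (f n)) \<Longrightarrow> trig_poly L (\<lambda>x. \<Sum>n\<in>S. f n x)"
  by (induction S rule: infinite_finite_induct) (auto intro: trig_poly_add trig_poly_const)

lemma trig_poly_mult:
  assumes "trig_poly L f" "trig_poly L g" shows "trig_poly L (\<lambda>x. f x * g x)"
proof -
  obtain S c T d where f: "finite S" "f = (\<lambda>x. \<Sum>n\<in>S. c n * cas L n x)"
    and g: "finite T" "g = (\<lambda>x. \<Sum>n\<in>T. d n * cas L n x)"
    using assms unfolding trig_poly_def by blast
  have cc: "trig_poly L (\<lambda>x. cas L m x * cas L n x)" for m n
  proof -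
    have "trig_poly L (\<lambda>x. ((1/2) * cas L (m - n) x + (1/2) * cas L (n - m) x) + ((1/2) * cas L (m + n) x + (-1/2) * cas L (- m - n) x))"
      by (intro trig_poly_add trig_poly_cmult trig_poly_cas)
    moreover have "((1/2) * cas L (m - n) x + (1/2) * cas L (n - m) x) + ((1/2) * cas L (m + n) x + (-1/2) * cas L (- m - n) x)
       = cas L m x * cas L n x" for x unfolding cas_mult by (simp add: add_divide_distrib diff_divide_distrib)
    ultimately show ?thesis by simp
  qed
  have "trig_poly L (\<lambda>x. \<Sum>m\<in>S. \<Sum>n\<in>T. (c m * d n) * (cas L m x * cas L n x))"
    by (intro trig_poly_sum trig_poly_cmult cc)
  moreover have "(\<Sum>m\<in>S. \<Sum>n\<in>T. (c m * d n) * (cas L m x * cas L n x)) = f x * g x" for x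
    unfolding f(2) g(2) sum_product by (intro sum.cong refl) (simp add: mult_ac)
  ultimately show ?thesis by simp
qed

text \<open>Polynomials on the plane are restricted to the circle, as Stone-Weierstrass supplies
  them; a linear functional contributes only the modes \<open>1\<close> and
  \<open>-1\<close>.\<close>

lemma trig_poly_polynomial:
  fixes p :: "complex \<Rightarrow> real"
  assumes "real_polynomial_function p"
  shows "trig_poly L (\<lambda>x. p (cis (kap L * x)))"
  using assms
proof induction
  case (linear f)
  have "f (cis (kap L * x)) = cos (kap L * x) * f 1 + sin (kap L * x) * f \<i>" for x
  proof -
    have "cis (kap L * x) = cos (kap L * x) *\<^sub>R 1 + sin (kap L * x) *\<^sub>R \<i>"
      by (simp add: complex_eq_iff)
    then show ?thesis
      using linear by (simp add: linear_simps)
  qed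
  then have "f (cis (kap L * x)) = (f 1 / 2 + f \<i> / 2) * cas L 1 x + (f 1 / 2 - f \<i> / 2) * cas L (-1) x" for x
    by (simp add: cas_def field_simps)
  then have "(\<lambda>x. f (cis (kap L * x)))
      = (\<lambda>x. (f 1 / 2 + f \<i> / 2) * cas L 1 x + (f 1 / 2 - f \<i> / 2) * cas L (-1) x)" by blast
  then show ?case
    using trig_poly_add[OF trig_poly_cmult[OF trig_poly_cas] trig_poly_cmult[OF trig_poly_cas]] by simp
next
  case const
  show ?case by (rule trig_poly_const)
next
  case (add f g)
  show ?case by (rule trig_poly_add[OF add.IH])
next
  case (mult f g)
  show ?case by (rule trig_poly_mult[OF mult.IH])
qed

text \<open>Because \<open>w 0 = w L\<close>, the function descends to a continuous function on the
  unit circle, where Stone-Weierstrass gives a polynomial close to it.\<close>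

lemma trig_poly_approx:
  fixes w :: "real \<Rightarrow> real"
  assumes w: "continuous_on {0..L} w" "w 0 = w L" and e: "e > 0"
  obtains S c where "finite S" "\<And>x. x \<in> {0..L} \<Longrightarrow> \<bar>w x - (\<Sum>n\<in>S. c n * cas L n x)\<bar> < e"
proof -
  define \<gamma> where "\<gamma> = (\<lambda>t. w (L * t))"
  have "path \<gamma>"
    unfolding path_def \<gamma>_def
    by (rule continuous_on_compose2[OF w(1)]) (use L in \<open>auto intro!: continuous_intros mult_left_le\<close>)
  moreover have "pathfinish \<gamma> = pathstart \<gamma>" using w(2) by (simp add: \<gamma>_def pathfinish_def pathstart_def)
  \<comment> \<open>The trivial homotopy only serves to obtain continuity on the circle from the
    correspondence between loops and maps of the circle.\<close>
  ultimately have "homotopic_loops UNIV \<gamma> \<gamma>" by (simp add: homotopic_loops_refl)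
  from homotopic_with_imp_continuous[OF homotopic_loops_imp_homotopic_circlemaps[OF this]]
  have "continuous_on (sphere 0 1) (\<gamma> \<circ> (\<lambda>z. Arg2pi z / (2 * pi)))" by simp
  then obtain p where p: "real_polynomial_function p"
    "\<And>z. z \<in> sphere 0 1 \<Longrightarrow> \<bar>(\<gamma> \<circ> (\<lambda>z. Arg2pi z / (2 * pi))) z - p z\<bar> < e"
    using Stone_Weierstrass_real_polynomial_function[OF compact_sphere _ e] by metis
  obtain S c where S: "finite S" "(\<lambda>x. p (cis (kap L * x))) = (\<lambda>x. \<Sum>n\<in>S. c n * cas L n x)"
    using trig_poly_polynomial[OF p(1)] unfolding trig_poly_def by blast
  have *: "w x = (\<gamma> \<circ> (\<lambda>z. Arg2pi z / (2 * pi))) (cis (kap L * x))" if "x \<in> {0..L}" for x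
  \<comment> \<open>\<open>Arg2pi\<close> takes values in \<open>[0, 2 pi)\<close>, so the right end
    point is sent to the angle \<open>0\<close>, where \<open>w 0 = w L\<close> enters.\<close>
  proof (cases "x = L")
    case True
    then have "cis (kap L * x) = 1" by (simp add: kap_L)
    moreover have "Arg2pi 1 = 0" by (simp add: Arg2pi_eq_0)
    ultimately show ?thesis using w(2) True by (simp add: \<gamma>_def)
  next
    case False
    then have "0 \<le> kap L * x" "kap L * x < 2 * pi"
      using that kap_pos mult_strict_left_mono[of x L "kap L"] by (auto simp: kap_L)
    then have "Arg2pi (cis (kap L * x)) = kap L * x"
      by (intro Arg2pi_unique[of 1]) (auto simp: cis_conv_exp)
    then show ?thesis using L by (simp add: \<gamma>_def kap_def)
  qed
  show ?thesis
  proof (rule that[OF S(1)])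
    fix x assume x: "x \<in> {0..L}"
    have "(\<Sum>n\<in>S. c n * cas L n x) = p (cis (kap L * x))" using S(2) by metis
    then show "\<bar>w x - (\<Sum>n\<in>S. c n * cas L n x)\<bar> < e"
      using p(2)[of "cis (kap L * x)"] *[OF x] by simp
  qed
qed

lemma sq_int_cas: "sq_int L (cas L n)"
  by (intro sq_int_continuous continuous_intros)

text \<open>Completing the square. The choice \<open>c n = hart L f n / L\<close> gives Bessel's
  inequality; dropping the last sum turns any good approximation into a Parseval inequality.\<close>

lemma trig_dist:
  assumes f: "sq_int L f" and S: "finite S"
  shows "pint L (\<lambda>x. (f x - (\<Sum>n\<in>S. c n * cas L n x))\<^sup>2)
    = pint L (\<lambda>x. (f x)\<^sup>2) - (\<Sum>n\<in>S. (hart L f n)\<^sup>2) / L + L * (\<Sum>n\<in>S. (c n - hart L f n / L)\<^sup>2)"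
proof -
  let ?s = "\<lambda>x. \<Sum>n\<in>S. c n * cas L n x"
  have s: "sq_int L ?s" by (intro sq_int_sum sq_int_cmult sq_int_cas)
  have i: "pintegrable L (\<lambda>x. (f x)\<^sup>2)" "pintegrable L (\<lambda>x. f x * ?s x)"
    "pintegrable L (\<lambda>x. (?s x)\<^sup>2)" "pintegrable L (\<lambda>x. c n * (f x * cas L n x))"
    "pintegrable L (\<lambda>x. cas L m x * cas L n x)" for n m
    using f s sq_int_mult[OF f s] sq_int_mult[OF f sq_int_cas] sq_int_mult[OF sq_int_cas sq_int_cas]
    by (auto simp: sq_int_def)
  have 1: "pint L (\<lambda>x. (f x - ?s x)\<^sup>2) = pint L (\<lambda>x. (f x)\<^sup>2) - 2 * pint L (\<lambda>x. f x * ?s x) + pint L (\<lambda>x. (?s x)\<^sup>2)"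
    using i by (simp add: power2_diff mult.assoc)
  have 2: "pint L (\<lambda>x. f x * ?s x) = (\<Sum>n\<in>S. c n * hart L f n)"
  proof -
    have "pint L (\<lambda>x. f x * ?s x) = pint L (\<lambda>x. \<Sum>n\<in>S. c n * (f x * cas L n x))"
      by (simp add: sum_distrib_left mult_ac)
    also have "\<dots> = (\<Sum>n\<in>S. c n * hart L f n)"
      unfolding hart_def by (subst Bochner_Integration.integral_sum) (use i in auto)
    finally show ?thesis .
  qed
  have 3: "pint L (\<lambda>x. (?s x)\<^sup>2) = L * (\<Sum>n\<in>S. (c n)\<^sup>2)"
  proof -
    have "pint L (\<lambda>x. (?s x)\<^sup>2) = pint L (\<lambda>x. \<Sum>m\<in>S. \<Sum>n\<in>S. (c m * c n) * (cas L m x * cas L n x))"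
      unfolding power2_eq_square sum_product by (simp add: mult_ac)
    also have "\<dots> = (\<Sum>m\<in>S. \<Sum>n\<in>S. (c m * c n) * (if m = n then L else 0))"
      by (simp add: Bochner_Integration.integral_sum i pint_cas_mult)
    also have "\<dots> = L * (\<Sum>n\<in>S. (c n)\<^sup>2)"
      using S by (simp add: sum_distrib_left power2_eq_square mult_ac if_distrib cong: if_cong)
    finally show ?thesis .
  qed
  have "L * (\<Sum>n\<in>S. (c n - hart L f n / L)\<^sup>2) = (\<Sum>n\<in>S. L * (c n)\<^sup>2 - 2 * (c n * hart L f n) + (hart L f n)\<^sup>2 / L)"
    unfolding sum_distrib_left using L by (intro sum.cong refl) (simp add: power2_eq_square field_simps)
  also have "\<dots> = L * (\<Sum>n\<in>S. (c n)\<^sup>2) - 2 * (\<Sum>n\<in>S. c n * hart L f n) + (\<Sum>n\<in>S. (hart L f n)\<^sup>2) / L"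
    by (simp add: sum.distrib sum_subtractf sum_distrib_left sum_divide_distrib)
  finally show ?thesis unfolding 1 2 3 by simp
qed

lemma hartley_Bessel:
  assumes "sq_int L f" "finite S"
  shows "(\<Sum>n\<in>S. (hart L f n)\<^sup>2) / L \<le> pint L (\<lambda>x. (f x)\<^sup>2)"
proof -
  have "0 \<le> pint L (\<lambda>x. (f x - (\<Sum>n\<in>S. hart L f n / L * cas L n x))\<^sup>2)" by simp
  then show ?thesis unfolding trig_dist[OF assms] by simp
qed

text \<open>A finite sum with slack \<open>e\<close> carries all that later estimates use, and
  infinite series are avoided.\<close>

lemma hartley_Parseval:
  assumes w: "continuous_on {0..L} w" "w 0 = w L" and e: "e > 0"
  obtains S where "finite S" "pint L (\<lambda>x. (w x)\<^sup>2) \<le> (\<Sum>n\<in>S. (hart L w n)\<^sup>2) / L + e"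
proof -
  \<comment> \<open>A uniform error \<open>sqrt (e / L)\<close> amounts to a squared error of at
    most \<open>e\<close> over the length \<open>L\<close>.\<close>
  obtain S c where S: "finite S" "\<And>x. x \<in> {0..L} \<Longrightarrow> \<bar>w x - (\<Sum>n\<in>S. c n * cas L n x)\<bar> < sqrt (e / L)"
    using trig_poly_approx[OF w, of "sqrt (e / L)"] e L by (metis divide_pos_pos real_sqrt_gt_zero)
  have "pint L (\<lambda>x. (w x - (\<Sum>n\<in>S. c n * cas L n x))\<^sup>2) \<le> pint L (\<lambda>x. e / L)"
  proof (rule integral_mono)
    show "pintegrable L (\<lambda>x. (w x - (\<Sum>n\<in>S. c n * cas L n x))\<^sup>2)"
      by (intro continuous_integrable_per_measure continuous_intros w)
    fix x assume "x \<in> space (per_measure L)"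
    then have "\<bar>w x - (\<Sum>n\<in>S. c n * cas L n x)\<bar>\<^sup>2 \<le> (sqrt (e / L))\<^sup>2"
      using S(2)[of x] by (intro power_mono) auto
    then show "(w x - (\<Sum>n\<in>S. c n * cas L n x))\<^sup>2 \<le> e / L" using e L by simp
  qed simp
  also have "\<dots> = e" using L by (simp add: measure_per_measure)
  finally have "pint L (\<lambda>x. (w x)\<^sup>2) - (\<Sum>n\<in>S. (hart L w n)\<^sup>2) / L + L * (\<Sum>n\<in>S. (c n - hart L w n / L)\<^sup>2) \<le> e"
    unfolding trig_dist[OF sq_int_continuous[OF w(1)] S(1)] .
  moreover have "0 \<le> L * (\<Sum>n\<in>S. (c n - hart L w n / L)\<^sup>2)" using L by (simp add: sum_nonneg)
  ultimately show ?thesis using that[OF S(1)] by linarith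
qed

end

text \<open>The half-lines \<open>{..a}\<close> are stable under intersection and generate the Borel
  sets. So the integral of \<open>f\<close>, extended by zero, vanishes over every Borel set, which
  forces \<open>f = 0\<close> almost everywhere.\<close>

lemma AE_zero_if_prim_zero:
  assumes f: "pintegrable L f" and 0: "\<And>x. x \<in> {0..L} \<Longrightarrow> prim L f x = 0" and L: "L > 0"
  shows "AE x in per_measure L. f x = 0"
proof -
  define g where "g = (\<lambda>x. indicator {0..L} x * f x)"
  have gi: "integrable lborel g"
    using f unfolding set_integrable_eq_per_measure[symmetric] set_integrable_def g_def by simp
  have gA: "set_integrable lborel A g" if "A \<in> sets borel" for A
    using gi that integrable_mult_indicator[of A lborel g] by (simp add: set_integrable_def)
  have "set_lebesgue_integral lborel A g = 0" if "A \<in> sets lborel" for A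
  proof -
    have "sets (lborel :: real measure) = sigma_sets UNIV (range (\<lambda>a::real. {..a}))"
      by (simp add: borel_eq_atMost sets_measure_of)
    then have A: "A \<in> sigma_sets UNIV (range (\<lambda>a::real. {..a}))" using that by simp
    have int: "Int_stable (range (\<lambda>a::real. {..a}))"
      by (auto simp: Int_stable_def)
    have S: "X \<in> sets borel" if "X \<in> sigma_sets UNIV (range (\<lambda>a::real. {..a}))" for X
      using that by (simp add: borel_eq_atMost sets_measure_of)
    have base: "set_lebesgue_integral lborel {..a} g = 0" for a
    proof -
      have "set_lebesgue_integral lborel {..a} g = pint L (\<lambda>s. indicator {..a} s * f s)"
        unfolding set_lebesgue_integral_eq_per_measure[symmetric] set_lebesgue_integral_def g_def
        by (simp add: mult_ac)
      also have "\<dots> = 0"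
      proof -
        consider "a < 0" | "a \<in> {0..L}" | "a > L" using L by force
        then show ?thesis
        proof cases
          case 1
          then have "pint L (\<lambda>s. indicator {..a} s * f s) = pint L (\<lambda>s. 0)"
            by (intro Bochner_Integration.integral_cong) (auto simp: indicator_def)
          then show ?thesis by simp
        next
          case 2
          have "pint L (\<lambda>s. indicator {..a} s * f s) = prim L f a"
            unfolding prim_def by (intro Bochner_Integration.integral_cong) (auto simp: indicator_def)
          then show ?thesis using 0[OF 2] by simp
        next
          case 3
          have "pint L (\<lambda>s. indicator {..a} s * f s) = prim L f L"
            unfolding prim_def using 3 by (intro Bochner_Integration.integral_cong) (auto simp: indicator_def)
          then show ?thesis using 0[of L] L by simp
        qed
      qed
      finally show ?thesis .
    qed
    have all: "(LINT x|lborel. g x) = 0"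
    proof -
      have "(LINT x|lborel. g x) = prim L f L"
        unfolding prim_L set_lebesgue_integral_eq_per_measure[symmetric] set_lebesgue_integral_def g_def by simp
      then show ?thesis using 0[of L] L by simp
    qed
    have cl: "range (\<lambda>a::real. {..a}) \<subseteq> Pow UNIV" by simp
    from int cl A show ?thesis
    proof (induction rule: sigma_sets_induct_disjoint)
      case (basic A)
      then show ?case using base by auto
    next
      case (compl A)
      have "set_lebesgue_integral lborel (UNIV - A) g + set_lebesgue_integral lborel A g = set_lebesgue_integral lborel UNIV g"
        using S[OF compl.hyps] by (subst set_integral_Un[symmetric]) (auto intro!: gA)
      then show ?case using compl.IH all by (simp add: set_lebesgue_integral_def)
    next
      case (union A)
      have "set_lebesgue_integral lborel (\<Union>i. A i) g = (\<Sum>i. set_lebesgue_integral lborel (A i) g)"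
      proof (intro lebesgue_integral_countable_add gA)
        have "A i \<in> sets borel" for i using S union.hyps(2) by (meson rangeI subsetD)
        then show "A i \<in> sets lborel" "(\<Union>i. A i) \<in> sets borel" for i by auto
        show "A i \<inter> A j = {}" if "i \<noteq> j" for i j
          using union.hyps(1) that by (simp add: disjoint_family_on_def)
      qed
      then show ?case using union.IH by simp
    qed (auto simp: set_lebesgue_integral_def)
  qed
  then have "AE x in lborel. g x = 0" by (intro sigma_finite_measure.density_zero[OF lborel.sigma_finite_measure_axioms gi])
  then show ?thesis unfolding AE_per_measure by eventually_elim (auto simp: g_def indicator_def split: if_splits)
qed

lemma continuous_eq_zero_if_hart_zero:
  assumes L: "L > 0" and w: "continuous_on {0..L} w" "w 0 = w L" and 0: "\<And>n. hart L w n = 0"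
    and x: "x \<in> {0..L}"
  shows "w x = 0"
proof -
  have "pint L (\<lambda>x. (w x)\<^sup>2) \<le> 0 + e" if "e > 0" for e
  proof -
    obtain S where "pint L (\<lambda>x. (w x)\<^sup>2) \<le> (\<Sum>n\<in>S. (hart L w n)\<^sup>2) / L + e"
      using hartley_Parseval[OF L w \<open>e > 0\<close>] by blast
    then show ?thesis by (simp add: 0)
  qed
  then have "pint L (\<lambda>x. (w x)\<^sup>2) \<le> 0" by (rule field_le_epsilon)
  then have "pint L (\<lambda>x. (w x)\<^sup>2) = 0" by (simp add: antisym)
  moreover have "pint L (\<lambda>x. (w x)\<^sup>2) = integral {0..L} (\<lambda>x. (w x)\<^sup>2)"
    unfolding prim_L[symmetric]
    by (intro prim_eq_integral continuous_integrable_per_measure continuous_intros w) simp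
  ultimately show ?thesis
    using integral_eq_0_iff[of 0 L "\<lambda>x. (w x)\<^sup>2"] continuous_on_power[OF w(1), of 2] L x by auto
qed

lemma hart_0: "hart L f 0 = pint L f"
  by (simp add: hart_def cas_def)

lemma cas_primitive:
  assumes "L > 0" "n \<noteq> 0"
  shows "((\<lambda>x. cas L (- n) x / (- of_int n * kap L)) has_real_derivative cas L n x) (at x within S)"
  using kap_pos[OF assms(1)] assms(2) by (auto intro!: derivative_eq_intros cas_has_derivative)

lemma integrable_cas_mult:
  assumes "L > 0" "pintegrable L f" shows "pintegrable L (\<lambda>x. f x * cas L n x)"
proof (rule Bochner_Integration.integrable_bound[where f = "\<lambda>x. f x * 2"])
  show "AE x in per_measure L. norm (f x * cas L n x) \<le> norm (f x * 2)"
    using cas_abs_le[of L n] by (intro AE_I2) (auto simp: abs_mult intro!: mult_left_mono)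
  show "(\<lambda>x. f x * cas L n x) \<in> borel_measurable (per_measure L)"
    using assms(2) integrable_cas[OF assms(1), of n] by (intro borel_measurable_times borel_measurable_integrable)
qed (use assms in auto)

lemma hart_diff_const:
  assumes L: "L > 0" and f: "pintegrable L f"
  shows "hart L (\<lambda>x. f x - c) n = hart L f n - (if n = 0 then c * L else 0)"
  using integrable_cas_mult[OF L f, of n] integrable_cas[OF L, of n] pint_cas[OF L, of n]
  by (simp add: hart_def left_diff_distrib)

text \<open>Mean zero removes the boundary term at \<open>L\<close>; the reflection of the index
  comes from integrating \<open>cas\<close>.\<close>

lemma hart_prim:
  assumes L: "L > 0" and f: "pintegrable L f" "pint L f = 0" and n: "n \<noteq> 0"
  shows "hart L (prim L f) n = hart L f (- n) / (of_int n * kap L)"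
proof -
  have "hart L (prim L f) n = - pint L (\<lambda>x. f x * (cas L (- n) x / (- of_int n * kap L)))"
    unfolding hart_def using prim_by_parts[OF less_imp_le[OF L] f(1) cas_primitive[OF L n] continuous_cas] f(2)
    by simp
  then show ?thesis by (simp add: hart_def minus_divide_right[symmetric])
qed

text \<open>Parseval is available for continuous functions with equal end values. The primitive of
  \<open>f\<close> is of this kind, because \<open>hart L f 0 = 0\<close>; minus its mean it has
  only zero coefficients. So it is constant, and it starts at \<open>0\<close>.\<close>

lemma hartley_complete:
  assumes L: "L > 0" and f: "pintegrable L f" and 0: "\<And>n. hart L f n = 0"
  shows "AE x in per_measure L. f x = 0"
proof (rule AE_zero_if_prim_zero[OF f _ L])
  have f0: "pint L f = 0" using 0[of 0] by (simp add: hart_0)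
  define F where "F = prim L f"
  define m where "m = pint L F / L"
  have Fc: "continuous_on {0..L} F" unfolding F_def by (rule continuous_prim[OF f])
  have F0: "F 0 = 0" "F L = 0" using L by (simp_all add: F_def prim_0[OF f] prim_L f0)
  have "F x - m = 0" if "x \<in> {0..L}" for x
  proof (rule continuous_eq_zero_if_hart_zero[OF L _ _ _ that])
    show "hart L (\<lambda>x. F x - m) n = 0" for n
    proof -
      have "hart L (\<lambda>x. F x - m) n = hart L F n - (if n = 0 then m * L else 0)"
        by (rule hart_diff_const[OF L continuous_integrable_per_measure[OF Fc]])
      then show ?thesis
        using hart_prim[OF L f f0, of n] 0 L by (cases "n = 0") (simp_all add: hart_0 m_def flip: F_def)
    qed
  qed (auto intro!: continuous_intros Fc simp: F0)
  then show "prim L f x = 0" if "x \<in> {0..L}" for x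
  proof -
    have "F x - m = 0" "F 0 - m = 0" using \<open>\<And>x. x \<in> {0..L} \<Longrightarrow> F x - m = 0\<close> that L by auto
    then show ?thesis using F0(1) by (simp add: F_def)
  qed
qed

section \<open>The periodic Sobolev space\<close>

text \<open>Carrying the weak derivative along as a second argument avoids the choice in \<open>weak_deriv\<close>.\<close>

definition h1 :: "real \<Rightarrow> (real \<Rightarrow> real) \<Rightarrow> (real \<Rightarrow> real) \<Rightarrow> bool" where
  "h1 L u g \<longleftrightarrow> u \<in> L2_per L \<and> g \<in> L2_per L \<and> has_weak_deriv L u g"

lemma L2_per_sq_int: "u \<in> L2_per L \<Longrightarrow> sq_int L u"
  by (simp add: L2_per_def sq_int_def borel_measurable_per_measure set_integrable_eq_per_measure)

lemma h1_sq_int: assumes "h1 L u g" shows "sq_int L u" "sq_int L g"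
  using assms by (auto simp: h1_def L2_per_sq_int)

lemma h1_parts:
  assumes "h1 L u g" "smooth_on UNIV \<psi>" "periodic L \<psi>"
  shows "pint L (\<lambda>x. u x * deriv \<psi> x) = - pint L (\<lambda>x. g x * \<psi> x)"
  using assms by (simp add: h1_def has_weak_deriv_def set_lebesgue_integral_eq_per_measure)

lemma smooth_cas: "smooth_on UNIV (cas L n)"
proof (rule smooth_on_gen_algebra_real[where G = "range (cas L)"])
  fix g assume "g \<in> range (cas L)"
  then obtain m where m: "g = cas L m" by blast
  show "\<exists>g'\<in>gen_algebra (range (cas L)). \<forall>x. (g has_real_derivative g' x) (at x)"
    unfolding m
    by (rule bexI[of _ "\<lambda>x. of_int m * kap L * cas L (- m) x"])
      (intro allI cas_has_derivative, intro gen_algebra.mult gen_algebra.const gen_algebra.gen rangeI)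
qed (auto intro: gen_algebra.gen)

lemma periodic_cas: assumes "L > 0" shows "periodic L (cas L n)"
proof -
  have "of_int n * kap L * (x + L) = of_int n * kap L * x + (2 * pi) * of_int n" for x
    using kap_L[OF assms] by (simp add: algebra_simps)
  then show ?thesis
    unfolding periodic_def cas_def
    by (simp only: cos_add sin_add cos_int_2pin sin_int_2pin) simp
qed

lemma deriv_cas: "deriv (cas L n) = (\<lambda>x. of_int n * kap L * cas L (- n) x)"
  using DERIV_imp_deriv[OF cas_has_derivative] by blast

text \<open>The test function is \<open>cas L n\<close>. The reflection
  \<open>n \<mapsto> - n\<close> plays the part of the imaginary unit in the rule for complex
  Fourier coefficients.\<close>

lemma h1_hart:
  assumes L: "L > 0" and u: "h1 L u g"
  shows "hart L g n = - (of_int n * kap L * hart L u (- n))"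
proof -
  have "pint L (\<lambda>x. u x * deriv (cas L n) x) = pint L (\<lambda>x. (of_int n * kap L) * (u x * cas L (- n) x))"
    by (simp add: deriv_cas mult_ac)
  then show ?thesis
    using h1_parts[OF u smooth_cas periodic_cas[OF L], of n] by (simp add: hart_def)
qed

text \<open>All Hartley coefficients of a weak derivative are determined by the function, and by
  completeness they determine it almost everywhere. Hence the choice in \<open>weak_deriv\<close>
  can be replaced by any explicit weak derivative.\<close>

lemma h1_unique:
  assumes L: "L > 0" and u: "h1 L u g" "h1 L u' g'" and eq: "AE x in per_measure L. u x = u' x"
  shows "AE x in per_measure L. g x = g' x"
proof -
  have i: "pintegrable L g" "pintegrable L g'" "pintegrable L u" "pintegrable L u'"
    using u h1_sq_int sq_int_integrable by blast+
  have "hart L u n = hart L u' n" for n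
    unfolding hart_def
    by (rule integral_cong_AE) (use eq i integrable_cas_mult[OF L] in \<open>auto intro!: borel_measurable_integrable\<close>)
  then have "hart L g n = hart L g' n" for n by (simp add: h1_hart[OF L u(1)] h1_hart[OF L u(2)])
  then have "hart L (\<lambda>x. g x - g' x) n = 0" for n
    using integrable_cas_mult[OF L i(1), of n] integrable_cas_mult[OF L i(2), of n]
    by (simp add: hart_def left_diff_distrib)
  then have "AE x in per_measure L. g x - g' x = 0"
    by (intro hartley_complete[OF L]) (use i in auto)
  then show ?thesis by eventually_elim simp
qed

text \<open>The difference \<open>u - prim L g\<close> has no mode other than \<open>0\<close>, so
  it is constant almost everywhere. This is the absolutely continuous representative.\<close>

lemma h1_representative:
  assumes L: "L > 0" and u: "h1 L u g"
  obtains m where "AE x in per_measure L. u x = prim L g x + m" "pint L g = 0"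
proof -
  have i: "pintegrable L g" "pintegrable L u"
    using u h1_sq_int sq_int_integrable by blast+
  have g0: "pint L g = 0"
    using h1_hart[OF L u, of 0] by (simp add: hart_0)
  define v where "v = (\<lambda>x. u x - prim L g x)"
  have pi: "pintegrable L (prim L g)"
    by (intro continuous_integrable_per_measure continuous_prim i)
  have vi: "pintegrable L v" unfolding v_def using i pi by simp
  have "hart L v n = 0" if n: "n \<noteq> 0" for n
  proof -
    have "hart L v n = hart L u n - hart L (prim L g) n"
      using integrable_cas_mult[OF L i(2), of n] integrable_cas_mult[OF L pi, of n]
      by (simp add: hart_def v_def left_diff_distrib)
    moreover have "hart L u n = hart L g (- n) / (of_int n * kap L)"
      using h1_hart[OF L u, of "- n"] n kap_pos[OF L] by (simp add: field_simps)
    ultimately show ?thesis using hart_prim[OF L i(1) g0 n] by simp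
  qed
  then have "AE x in per_measure L. v x - pint L v / L = 0"
    using L by (intro hartley_complete[OF L]) (auto simp: vi hart_diff_const hart_0)
  then have "AE x in per_measure L. u x = prim L g x + pint L v / L"
    by eventually_elim (simp add: v_def)
  then show ?thesis using that g0 by blast
qed

section \<open>Norm, sup bound and Wirtinger inequality\<close>

definition h1_sq :: "real \<Rightarrow> (real \<Rightarrow> real) \<Rightarrow> (real \<Rightarrow> real) \<Rightarrow> real" where
  "h1_sq L u g = pint L (\<lambda>x. (u x)\<^sup>2 + (g x)\<^sup>2)"

lemma h1_sq_nonneg: "0 \<le> h1_sq L u g"
  unfolding h1_sq_def by (rule Bochner_Integration.integral_nonneg) simp

lemma h1_sq_split:
  assumes "h1 L u g" shows "h1_sq L u g = pint L (\<lambda>x. (u x)\<^sup>2) + pint L (\<lambda>x. (g x)\<^sup>2)"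
  using h1_sq_int[OF assms] by (simp add: h1_sq_def sq_int_def)

definition sob_const :: "real \<Rightarrow> real" where "sob_const L = (sqrt L + L * sqrt L) / L"

text \<open>For the continuous representative \<open>w\<close>, the inequality \<open>\<bar>w
  x\<bar> \<le> \<bar>w y\<bar> + \<integral>\<bar>g\<bar>\<close> is averaged over
  \<open>y\<close>. Both integrals are at most \<open>sqrt (L N)\<close> by Cauchy-Schwarz, which
  gives the two terms of \<open>sob_const\<close>.\<close>

lemma h1_sup_bound:
  assumes L: "L > 0" and u: "h1 L u g"
  shows "AE x in per_measure L. \<bar>u x\<bar> \<le> sob_const L * sqrt (h1_sq L u g)"
proof -
  obtain m where m: "AE x in per_measure L. u x = prim L g x + m"
    using h1_representative[OF L u] by blast
  define w where "w = (\<lambda>x. prim L g x + m)"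
  define N where "N = h1_sq L u g"
  note sq = h1_sq_int[OF u]
  have gi: "pintegrable L g" by (rule sq_int_integrable[OF sq(2)])
  have wc: "continuous_on {0..L} w" unfolding w_def by (intro continuous_intros continuous_prim gi)
  have wi: "pintegrable L (\<lambda>x. \<bar>w x\<bar>)"
    by (intro continuous_integrable_per_measure continuous_intros wc)
  have ww: "pint L (\<lambda>x. (w x)\<^sup>2) = pint L (\<lambda>x. (u x)\<^sup>2)"
    using m sq(1) sq_int_continuous[OF wc]
    by (intro integral_cong_AE) (auto simp: sq_int_def w_def)
  have le: "pint L (\<lambda>x. (u x)\<^sup>2) \<le> N" "pint L (\<lambda>x. (g x)\<^sup>2) \<le> N"
    unfolding N_def h1_sq_split[OF u] by simp_all
  have a: "pint L (\<lambda>s. \<bar>g s\<bar>) \<le> sqrt (L * N)"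
    using integral_abs_le[OF sq(2)] L le by (meson less_imp_le mult_left_mono order_trans real_sqrt_le_mono)
  have b: "pint L (\<lambda>s. \<bar>w s\<bar>) \<le> sqrt (L * N)"
    using integral_abs_le[OF sq_int_continuous[OF wc]] L le(1) unfolding ww
    by (meson less_imp_le mult_left_mono order_trans real_sqrt_le_mono)
  have "\<bar>w x\<bar> \<le> sob_const L * sqrt N" for x
  proof -
    have "\<bar>w x\<bar> * L = pint L (\<lambda>y. \<bar>w x\<bar>)" using L by (simp add: measure_per_measure)
    also have "\<dots> \<le> pint L (\<lambda>y. \<bar>w y\<bar> + sqrt (L * N))"
    proof (rule integral_mono)
      fix y
      have "\<bar>w x - w y\<bar> \<le> sqrt (L * N)"
        using order_trans[OF prim_diff_le[OF gi, of x y] a] by (simp add: w_def)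
      then show "\<bar>w x\<bar> \<le> \<bar>w y\<bar> + sqrt (L * N)" by linarith
    qed (use wi in auto)
    also have "\<dots> = pint L (\<lambda>y. \<bar>w y\<bar>) + L * sqrt (L * N)"
      using wi L by (simp add: measure_per_measure)
    also have "\<dots> \<le> sqrt (L * N) + L * sqrt (L * N)" using b by simp
    also have "\<dots> = (sqrt L + L * sqrt L) * sqrt N" by (simp add: real_sqrt_mult algebra_simps)
    finally show ?thesis using L by (simp add: sob_const_def field_simps)
  qed
  with m show ?thesis unfolding N_def[symmetric] by (auto elim!: eventually_mono simp: w_def)
qed

text \<open>Modes with \<open>\<bar>n\<bar> \<ge> 2\<close> satisfy \<open>4 \<le> n^2\<close>; mode
  \<open>0\<close> lacks \<open>4\<close>, and the modes \<open>1\<close> and \<open>-1\<close> lack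
  \<open>3\<close> each. The squared Hartley coefficients at \<open>1\<close> and \<open>-1\<close>
  add up to twice the sum of the squared cosine and sine coefficients, hence the factor
  \<open>6\<close>.\<close>

lemma h1_Wirtinger:
  assumes L: "L > 0" and u: "h1 L u g"
  shows "4 * (kap L)\<^sup>2 * pint L (\<lambda>x. (u x)\<^sup>2) \<le> pint L (\<lambda>x. (g x)\<^sup>2)
    + (kap L)\<^sup>2 / L * (4 * (pint L u)\<^sup>2
       + 6 * ((pint L (\<lambda>x. u x * cos (kap L * x)))\<^sup>2 + (pint L (\<lambda>x. u x * sin (kap L * x)))\<^sup>2))"
proof -
  obtain m where m: "AE x in per_measure L. u x = prim L g x + m" and g0: "pint L g = 0"
    using h1_representative[OF L u] by blast
  define w where "w = (\<lambda>x. prim L g x + m)"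
  note sq = h1_sq_int[OF u]
  have i: "pintegrable L g" "pintegrable L u" using sq sq_int_integrable by blast+
  have wc: "continuous_on {0..L} w" unfolding w_def by (intro continuous_intros continuous_prim i)
  have w0: "w 0 = w L" using L g0 by (simp add: w_def prim_0[OF i(1)] prim_L)
  have ww: "pint L (\<lambda>x. (w x)\<^sup>2) = pint L (\<lambda>x. (u x)\<^sup>2)"
    using m sq(1) sq_int_continuous[OF wc]
    by (intro integral_cong_AE) (auto simp: sq_int_def w_def)
  have hw: "hart L w n = hart L u n" for n
    unfolding hart_def using m i(2) integrable_cas_mult[OF L] continuous_integrable_per_measure[OF wc]
    by (intro integral_cong_AE) (auto intro!: borel_measurable_integrable simp: w_def)
  define a where "a = (\<lambda>n. (hart L u n)\<^sup>2)"
  define \<kappa> where "\<kappa> = kap L"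
  \<comment> \<open>Parseval holds up to a slack, which is removed at the end because
    \<open>e\<close> is arbitrary.\<close>
  have key: "4 * \<kappa>\<^sup>2 * (pint L (\<lambda>x. (u x)\<^sup>2)) \<le> pint L (\<lambda>x. (g x)\<^sup>2) + \<kappa>\<^sup>2 / L * (4 * a 0 + 3 * (a 1 + a (-1))) + e"
    if e: "e > 0" for e
  proof -
    have \<kappa>: "\<kappa> > 0" using kap_pos[OF L] by (simp add: \<kappa>_def)
    obtain S where S: "finite S" "pint L (\<lambda>x. (u x)\<^sup>2) \<le> (\<Sum>n\<in>S. a n) / L + e / (4 * \<kappa>\<^sup>2)"
      using hartley_Parseval[OF L wc w0, of "e / (4 * \<kappa>\<^sup>2)"] e \<kappa> unfolding ww hw a_def by auto
    define b where "b = (\<lambda>n::int. if n = 0 then 4 * a n else if n = 1 \<or> n = -1 then 3 * a n else 0)"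
    have b0: "0 \<le> b n" for n by (simp add: b_def a_def)
    have pt: "4 * a n \<le> (of_int n)\<^sup>2 * a n + b n" for n :: int
    proof (cases "n = 0 \<or> n = 1 \<or> n = -1")
      case False
      then have "2 \<le> \<bar>n\<bar>" by auto
      then have "2\<^sup>2 \<le> \<bar>real_of_int n\<bar>\<^sup>2" by (intro power_mono) auto
      then have "4 * a n \<le> (of_int n)\<^sup>2 * a n" by (intro mult_right_mono) (auto simp: a_def)
      then show ?thesis using b0[of n] by linarith
    qed (auto simp: b_def)
    have "(\<Sum>n\<in>S. b n) \<le> (\<Sum>n\<in>S \<union> {0, 1, -1}. b n)"
      by (rule sum_mono2) (use S b0 in auto)
    also have "\<dots> = (\<Sum>n\<in>{0, 1, -1}. b n)"
      by (rule sum.mono_neutral_right) (use S in \<open>auto simp: b_def\<close>)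
    also have "\<dots> = 4 * a 0 + 3 * (a 1 + a (-1))" by (simp add: b_def)
    finally have bs: "(\<Sum>n\<in>S. b n) \<le> 4 * a 0 + 3 * (a 1 + a (-1))" .
    have "\<kappa>\<^sup>2 * (\<Sum>n\<in>S. (of_int n)\<^sup>2 * a n) = (\<Sum>n\<in>uminus ` S. (hart L g n)\<^sup>2)"
      by (subst sum.reindex) (auto simp: inj_on_def h1_hart[OF L u] a_def \<kappa>_def sum_distrib_left power_mult_distrib mult_ac)
    then have bes: "\<kappa>\<^sup>2 / L * (\<Sum>n\<in>S. (of_int n)\<^sup>2 * a n) \<le> pint L (\<lambda>x. (g x)\<^sup>2)"
      using hartley_Bessel[OF L sq(2), of "uminus ` S"] S(1) by simp
    have "4 * \<kappa>\<^sup>2 * pint L (\<lambda>x. (u x)\<^sup>2) \<le> 4 * \<kappa>\<^sup>2 * ((\<Sum>n\<in>S. a n) / L + e / (4 * \<kappa>\<^sup>2))"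
      using S(2) by (intro mult_left_mono) auto
    also have "\<dots> = \<kappa>\<^sup>2 / L * (\<Sum>n\<in>S. 4 * a n) + e"
    proof -
      have "(\<Sum>n\<in>S. 4 * a n) = 4 * (\<Sum>n\<in>S. a n)" by (simp add: sum_distrib_left)
      moreover have "4 * \<kappa>\<^sup>2 * (s / L + e / (4 * \<kappa>\<^sup>2)) = \<kappa>\<^sup>2 / L * (4 * s) + e" for s
        using \<kappa> L by (simp add: field_simps)
      ultimately show ?thesis by simp
    qed
    also have "\<dots> \<le> \<kappa>\<^sup>2 / L * (\<Sum>n\<in>S. (of_int n)\<^sup>2 * a n + b n) + e"
      using pt L by (intro add_right_mono mult_left_mono sum_mono) auto
    also have "\<dots> = \<kappa>\<^sup>2 / L * (\<Sum>n\<in>S. (of_int n)\<^sup>2 * a n) + \<kappa>\<^sup>2 / L * (\<Sum>n\<in>S. b n) + e"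
      by (simp add: sum.distrib distrib_left)
    also have "\<dots> \<le> pint L (\<lambda>x. (g x)\<^sup>2) + \<kappa>\<^sup>2 / L * (4 * a 0 + 3 * (a 1 + a (-1))) + e"
      using bes bs L by (intro add_mono mult_left_mono) auto
    finally show ?thesis .
  qed
  have "4 * \<kappa>\<^sup>2 * (pint L (\<lambda>x. (u x)\<^sup>2)) \<le> pint L (\<lambda>x. (g x)\<^sup>2) + \<kappa>\<^sup>2 / L * (4 * a 0 + 3 * (a 1 + a (-1)))"
    by (rule field_le_epsilon) (rule key)
  moreover have "a 0 = (pint L u)\<^sup>2" by (simp add: a_def hart_0)
  moreover have "a 1 + a (-1) = 2 * ((pint L (\<lambda>x. u x * cos (kap L * x)))\<^sup>2 + (pint L (\<lambda>x. u x * sin (kap L * x)))\<^sup>2)"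
  proof -
    have j: "pintegrable L (\<lambda>x. u x * cos (kap L * x))" "pintegrable L (\<lambda>x. u x * sin (kap L * x))"
      by (rule sq_int_mult[OF sq(1) sq_int_continuous]; intro continuous_intros)+
    show ?thesis
      unfolding a_def hart_def cas_def using j
      by (simp add: distrib_left right_diff_distrib power2_eq_square algebra_simps)
  qed
  ultimately show ?thesis by (simp add: \<kappa>_def)
qed

section \<open>Transfer to \<open>weak_deriv\<close> and to the conserved quantities\<close>

lemma h1_weak_deriv:
  assumes "u \<in> H1_per L" shows "h1 L u (weak_deriv L u)"
proof -
  from assms obtain g where "u \<in> L2_per L" "g \<in> L2_per L \<and> has_weak_deriv L u g"
    by (auto simp: H1_per_def)
  then show ?thesis
    unfolding h1_def weak_deriv_def by (metis (mono_tags, lifting) someI)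
qed

lemma h1_imp_H1_per: "h1 L u g \<Longrightarrow> u \<in> H1_per L"
  by (auto simp: h1_def H1_per_def)

text \<open>Uniqueness of the weak derivative in the form that eliminates \<open>weak_deriv\<close>
  from the norm and the energies.\<close>

lemma pint_cong_h1:
  fixes f :: "real \<Rightarrow> real \<Rightarrow> real"
  assumes L: "L > 0" and u: "h1 L u g" "h1 L u' g'" and eq: "AE x in per_measure L. u x = u' x"
    and f: "case_prod f \<in> borel_measurable borel"
  shows "pint L (\<lambda>x. f (u x) (g x)) = pint L (\<lambda>x. f (u' x) (g' x))"
proof (rule integral_cong_AE)
  have m: "(\<lambda>x. f (v x) (w x)) \<in> borel_measurable (per_measure L)" if "h1 L v w" for v w
  proof -
    have "v \<in> borel_measurable (per_measure L)" "w \<in> borel_measurable (per_measure L)"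
      using h1_sq_int[OF that] by (auto simp: sq_int_def)
    then have "(\<lambda>x. (v x, w x)) \<in> borel_measurable (per_measure L)" by (rule borel_measurable_Pair)
    from measurable_compose[OF this f] show ?thesis by simp
  qed
  show "(\<lambda>x. f (u x) (g x)) \<in> borel_measurable (per_measure L)" by (rule m[OF u(1)])
  show "(\<lambda>x. f (u' x) (g' x)) \<in> borel_measurable (per_measure L)" by (rule m[OF u(2)])
  show "AE x in per_measure L. f (u x) (g x) = f (u' x) (g' x)"
    using eq h1_unique[OF L u eq] by eventually_elim simp
qed

lemma h1_sq_cong:
  assumes "L > 0" "h1 L u g" "h1 L u' g'" "AE x in per_measure L. u x = u' x"
  shows "h1_sq L u g = h1_sq L u' g'"
  unfolding h1_sq_def
  by (rule pint_cong_h1[OF assms]) (auto simp: case_prod_unfold intro!: borel_measurable_continuous_onI continuous_intros)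

lemma H1_norm_eq:
  assumes "L > 0" "h1 L u g" shows "H1_norm L u = sqrt (h1_sq L u g)"
  using h1_sq_cong[OF assms(1) h1_weak_deriv[OF h1_imp_H1_per[OF assms(2)]] assms(2)]
  by (simp add: H1_norm_def h1_sq_def set_lebesgue_integral_eq_per_measure)

lemma energy_F_eq:
  assumes "L > 0" "h1 L u g" shows "energy_F L u = h1_sq L u g / 2"
  using h1_sq_cong[OF assms(1) h1_weak_deriv[OF h1_imp_H1_per[OF assms(2)]] assms(2)]
  by (simp add: energy_F_def h1_sq_def set_lebesgue_integral_eq_per_measure)

lemma energy_E_eq:
  assumes "L > 0" "h1 L u g" shows "energy_E L u = - pint L (\<lambda>x. (u x)^4 / 4 + u x * (g x)\<^sup>2 / 2)"
proof -
  have "(\<lambda>p::real \<times> real. fst p ^ 4 / 4 + fst p * (snd p)\<^sup>2 / 2) \<in> borel_measurable borel"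
    by (intro borel_measurable_continuous_onI continuous_intros) auto
  then show ?thesis
    unfolding energy_E_def set_lebesgue_integral_eq_per_measure
    using pint_cong_h1[OF assms(1) h1_weak_deriv[OF h1_imp_H1_per[OF assms(2)]] assms(2),
        where f = "\<lambda>u g. u^4 / 4 + u * g\<^sup>2 / 2"] by (simp add: case_prod_unfold)
qed

lemma mass_V_eq: "mass_V L u = pint L u"
  by (simp add: mass_V_def set_lebesgue_integral_eq_per_measure)

lemma L2_per_diff:
  assumes "u \<in> L2_per L" "v \<in> L2_per L" shows "(\<lambda>x. u x - v x) \<in> L2_per L"
proof -
  have "sq_int L (\<lambda>x. u x - v x)" using assms by (intro sq_int_diff L2_per_sq_int)
  then show ?thesis
    using assms by (auto simp: L2_per_def periodic_def sq_int_def set_integrable_eq_per_measure)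
qed

lemma sq_int_mult_continuous:
  assumes "sq_int L u" "continuous_on {0..L} \<psi>"
  shows "pintegrable L (\<lambda>x. u x * \<psi> x)"
  by (rule sq_int_mult[OF assms(1) sq_int_continuous[OF assms(2)]])

lemma smooth_continuous:
  fixes \<psi> :: "real \<Rightarrow> real"
  assumes "smooth_on UNIV \<psi>" shows "continuous_on S \<psi>"
  by (rule DERIV_continuous_on) (rule has_field_derivative_at_within[OF smooth_on_has_deriv[OF assms]])

lemma h1_diff:
  assumes "h1 L u g" "h1 L v k" shows "h1 L (\<lambda>x. u x - v x) (\<lambda>x. g x - k x)"
proof -
  note sq = h1_sq_int[OF assms(1)] h1_sq_int[OF assms(2)]
  have "pint L (\<lambda>x. (u x - v x) * deriv \<psi> x) = - pint L (\<lambda>x. (g x - k x) * \<psi> x)"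
    if \<psi>: "smooth_on UNIV \<psi>" "periodic L \<psi>" for \<psi>
  proof -
    note c = smooth_continuous[OF \<psi>(1), of "{0..L}"] smooth_continuous[OF smooth_on_deriv[OF \<psi>(1)], of "{0..L}"]
    show ?thesis
      using h1_parts[OF assms(1) \<psi>] h1_parts[OF assms(2) \<psi>] sq_int_mult_continuous[OF sq(1) c(2)]
        sq_int_mult_continuous[OF sq(2) c(1)] sq_int_mult_continuous[OF sq(3) c(2)] sq_int_mult_continuous[OF sq(4) c(1)]
      by (simp add: left_diff_distrib)
  qed
  then show ?thesis
    using assms by (auto simp: h1_def has_weak_deriv_def set_lebesgue_integral_eq_per_measure intro: L2_per_diff)
qed

lemma C1_parts:
  assumes L: "L > 0" and \<phi>: "\<And>x. (\<phi> has_real_derivative \<phi>' x) (at x)" "continuous_on UNIV \<phi>'" "periodic L \<phi>"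
    and \<psi>: "\<And>x. (\<psi> has_real_derivative \<psi>' x) (at x)" "continuous_on UNIV \<psi>'" "periodic L \<psi>"
  shows "pint L (\<lambda>x. \<phi> x * \<psi>' x) = - pint L (\<lambda>x. \<phi>' x * \<psi> x)"
proof -
  have c: "continuous_on S \<phi>" "continuous_on S \<psi>" "continuous_on S \<phi>'" "continuous_on S \<psi>'" for S
    using \<phi>(1,2) \<psi>(1,2) by (auto intro: DERIV_continuous_on has_field_derivative_at_within continuous_on_subset)
  have "pint L (\<lambda>x. \<phi> x * \<psi>' x + \<phi>' x * \<psi> x) = \<phi> L * \<psi> L - \<phi> 0 * \<psi> 0"
  proof (rule integral_per_measure_FTC_full[where F = "\<lambda>x. \<phi> x * \<psi> x"])
    show "((\<lambda>x. \<phi> x * \<psi> x) has_real_derivative \<phi> x * \<psi>' x + \<phi>' x * \<psi> x) (at x within {0..L})" for x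
      using DERIV_mult[OF has_field_derivative_at_within[OF \<phi>(1)] has_field_derivative_at_within[OF \<psi>(1)], of x "{0..L}"]
      by (simp add: add.commute mult.commute)
  qed (use L in \<open>auto intro!: continuous_intros c\<close>)
  also have "\<dots> = 0"
    using \<phi>(3)[unfolded periodic_def, rule_format, of 0] \<psi>(3)[unfolded periodic_def, rule_format, of 0] by simp
  finally have "pint L (\<lambda>x. \<phi> x * \<psi>' x + \<phi>' x * \<psi> x) = 0" .
  then show ?thesis
    by (simp add: continuous_integrable_per_measure continuous_intros c)
qed

lemma periodic_deriv:
  assumes "\<And>x. (\<phi> has_real_derivative \<phi>' x) (at x)" "periodic L \<phi>" shows "periodic L \<phi>'"
  unfolding periodic_def
proof
  fix x
  have "((\<lambda>x. \<phi> (x + L)) has_real_derivative \<phi>' (x + L)) (at x)"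
    using assms(1)[of "x + L"] by (simp add: DERIV_shift)
  then show "\<phi>' (x + L) = \<phi>' x"
    using assms by (simp add: periodic_def) (metis DERIV_unique)
qed

lemma h1_C1:
  assumes L: "L > 0" and \<phi>: "\<And>x. (\<phi> has_real_derivative \<phi>' x) (at x)" "continuous_on UNIV \<phi>'" "periodic L \<phi>"
  shows "h1 L \<phi> \<phi>'"
proof -
  have c: "continuous_on UNIV \<phi>" using \<phi>(1) by (auto intro: DERIV_continuous_on has_field_derivative_at_within)
  have L2: "f \<in> L2_per L" if "continuous_on UNIV f" "periodic L f" for f
    using that sq_int_continuous[OF continuous_on_subset[OF that(1)], of L]
    by (simp add: L2_per_def borel_measurable_continuous_onI set_integrable_eq_per_measure sq_int_def)
  have "has_weak_deriv L \<phi> \<phi>'"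
    unfolding has_weak_deriv_def set_lebesgue_integral_eq_per_measure
  proof (intro allI impI, elim conjE)
    fix \<psi> :: "real \<Rightarrow> real" assume "smooth_on UNIV \<psi>" "periodic L \<psi>"
    then show "pint L (\<lambda>x. \<phi> x * deriv \<psi> x) = - pint L (\<lambda>x. \<phi>' x * \<psi> x)"
      by (intro C1_parts L \<phi> smooth_on_has_deriv smooth_continuous smooth_on_deriv)
  qed
  then show ?thesis unfolding h1_def using L2 c \<phi> periodic_deriv by blast
qed

section \<open>Translation and parity over a period\<close>

lemma smooth_shift:
  fixes f :: "real \<Rightarrow> real"
  assumes "smooth_on UNIV f" shows "smooth_on UNIV (\<lambda>x. f (x + y))"
proof (rule smooth_on_gen_algebra_real[where G = "{\<lambda>x. g (x + y) |g. smooth_on UNIV g}"])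
  fix h :: "real \<Rightarrow> real" assume "h \<in> {\<lambda>x. g (x + y) |g. smooth_on UNIV g}"
  then obtain g where g: "h = (\<lambda>x. g (x + y))" "smooth_on UNIV g" by blast
  have "(h has_real_derivative deriv g (x + y)) (at x)" for x
    using smooth_on_has_deriv[OF g(2), of "x + y"] by (simp add: g(1) DERIV_shift)
  then show "\<exists>g'\<in>gen_algebra {\<lambda>x. g (x + y) |g. smooth_on UNIV g}. \<forall>x. (h has_real_derivative g' x) (at x)"
    using smooth_on_deriv[OF g(2)] by (intro bexI[of _ "\<lambda>x. deriv g (x + y)"]) (auto intro!: gen_algebra.gen)
qed (use assms in \<open>auto intro!: gen_algebra.gen\<close>)

lemma periodic_shift: "periodic L f \<Longrightarrow> periodic L (\<lambda>x. f (x + y))"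
  unfolding periodic_def by (metis add.commute add.left_commute)

lemma continuous_antiderivative:
  fixes f :: "real \<Rightarrow> real"
  assumes "continuous_on UNIV f"
  obtains F where "\<And>x. (F has_real_derivative f x) (at x)"
proof
  fix x :: real
  define M where "M = \<bar>x\<bar> + 1"
  have "((\<lambda>u. LBINT y=0..u. f y) has_vector_derivative f x) (at x within {-M..M})"
    unfolding zero_ereal_def
    by (rule interval_integral_FTC2) (auto simp: M_def intro!: continuous_on_subset[OF assms])
  moreover have "x \<in> interior {-M..M}" by (auto simp: M_def)
  ultimately show "((\<lambda>u. LBINT y=0..u. f y) has_real_derivative f x) (at x)"
    by (metis at_within_interior has_real_derivative_iff_has_vector_derivative)
qed

lemma pint_antiderivative:
  assumes "L > 0" "continuous_on UNIV f" "\<And>x. (F has_real_derivative f x) (at x)"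
  shows "pint L (\<lambda>x. f (x + y)) = F (L + y) - F y"
proof -
  have "pint L (\<lambda>x. f (x + y)) = (\<lambda>x. F (x + y)) L - (\<lambda>x. F (x + y)) 0"
  proof (rule integral_per_measure_FTC_full[where F = "\<lambda>x. F (x + y)"])
    show "continuous_on {0..L} (\<lambda>x. f (x + y))"
      by (rule continuous_on_compose2[OF assms(2)]) (intro continuous_intros, simp)
    show "((\<lambda>x. F (x + y)) has_real_derivative f (x + y)) (at x within {0..L})" for x
      using assms(3)[of "x + y"] by (simp add: DERIV_shift has_field_derivative_at_within)
  qed (use assms(1) in auto)
  then show ?thesis by simp
qed

lemma periodic_increment_const:
  assumes "\<And>x. (F has_real_derivative f x) (at x)" "periodic L f"
  shows "F (x + L) - F x = F (y + L) - F y"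
proof -
  have "((\<lambda>x. F (x + L) - F x) has_real_derivative f (x + L) - f x) (at x)" for x
    using assms(1)[of "x + L"] assms(1)[of x] by (intro DERIV_diff) (simp_all add: DERIV_shift)
  then have "((\<lambda>x. F (x + L) - F x) has_real_derivative 0) (at x)" for x
    using assms(2) by (simp add: periodic_def)
  then show ?thesis using DERIV_isconst_all by (metis (no_types, lifting))
qed

text \<open>The increment of an antiderivative over one period has derivative zero in its starting
  point, so the interval is never split.\<close>

lemma pint_shift:
  assumes L: "L > 0" and f: "continuous_on UNIV f" "periodic L f"
  shows "pint L (\<lambda>x. f (x + y)) = pint L f"
proof -
  obtain F where F: "\<And>x. (F has_real_derivative f x) (at x)"
    using continuous_antiderivative[OF f(1)] by blast
  show ?thesis
    using pint_antiderivative[OF L f(1) F, of y] pint_antiderivative[OF L f(1) F, of 0]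
      periodic_increment_const[OF F f(2), of y 0] by (simp add: add.commute)
qed

text \<open>An antiderivative of an odd function is even, so its increment from
  \<open>- L / 2\<close> to \<open>L / 2\<close> is zero, and by periodicity so is the increment
  over any period.\<close>

lemma pint_odd:
  assumes L: "L > 0" and f: "continuous_on UNIV f" "periodic L f" "\<And>x. f (- x) = - f x"
  shows "pint L f = 0"
proof -
  obtain F where F: "\<And>x. (F has_real_derivative f x) (at x)"
    using continuous_antiderivative[OF f(1)] by blast
  have "((\<lambda>x. F (- x) - F x) has_real_derivative 0) (at x)" for x
  proof -
    have "((\<lambda>x. F (- x)) has_real_derivative f (- x) * (- 1)) (at x)"
      by (rule DERIV_chain2[OF F]) (auto intro!: derivative_eq_intros)
    from DERIV_diff[OF this F] show ?thesis by (simp add: f(3))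
  qed
  then have "F (- (L/2)) - F (L/2) = F (- 0) - F 0"
    using DERIV_isconst_all[of "\<lambda>x. F (- x) - F x"] by blast
  then show ?thesis
    using pint_antiderivative[OF L f(1) F, of 0] periodic_increment_const[OF F f(2), of "- (L/2)" 0] by simp
qed

text \<open>Stated for differences, the form in which distances occur. Nonnegativity of the norm of
  \<open>s u + t v\<close> gives Cauchy-Schwarz for the \<open>H1\<close> product
  \<open>B\<close>.\<close>

lemma h1_sq_triangle:
  assumes L: "L > 0" and "h1 L u g" "h1 L v k"
  shows "sqrt (h1_sq L (\<lambda>x. u x - v x) (\<lambda>x. g x - k x)) \<le> sqrt (h1_sq L u g) + sqrt (h1_sq L v k)"
proof -
  note sq = h1_sq_int[OF assms(2)] h1_sq_int[OF assms(3)]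
  define B where "B = pint L (\<lambda>x. u x * v x + g x * k x)"
  have i: "pintegrable L (\<lambda>x. (u x)\<^sup>2 + (g x)\<^sup>2)" "pintegrable L (\<lambda>x. (v x)\<^sup>2 + (k x)\<^sup>2)"
    "pintegrable L (\<lambda>x. u x * v x + g x * k x)"
    using sq sq_int_mult[OF sq(1,3)] sq_int_mult[OF sq(2,4)] by (auto simp: sq_int_def)
  have e: "pint L (\<lambda>x. (s * u x + t * v x)\<^sup>2 + (s * g x + t * k x)\<^sup>2) = s\<^sup>2 * h1_sq L u g + 2 * s * t * B + t\<^sup>2 * h1_sq L v k" for s t
  proof -
    have "pint L (\<lambda>x. (s * u x + t * v x)\<^sup>2 + (s * g x + t * k x)\<^sup>2)
      = pint L (\<lambda>x. s\<^sup>2 * ((u x)\<^sup>2 + (g x)\<^sup>2) + (2 * s * t) * (u x * v x + g x * k x) + t\<^sup>2 * ((v x)\<^sup>2 + (k x)\<^sup>2))"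
      by (intro Bochner_Integration.integral_cong) (auto simp: power2_eq_square algebra_simps)
    also have "\<dots> = s\<^sup>2 * h1_sq L u g + 2 * s * t * B + t\<^sup>2 * h1_sq L v k"
      unfolding h1_sq_def B_def using i by simp
    finally show ?thesis .
  qed
  have "0 \<le> pint L (\<lambda>x. (s * u x + t * v x)\<^sup>2 + (s * g x + t * k x)\<^sup>2)" for s t
    by (rule Bochner_Integration.integral_nonneg) simp
  then have "B\<^sup>2 \<le> h1_sq L u g * h1_sq L v k" unfolding e by (rule nonneg_quadratic_form)
  then have "\<bar>B\<bar> \<le> sqrt (h1_sq L u g) * sqrt (h1_sq L v k)"
    by (metis real_sqrt_abs real_sqrt_le_mono real_sqrt_mult)
  moreover have "h1_sq L (\<lambda>x. u x - v x) (\<lambda>x. g x - k x) = h1_sq L u g - 2 * B + h1_sq L v k"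
    using e[of 1 "-1"] by (simp add: h1_sq_def)
  moreover have "(sqrt (h1_sq L u g) + sqrt (h1_sq L v k))\<^sup>2
      = h1_sq L u g + 2 * (sqrt (h1_sq L u g) * sqrt (h1_sq L v k)) + h1_sq L v k"
    by (simp add: power2_sum h1_sq_nonneg)
  ultimately have "h1_sq L (\<lambda>x. u x - v x) (\<lambda>x. g x - k x) \<le> (sqrt (h1_sq L u g) + sqrt (h1_sq L v k))\<^sup>2"
    by linarith
  then show ?thesis by (simp add: h1_sq_nonneg real_le_lsqrt)
qed

lemma H1_norm_triangle:
  assumes L: "L > 0" and "u \<in> H1_per L" "v \<in> H1_per L" "w \<in> H1_per L"
  shows "H1_norm L (\<lambda>x. u x - w x) \<le> H1_norm L (\<lambda>x. u x - v x) + H1_norm L (\<lambda>x. v x - w x)"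
proof -
  note h = assms(2-4)[THEN h1_weak_deriv]
  have "h1_sq L (\<lambda>x. w x - v x) (\<lambda>x. weak_deriv L w x - weak_deriv L v x)
     = h1_sq L (\<lambda>x. v x - w x) (\<lambda>x. weak_deriv L v x - weak_deriv L w x)"
    by (simp add: h1_sq_def power2_commute)
  then show ?thesis
    using h1_sq_triangle[OF L h1_diff[OF h(1) h(2)] h1_diff[OF h(3) h(2)]]
    by (simp add: H1_norm_eq[OF L h1_diff[OF h(1) h(2)]] H1_norm_eq[OF L h1_diff[OF h(2) h(3)]]
        H1_norm_eq[OF L h1_diff[OF h(1) h(3)]])
qed

lemma H1_norm_nonneg: "0 \<le> H1_norm L f"
  unfolding H1_norm_def set_lebesgue_integral_eq_per_measure
  by (intro real_sqrt_ge_zero Bochner_Integration.integral_nonneg) simp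

lemma H1_norm_commute:
  assumes "L > 0" "u \<in> H1_per L" "v \<in> H1_per L"
  shows "H1_norm L (\<lambda>x. u x - v x) = H1_norm L (\<lambda>x. v x - u x)"
proof -
  note h = assms(2,3)[THEN h1_weak_deriv]
  show ?thesis
    unfolding H1_norm_eq[OF assms(1) h1_diff[OF h(1) h(2)]] H1_norm_eq[OF assms(1) h1_diff[OF h(2) h(1)]]
    by (simp add: h1_sq_def power2_commute)
qed

section \<open>Stability close to a bifurcation point\<close>

lemma integrable_AE_bounded_mult:
  fixes b f :: "real \<Rightarrow> real"
  assumes "AE x in per_measure L. \<bar>b x\<bar> \<le> C" "b \<in> borel_measurable (per_measure L)" "pintegrable L f"
  shows "pintegrable L (\<lambda>x. b x * f x)"
proof (rule Bochner_Integration.integrable_bound[where f = "\<lambda>x. C * \<bar>f x\<bar>"])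
  show "AE x in per_measure L. norm (b x * f x) \<le> norm (C * \<bar>f x\<bar>)"
    using assms(1) by eventually_elim (simp add: abs_mult mult_right_mono)
qed (use assms in auto)

lemma integrable_continuous_mult:
  fixes b f :: "real \<Rightarrow> real"
  assumes "continuous_on {0..L} b" "pintegrable L f"
  shows "pintegrable L (\<lambda>x. b x * f x)"
proof -
  obtain C where "\<And>x. x \<in> {0..L} \<Longrightarrow> \<bar>b x\<bar> \<le> C" using continuous_on_Icc_bounded[OF assms(1)] by blast
  then show ?thesis
    by (intro integrable_AE_bounded_mult[where C = C] AE_per_measureI continuous_measurable_per_measure assms)
qed

lemma abs_integral_le:
  fixes f g :: "real \<Rightarrow> real"
  assumes "pintegrable L f" "pintegrable L g" "AE x in per_measure L. \<bar>f x\<bar> \<le> g x"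
  shows "\<bar>pint L f\<bar> \<le> pint L g"
proof -
  have "\<bar>pint L f\<bar> \<le> pint L (\<lambda>x. \<bar>f x\<bar>)" by (rule integral_abs_bound)
  also have "\<dots> \<le> pint L g" using assms by (intro integral_mono_AE) auto
  finally show ?thesis .
qed

lemma h1_pint_abs_le:
  assumes "L > 0" "h1 L h k"
  shows "pint L (\<lambda>x. \<bar>h x\<bar>) \<le> sqrt L * sqrt (h1_sq L h k)" "pint L (\<lambda>x. \<bar>k x\<bar>) \<le> sqrt L * sqrt (h1_sq L h k)"
proof -
  have "sqrt (L * pint L (\<lambda>x. (h x)\<^sup>2)) \<le> sqrt L * sqrt (h1_sq L h k)"
    "sqrt (L * pint L (\<lambda>x. (k x)\<^sup>2)) \<le> sqrt L * sqrt (h1_sq L h k)"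
    using assms by (simp_all add: real_sqrt_mult h1_sq_split)
  then show "pint L (\<lambda>x. \<bar>h x\<bar>) \<le> sqrt L * sqrt (h1_sq L h k)" "pint L (\<lambda>x. \<bar>k x\<bar>) \<le> sqrt L * sqrt (h1_sq L h k)"
    using integral_abs_le h1_sq_int[OF assms(2)] assms(1) by (meson less_imp_le order_trans)+
qed

lemma h1_pint_bounded_mult_le:
  assumes L: "L > 0" and h: "h1 L h k" and b: "continuous_on {0..L} b" "\<And>x. \<bar>b x\<bar> \<le> B"
  shows "\<bar>pint L (\<lambda>x. h x * b x)\<bar> \<le> B * (sqrt L * sqrt (h1_sq L h k))"
proof -
  have i: "pintegrable L h" using h1_sq_int[OF h] sq_int_integrable by blast
  have B: "0 \<le> B" using b(2)[of 0] by linarith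
  have "\<bar>pint L (\<lambda>x. h x * b x)\<bar> \<le> pint L (\<lambda>x. B * \<bar>h x\<bar>)"
  proof (rule abs_integral_le)
    show "pintegrable L (\<lambda>x. h x * b x)"
      using integrable_continuous_mult[OF b(1) i] by (simp add: mult.commute)
    show "AE x in per_measure L. \<bar>h x * b x\<bar> \<le> B * \<bar>h x\<bar>"
    proof (rule AE_I2)
      fix x
      have "\<bar>b x\<bar> * \<bar>h x\<bar> \<le> B * \<bar>h x\<bar>" using b(2) by (intro mult_right_mono) auto
      then show "\<bar>h x * b x\<bar> \<le> B * \<bar>h x\<bar>" by (simp add: abs_mult mult.commute)
    qed
  qed (use i in simp)
  also have "\<dots> \<le> B * (sqrt L * sqrt (h1_sq L h k))"
    using h1_pint_abs_le(1)[OF L h] i B by (simp add: mult_left_mono)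
  finally show ?thesis .
qed

section \<open>Expansion of the functional \<open>E + c F - A V\<close> at the wave\<close>

definition energy_density :: "real \<Rightarrow> real \<Rightarrow> real \<Rightarrow> real \<Rightarrow> real" where
  "energy_density c A u g = - (u^4 / 4 + u * g\<^sup>2 / 2) + c / 2 * (u\<^sup>2 + g\<^sup>2) - A * u"

text \<open>An exact Taylor expansion, ordered as quadratic part, cubic and quartic part, linear
  part. The profile equation replaces \<open>A\<close> in the linear part, which thereby becomes, up
  to sign, \<open>\<psi>' h + \<psi> k\<close> with \<open>\<psi> = (p - c) p'\<close>.\<close>

lemma energy_density_expand:
  fixes p p' p'' h k c A :: real
  assumes "(p - c) * p'' + p'\<^sup>2 / 2 - p^3 + c * p = A"
  shows "energy_density c A (p + h) (p' + k) = energy_density c A p p'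
    + ((c - p) * k\<^sup>2 - 2 * (p' * (h * k)) + (c - 3 * p\<^sup>2) * h\<^sup>2) / 2
    - (p * (h * h\<^sup>2) + h\<^sup>2 * h\<^sup>2 / 4 + h * k\<^sup>2 / 2)
    - ((p'\<^sup>2 + (p - c) * p'') * h + (p - c) * p' * k)"
  unfolding energy_density_def assms[symmetric]
  by (simp add: field_simps power2_eq_square power3_eq_cube power4_eq_xxxx)

lemma energy_density_integral:
  assumes L: "L > 0" and u: "h1 L u g"
  shows "energy_E L u + c * energy_F L u - A * mass_V L u = pint L (\<lambda>x. energy_density c A (u x) (g x))"
proof -
  note sq = h1_sq_int[OF u]
  define s where "s = sob_const L * sqrt (h1_sq L u g)"
  have b: "AE x in per_measure L. \<bar>u x\<bar> \<le> s" using h1_sup_bound[OF L u] by (simp add: s_def)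
  have m: "u \<in> borel_measurable (per_measure L)" using sq by (simp add: sq_int_def)
  have i: "pintegrable L u" "pintegrable L (\<lambda>x. (u x)\<^sup>2)" "pintegrable L (\<lambda>x. (g x)\<^sup>2)"
    using sq sq_int_integrable[OF sq(1)] by (simp_all add: sq_int_def)
  have "pintegrable L (\<lambda>x. u x * (u x * (u x)\<^sup>2))" "pintegrable L (\<lambda>x. u x * (g x)\<^sup>2)"
    by (rule integrable_AE_bounded_mult[OF b m] i)+
  then have "pintegrable L (\<lambda>x. (u x)^4)" "pintegrable L (\<lambda>x. u x * (g x)\<^sup>2)"
    by (simp_all add: power4_eq_xxxx power2_eq_square mult.assoc)
  then show ?thesis
    using i by (simp add: energy_density_def energy_E_eq[OF L u] energy_F_eq[OF L u] mass_V_eq h1_sq_def)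
qed

text \<open>\<open>D\<close> is the value of \<open>c - \<phi>\<close> at the bifurcation point, and
  \<open>\<eta>\<close> bounds the deviation of the three coefficients of the second variation from
  \<open>D\<close>, \<open>0\<close> and \<open>- D * (kap L)^2\<close>. The remainders
  \<open>r\<close> and \<open>r'\<close> are relative to \<open>\<beta>\<close>. By
  \<open>small\<close> both errors together consume at most half of the coercivity constant
  \<open>D * min (1/2) ((kap L)^2)\<close>.\<close>

locale stable_wave =
  fixes L c A D \<eta> \<zeta> \<beta> m :: real and \<phi> \<phi>' \<phi>'' r r' :: "real \<Rightarrow> real"
  assumes L: "L > 0"
    and smooth: "smooth_on UNIV \<phi>" and per: "periodic L \<phi>"
    and d1: "\<And>x. (\<phi> has_real_derivative \<phi>' x) (at x)" and d2: "\<And>x. (\<phi>' has_real_derivative \<phi>'' x) (at x)"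
    and ode: "\<And>x. (\<phi> x - c) * \<phi>'' x + (\<phi>' x)\<^sup>2 / 2 - (\<phi> x)^3 + c * \<phi> x = A"
    and even: "\<And>x. \<phi> (- x) = \<phi> x"
    and D: "D > 0"
    and b1: "\<And>x. \<bar>c - \<phi> x - D\<bar> \<le> \<eta>" and b2: "\<And>x. \<bar>\<phi>' x\<bar> \<le> \<eta>"
    and b3: "\<And>x. \<bar>c - 3 * (\<phi> x)\<^sup>2 + D * (kap L)\<^sup>2\<bar> \<le> \<eta>"
    and dec: "\<And>x. \<phi> x = m + \<beta> * (cos (kap L * x) + r x)"
    and dec': "\<And>x. \<phi>' x = \<beta> * (- (kap L * sin (kap L * x)) + r' x)"
    and r: "\<And>x. \<bar>r x\<bar> \<le> \<zeta>" "\<And>x. \<bar>r' x\<bar> \<le> \<zeta>" and \<beta>: "\<beta> \<noteq> 0"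
    and small: "2 * \<eta> + 18 * D * (kap L)\<^sup>2 * \<zeta>\<^sup>2 \<le> D * min (1/2) ((kap L)\<^sup>2) / 2" "\<zeta> < 1 / 2"
begin

definition "gap = D * min (1/2) ((kap L)\<^sup>2) / 2"

lemma kap: "kap L > 0" by (rule kap_pos[OF L])

lemma gap_pos: "gap > 0" using D kap by (simp add: gap_def)

lemma deriv_eq: "deriv \<phi> = \<phi>'" "deriv \<phi>' = \<phi>''"
  using DERIV_imp_deriv[OF d1] DERIV_imp_deriv[OF d2] by blast+

lemma smooth': "smooth_on UNIV \<phi>'" "smooth_on UNIV \<phi>''"
  using smooth_on_deriv[OF smooth] smooth_on_deriv[OF smooth_on_deriv[OF smooth]] by (simp_all add: deriv_eq)

lemma cont: "continuous_on S \<phi>" "continuous_on S \<phi>'" "continuous_on S \<phi>''"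
  by (rule smooth_continuous smooth smooth')+

lemma cont_shift:
  "continuous_on S (\<lambda>x. \<phi> (x + y))" "continuous_on S (\<lambda>x. \<phi>' (x + y))" "continuous_on S (\<lambda>x. \<phi>'' (x + y))"
  by (rule continuous_on_compose2[OF cont(1)[of UNIV]] continuous_on_compose2[OF cont(2)[of UNIV]]
        continuous_on_compose2[OF cont(3)[of UNIV]]; (intro continuous_intros)?; simp)+

lemma per': "periodic L \<phi>'" "periodic L \<phi>''"
  using periodic_deriv[OF d1 per] periodic_deriv[OF d2] by blast+

lemma cont_r: "continuous_on S r" "continuous_on S r'"
proof -
  have 1: "r = (\<lambda>x. (\<phi> x - m) / \<beta> - cos (kap L * x))" using \<beta> by (simp add: fun_eq_iff dec)
  have "continuous_on S (\<lambda>x. (\<phi> x - m) / \<beta> - cos (kap L * x))" using \<beta> by (auto intro!: continuous_intros cont)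
  then show "continuous_on S r" by (simp only: 1[symmetric])
  have 2: "r' = (\<lambda>x. \<phi>' x / \<beta> + kap L * sin (kap L * x))" using \<beta> by (simp add: fun_eq_iff dec')
  have "continuous_on S (\<lambda>x. \<phi>' x / \<beta> + kap L * sin (kap L * x))" using \<beta> by (auto intro!: continuous_intros cont)
  then show "continuous_on S r'" by (simp only: 2[symmetric])
qed

lemma cont_r_shift: "continuous_on S (\<lambda>x. r (x + y))" "continuous_on S (\<lambda>x. r' (x + y))"
  by (rule continuous_on_compose2[OF cont_r(1)[of UNIV]] continuous_on_compose2[OF cont_r(2)[of UNIV]];
      (intro continuous_intros)?; simp)+

lemma h1_phi: "h1 L (\<lambda>x. \<phi> (x + y)) (\<lambda>x. \<phi>' (x + y))"
proof (rule h1_C1[OF L])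
  show "((\<lambda>x. \<phi> (x + y)) has_real_derivative \<phi>' (x + y)) (at x)" for x
    using d1[of "x + y"] by (simp add: DERIV_shift)
qed (auto intro: cont_shift periodic_shift per)

lemma eta_nonneg: "0 \<le> \<eta>" using b2[of 0] by linarith

lemma zeta_nonneg: "0 \<le> \<zeta>" using r(1)[of 0] by linarith

text \<open>Twice the second-order part of the functional at the translate by
  \<open>y\<close>.\<close>

definition "quad y h k = pint L (\<lambda>x. (c - \<phi> (x + y)) * (k x)\<^sup>2 - 2 * (\<phi>' (x + y) * (h x * k x)) + (c - 3 * (\<phi> (x + y))\<^sup>2) * (h x)\<^sup>2)"

definition "lin_F y h k = pint L (\<lambda>x. h x * \<phi> (x + y) + k x * \<phi>' (x + y))"

definition "higher y h k = pint L (\<lambda>x. \<phi> (x + y) * (h x * (h x)\<^sup>2) + (h x)\<^sup>2 * (h x)\<^sup>2 / 4 + h x * (k x)\<^sup>2 / 2)"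

text \<open>The terms in \<open>1 / \<beta>^2\<close> are the price for solving \<open>lin_F\<close>
  for the cosine coefficient. They multiply only squares of \<open>pint L h\<close> and
  \<open>lin_F\<close>, which the conservation laws control; their growth as \<open>k\<close> tends
  to \<open>0\<close> shrinks the radii below, but not the range of \<open>k\<close>.\<close>

definition "coer_const = D * (kap L)\<^sup>2 / L * (2 + 9 / \<beta>\<^sup>2 + 9 * m\<^sup>2 / \<beta>\<^sup>2)"

lemma coer_const_nonneg: "0 \<le> coer_const"
  using D L by (simp add: coer_const_def)

lemma sin_shift_smooth:
  "smooth_on UNIV (\<lambda>x. sin (kap L * (x + y)))" "periodic L (\<lambda>x. sin (kap L * (x + y)))"
proof -
  have s: "(\<lambda>x. sin (kap L * x)) = (\<lambda>x. (1/2) * cas L 1 x - (1/2) * cas L (-1) x)"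
    by (simp add: cas_def fun_eq_iff field_simps)
  have "smooth_on UNIV (\<lambda>x. sin (kap L * x))"
    unfolding s
    by (rule smooth_on_algebra[OF open_UNIV]) (intro gen_algebra_diff gen_algebra.mult gen_algebra.const gen_algebra.gen CollectI smooth_cas)
  from smooth_shift[OF this] show "smooth_on UNIV (\<lambda>x. sin (kap L * (x + y)))" .
  have "periodic L (\<lambda>x. sin (kap L * x))"
    unfolding s using periodic_cas[OF L] by (simp add: periodic_def)
  from periodic_shift[OF this] show "periodic L (\<lambda>x. sin (kap L * (x + y)))" .
qed

context
  fixes h k :: "real \<Rightarrow> real"
  assumes h: "h1 L h k"
begin

lemma sq: "sq_int L h" "sq_int L k" using h1_sq_int[OF h] by auto

lemma int_hk: "pintegrable L h" "pintegrable L k"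
  "pintegrable L (\<lambda>x. (h x)\<^sup>2)" "pintegrable L (\<lambda>x. (k x)\<^sup>2)" "pintegrable L (\<lambda>x. h x * k x)"
  using sq sq_int_integrable[OF sq(1)] sq_int_integrable[OF sq(2)] sq_int_mult[OF sq] by (simp_all add: sq_int_def)

lemma int_quad: "pintegrable L (\<lambda>x. (c - \<phi> (x + y)) * (k x)\<^sup>2)"
  "pintegrable L (\<lambda>x. \<phi>' (x + y) * (h x * k x))" "pintegrable L (\<lambda>x. (c - 3 * (\<phi> (x + y))\<^sup>2) * (h x)\<^sup>2)"
  by ((rule integrable_continuous_mult, intro continuous_intros cont_shift, rule int_hk)+)

lemma int_sq: "pintegrable L (\<lambda>x. (h x)\<^sup>2 + (k x)\<^sup>2)"
  using int_hk by simp

text \<open>With frozen coefficients the form takes on mode \<open>n\<close> a value proportional to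
  \<open>n^2 - 1\<close>. The cross term costs \<open>\<eta> (h^2 + k^2)\<close> and each other term
  \<open>\<eta>\<close> times one square, hence the factor \<open>2\<close>.\<close>

lemma quad_near: "\<bar>quad y h k - D * (pint L (\<lambda>x. (k x)\<^sup>2) - (kap L)\<^sup>2 * pint L (\<lambda>x. (h x)\<^sup>2))\<bar> \<le> 2 * \<eta> * h1_sq L h k"
proof -
  have eq: "quad y h k - D * (pint L (\<lambda>x. (k x)\<^sup>2) - (kap L)\<^sup>2 * pint L (\<lambda>x. (h x)\<^sup>2))
    = pint L (\<lambda>x. (c - \<phi> (x + y)) * (k x)\<^sup>2 - 2 * (\<phi>' (x + y) * (h x * k x)) + (c - 3 * (\<phi> (x + y))\<^sup>2) * (h x)\<^sup>2
       - (D * (k x)\<^sup>2 - D * (kap L)\<^sup>2 * (h x)\<^sup>2))"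
    unfolding quad_def using int_quad[of y] int_hk by (simp add: right_diff_distrib)
  have "\<bar>pint L (\<lambda>x. (c - \<phi> (x + y)) * (k x)\<^sup>2 - 2 * (\<phi>' (x + y) * (h x * k x)) + (c - 3 * (\<phi> (x + y))\<^sup>2) * (h x)\<^sup>2
       - (D * (k x)\<^sup>2 - D * (kap L)\<^sup>2 * (h x)\<^sup>2))\<bar> \<le> pint L (\<lambda>x. 2 * \<eta> * ((h x)\<^sup>2 + (k x)\<^sup>2))"
  proof (rule abs_integral_le)
    show "AE x in per_measure L. \<bar>(c - \<phi> (x + y)) * (k x)\<^sup>2 - 2 * (\<phi>' (x + y) * (h x * k x)) + (c - 3 * (\<phi> (x + y))\<^sup>2) * (h x)\<^sup>2
       - (D * (k x)\<^sup>2 - D * (kap L)\<^sup>2 * (h x)\<^sup>2)\<bar> \<le> 2 * \<eta> * ((h x)\<^sup>2 + (k x)\<^sup>2)"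
    proof (rule AE_I2)
      fix x
      define p p' a b where "p = \<phi> (x + y)" and "p' = \<phi>' (x + y)" and "a = h x" and "b = k x"
      have "\<bar>(c - p - D) * b\<^sup>2\<bar> \<le> \<eta> * b\<^sup>2" "\<bar>(c - 3 * p\<^sup>2 + D * (kap L)\<^sup>2) * a\<^sup>2\<bar> \<le> \<eta> * a\<^sup>2"
        using b1[of "x + y"] b3[of "x + y"] by (auto simp: abs_mult p_def intro!: mult_right_mono)
      moreover have "\<bar>2 * (p' * (a * b))\<bar> \<le> \<eta> * (a\<^sup>2 + b\<^sup>2)"
      proof -
        have "2 * (\<bar>a\<bar> * \<bar>b\<bar>) \<le> a\<^sup>2 + b\<^sup>2" using sum_squares_bound[of "\<bar>a\<bar>" "\<bar>b\<bar>"] by (simp add: mult.assoc)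
        then have "\<bar>p'\<bar> * (2 * (\<bar>a\<bar> * \<bar>b\<bar>)) \<le> \<eta> * (a\<^sup>2 + b\<^sup>2)"
          using b2[of "x + y"] by (intro mult_mono) (auto simp: p'_def)
        then show ?thesis by (simp add: abs_mult mult_ac)
      qed
      moreover have "(c - p) * b\<^sup>2 - 2 * (p' * (a * b)) + (c - 3 * p\<^sup>2) * a\<^sup>2 - (D * b\<^sup>2 - D * (kap L)\<^sup>2 * a\<^sup>2)
        = (c - p - D) * b\<^sup>2 - 2 * (p' * (a * b)) + (c - 3 * p\<^sup>2 + D * (kap L)\<^sup>2) * a\<^sup>2" by (simp add: algebra_simps)
      ultimately have "\<bar>(c - p) * b\<^sup>2 - 2 * (p' * (a * b)) + (c - 3 * p\<^sup>2) * a\<^sup>2 - (D * b\<^sup>2 - D * (kap L)\<^sup>2 * a\<^sup>2)\<bar>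
        \<le> \<eta> * b\<^sup>2 + \<eta> * (a\<^sup>2 + b\<^sup>2) + \<eta> * a\<^sup>2" by linarith
      then show "\<bar>(c - \<phi> (x + y)) * (k x)\<^sup>2 - 2 * (\<phi>' (x + y) * (h x * k x)) + (c - 3 * (\<phi> (x + y))\<^sup>2) * (h x)\<^sup>2
       - (D * (k x)\<^sup>2 - D * (kap L)\<^sup>2 * (h x)\<^sup>2)\<bar> \<le> 2 * \<eta> * ((h x)\<^sup>2 + (k x)\<^sup>2)"
        by (simp add: p_def p'_def a_def b_def algebra_simps)
    qed
    show "pintegrable L (\<lambda>x. (c - \<phi> (x + y)) * (k x)\<^sup>2 - 2 * (\<phi>' (x + y) * (h x * k x)) + (c - 3 * (\<phi> (x + y))\<^sup>2) * (h x)\<^sup>2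
       - (D * (k x)\<^sup>2 - D * (kap L)\<^sup>2 * (h x)\<^sup>2))"
      by (intro Bochner_Integration.integrable_add Bochner_Integration.integrable_diff
          Bochner_Integration.integrable_mult_right int_quad int_hk)
    show "pintegrable L (\<lambda>x. 2 * \<eta> * ((h x)\<^sup>2 + (k x)\<^sup>2))"
      by (intro Bochner_Integration.integrable_mult_right int_sq)
  qed
  then show ?thesis unfolding eq by (simp add: h1_sq_def)
qed

text \<open>A translation rotates the pair of first-mode coefficients. So orthogonality to the
  shifted sine can be combined with the Wirtinger inequality, which involves the unshifted
  modes.\<close>

lemma mode_rotate:
  "(pint L (\<lambda>x. h x * cos (kap L * (x + y))))\<^sup>2 + (pint L (\<lambda>x. h x * sin (kap L * (x + y))))\<^sup>2
    = (pint L (\<lambda>x. h x * cos (kap L * x)))\<^sup>2 + (pint L (\<lambda>x. h x * sin (kap L * x)))\<^sup>2"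
proof -
  define P S where "P = pint L (\<lambda>x. h x * cos (kap L * x))" and "S = pint L (\<lambda>x. h x * sin (kap L * x))"
  define C s where "C = cos (kap L * y)" and "s = sin (kap L * y)"
  have i: "pintegrable L (\<lambda>x. h x * cos (kap L * x))" "pintegrable L (\<lambda>x. h x * sin (kap L * x))"
    by (rule sq_int_mult_continuous[OF sq(1)]; intro continuous_intros)+
  have 1: "pint L (\<lambda>x. h x * cos (kap L * (x + y))) = C * P - s * S"
  proof -
    have "pint L (\<lambda>x. h x * cos (kap L * (x + y))) = pint L (\<lambda>x. C * (h x * cos (kap L * x)) - s * (h x * sin (kap L * x)))"
      by (simp add: distrib_left cos_add C_def s_def algebra_simps)
    then show ?thesis using i by (simp add: P_def S_def)
  qed
  have 2: "pint L (\<lambda>x. h x * sin (kap L * (x + y))) = s * P + C * S"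
  proof -
    have "pint L (\<lambda>x. h x * sin (kap L * (x + y))) = pint L (\<lambda>x. s * (h x * cos (kap L * x)) + C * (h x * sin (kap L * x)))"
      by (simp add: distrib_left sin_add C_def s_def algebra_simps)
    then show ?thesis using i by (simp add: P_def S_def)
  qed
  have "C\<^sup>2 + s\<^sup>2 = 1" by (simp add: C_def s_def)
  moreover have "(C * P - s * S)\<^sup>2 + (s * P + C * S)\<^sup>2 = (C\<^sup>2 + s\<^sup>2) * (P\<^sup>2 + S\<^sup>2)"
    by (simp add: power2_eq_square algebra_simps)
  ultimately show ?thesis unfolding 1 2 P_def[symmetric] S_def[symmetric] by simp
qed

text \<open>The constraint \<open>F\<close> controls the cosine mode, because \<open>\<phi> - \<phi>''\<close> is to leading order
  \<open>m + \<beta> (1 + \<kappa>\<^sup>2) cos\<close>.\<close>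

lemma cos_mode_bound:
  "(pint L (\<lambda>x. h x * cos (kap L * (x + y))))\<^sup>2
    \<le> 3 * ((lin_F y h k)\<^sup>2 / \<beta>\<^sup>2 + m\<^sup>2 * (pint L h)\<^sup>2 / \<beta>\<^sup>2 + 2 * L * \<zeta>\<^sup>2 * h1_sq L h k)"
proof -
  define N P where "N = h1_sq L h k" and "P = pint L (\<lambda>x. h x * cos (kap L * (x + y)))"
  define \<rho> where "\<rho> = pint L (\<lambda>x. h x * r (x + y) + k x * r' (x + y))"
  have i: "pintegrable L (\<lambda>x. h x * cos (kap L * (x + y)))"
    "pintegrable L (\<lambda>x. k x * sin (kap L * (x + y)))"
    by (rule sq_int_mult_continuous[OF sq(1)] sq_int_mult_continuous[OF sq(2)]; intro continuous_intros)+
  have ir: "pintegrable L (\<lambda>x. h x * r (x + y))" "pintegrable L (\<lambda>x. k x * r' (x + y))"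
    by (rule sq_int_mult_continuous[OF sq(1)] sq_int_mult_continuous[OF sq(2)]; rule cont_r_shift)+
  \<comment> \<open>Testing with the sine turns the contribution of \<open>k\<close> into
    \<open>(kap L)^2 * P\<close>. The resulting factor \<open>1 + (kap L)^2\<close> is at least
    \<open>1\<close> and is dropped at the end.\<close>
  have S: "pint L (\<lambda>x. k x * sin (kap L * (x + y))) = - (kap L * P)"
  proof -
    have "deriv (\<lambda>x. sin (kap L * (x + y))) = (\<lambda>x. kap L * cos (kap L * (x + y)))"
      by (rule ext, rule DERIV_imp_deriv) (auto intro!: derivative_eq_intros)
    then have "pint L (\<lambda>x. h x * (kap L * cos (kap L * (x + y)))) = - pint L (\<lambda>x. k x * sin (kap L * (x + y)))"
      using h1_parts[OF h sin_shift_smooth[of y]] by simp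
    moreover have "pint L (\<lambda>x. h x * (kap L * cos (kap L * (x + y)))) = kap L * P"
      unfolding P_def by (simp add: mult.left_commute[of _ "kap L"])
    ultimately show ?thesis by simp
  qed
  have "lin_F y h k = pint L (\<lambda>x. m * h x + \<beta> * (h x * cos (kap L * (x + y))) - \<beta> * kap L * (k x * sin (kap L * (x + y)))
     + \<beta> * (h x * r (x + y) + k x * r' (x + y)))"
    unfolding lin_F_def dec dec' by (rule Bochner_Integration.integral_cong) (auto simp: algebra_simps)
  also have "\<dots> = m * pint L h + \<beta> * P - \<beta> * kap L * pint L (\<lambda>x. k x * sin (kap L * (x + y))) + \<beta> * \<rho>"
    using i ir int_hk by (simp add: P_def \<rho>_def)
  also have "\<dots> = m * pint L h + \<beta> * ((1 + (kap L)\<^sup>2) * P + \<rho>)"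
    unfolding S by (simp add: algebra_simps power2_eq_square)
  finally have e: "(1 + (kap L)\<^sup>2) * P = lin_F y h k / \<beta> + - m * pint L h / \<beta> + - \<rho>"
    using \<beta> by (simp add: field_simps)
  have \<rho>: "\<rho>\<^sup>2 \<le> 2 * L * \<zeta>\<^sup>2 * N"
  proof -
    define a b where "a = pint L (\<lambda>x. (h x)\<^sup>2)" and "b = pint L (\<lambda>x. (k x)\<^sup>2)"
    have ab: "0 \<le> a" "0 \<le> b" "N = a + b" unfolding a_def b_def N_def h1_sq_split[OF h] by auto
    have "\<bar>\<rho>\<bar> \<le> pint L (\<lambda>x. \<zeta> * (\<bar>h x\<bar> + \<bar>k x\<bar>))"
      unfolding \<rho>_def
    proof (rule abs_integral_le)
      show "AE x in per_measure L. \<bar>h x * r (x + y) + k x * r' (x + y)\<bar> \<le> \<zeta> * (\<bar>h x\<bar> + \<bar>k x\<bar>)"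
      proof (rule AE_I2)
        fix x
        have "\<bar>h x * r (x + y)\<bar> \<le> \<bar>h x\<bar> * \<zeta>" "\<bar>k x * r' (x + y)\<bar> \<le> \<bar>k x\<bar> * \<zeta>"
          using r[of "x + y"] by (auto simp: abs_mult intro!: mult_left_mono)
        then show "\<bar>h x * r (x + y) + k x * r' (x + y)\<bar> \<le> \<zeta> * (\<bar>h x\<bar> + \<bar>k x\<bar>)"
          by (simp add: algebra_simps)
      qed
    qed (use ir int_hk in auto)
    also have "\<dots> = \<zeta> * (pint L (\<lambda>x. \<bar>h x\<bar>) + pint L (\<lambda>x. \<bar>k x\<bar>))" using int_hk by simp
    also have "\<dots> \<le> \<zeta> * (sqrt (L * a) + sqrt (L * b))"
      using integral_abs_le[OF sq(1)] integral_abs_le[OF sq(2)] L zeta_nonneg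
      by (intro mult_left_mono add_mono) (auto simp: a_def b_def)
    finally have "\<rho>\<^sup>2 \<le> (\<zeta> * (sqrt (L * a) + sqrt (L * b)))\<^sup>2"
      using power_mono[of "\<bar>\<rho>\<bar>" _ 2] by simp
    also have "\<dots> = \<zeta>\<^sup>2 * (sqrt (L * a) + sqrt (L * b))\<^sup>2" by (simp add: power_mult_distrib)
    also have "\<dots> \<le> \<zeta>\<^sup>2 * (2 * (L * a) + 2 * (L * b))"
    proof (rule mult_left_mono)
      have "(s + t)\<^sup>2 \<le> 2 * s\<^sup>2 + 2 * t\<^sup>2" for s t :: real
        using sum_squares_bound[of s t] by (simp add: power2_sum)
      from this[of "sqrt (L * a)" "sqrt (L * b)"]
      show "(sqrt (L * a) + sqrt (L * b))\<^sup>2 \<le> 2 * (L * a) + 2 * (L * b)" using L ab by simp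
    qed simp
    finally show ?thesis unfolding ab(3) by (simp add: algebra_simps)
  qed
  have "P\<^sup>2 \<le> ((1 + (kap L)\<^sup>2) * P)\<^sup>2"
  proof -
    have "1\<^sup>2 \<le> (1 + (kap L)\<^sup>2)\<^sup>2" by (intro power_mono) auto
    then show ?thesis unfolding power_mult_distrib using mult_right_mono[of "1" _ "P\<^sup>2"] by simp
  qed
  also have "\<dots> \<le> 3 * ((lin_F y h k / \<beta>)\<^sup>2 + (- m * pint L h / \<beta>)\<^sup>2 + (- \<rho>)\<^sup>2)"
  proof -
    have "(u + v + w)\<^sup>2 \<le> 3 * (u\<^sup>2 + v\<^sup>2 + w\<^sup>2)" for u v w :: real
      using sum_squares_bound[of u v] sum_squares_bound[of v w] sum_squares_bound[of u w]
      by (simp add: power2_eq_square algebra_simps)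
    then show ?thesis unfolding e .
  qed
  also have "\<dots> \<le> 3 * ((lin_F y h k)\<^sup>2 / \<beta>\<^sup>2 + m\<^sup>2 * (pint L h)\<^sup>2 / \<beta>\<^sup>2 + 2 * L * \<zeta>\<^sup>2 * N)"
    using \<rho> by (intro mult_left_mono add_mono) (simp_all add: power_mult_distrib power_divide)
  finally show ?thesis by (simp add: N_def P_def)
qed

text \<open>Half of the Wirtinger inequality bounds \<open>b - \<kappa>^2 a\<close> below by
  \<open>b / 2 + \<kappa>^2 a\<close> up to low modes, hence the minimum of \<open>1/2\<close> and
  \<open>\<kappa>^2\<close>. The sine mode vanishes and the cosine mode is bounded by
  \<open>cos_mode_bound\<close>; the multiples of the norm that remain are absorbed through
  \<open>small\<close>, which leaves \<open>gap\<close>.\<close>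

lemma quad_coercive:
  assumes s0: "pint L (\<lambda>x. h x * sin (kap L * (x + y))) = 0"
  shows "gap * h1_sq L h k \<le> quad y h k + coer_const * ((pint L h)\<^sup>2 + (lin_F y h k)\<^sup>2)"
proof -
  define a b N \<kappa> where "a = pint L (\<lambda>x. (h x)\<^sup>2)" and "b = pint L (\<lambda>x. (k x)\<^sup>2)" and "N = h1_sq L h k" and "\<kappa> = kap L"
  define P where "P = (pint L (\<lambda>x. h x * cos (kap L * (x + y))))\<^sup>2"
  define V F where "V = (pint L h)\<^sup>2" and "F = (lin_F y h k)\<^sup>2"
  have ab: "0 \<le> a" "0 \<le> b" "N = a + b" unfolding a_def b_def N_def h1_sq_split[OF h] by auto
  have modes: "(pint L (\<lambda>x. h x * cos (kap L * x)))\<^sup>2 + (pint L (\<lambda>x. h x * sin (kap L * x)))\<^sup>2 = P"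
    using mode_rotate[of y] s0 by (simp add: P_def)
  have W: "4 * \<kappa>\<^sup>2 * a \<le> b + \<kappa>\<^sup>2 / L * (4 * V + 6 * P)"
    using h1_Wirtinger[OF L h] unfolding modes a_def b_def V_def \<kappa>_def .
  have PP: "P \<le> 3 * (F / \<beta>\<^sup>2 + m\<^sup>2 * V / \<beta>\<^sup>2 + 2 * L * \<zeta>\<^sup>2 * N)"
    using cos_mode_bound[of y] by (simp add: P_def F_def V_def N_def)
  define \<mu> where "\<mu> = min (1/2) (\<kappa>\<^sup>2)"
  have "\<mu> * N \<le> 1/2 * b + \<kappa>\<^sup>2 * a"
  proof -
    have "\<mu> * b \<le> 1/2 * b" "\<mu> * a \<le> \<kappa>\<^sup>2 * a" using ab by (intro mult_right_mono; simp add: \<mu>_def)+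
    then show ?thesis unfolding ab(3) by (simp add: distrib_left)
  qed
  also have "\<dots> \<le> b - \<kappa>\<^sup>2 * a + \<kappa>\<^sup>2 / L * (2 * V + 3 * P)"
  proof -
    have "\<kappa>\<^sup>2 / L * (4 * V + 6 * P) = 2 * (\<kappa>\<^sup>2 / L * (2 * V + 3 * P))" by (simp add: algebra_simps)
    then show ?thesis using W by linarith
  qed
  finally have "D * (\<mu> * N) \<le> D * (b - \<kappa>\<^sup>2 * a + \<kappa>\<^sup>2 / L * (2 * V + 3 * P))"
    using D by (intro mult_left_mono) auto
  also have "\<dots> \<le> D * (b - \<kappa>\<^sup>2 * a + \<kappa>\<^sup>2 / L * (2 * V + 9 * (F / \<beta>\<^sup>2 + m\<^sup>2 * V / \<beta>\<^sup>2 + 2 * L * \<zeta>\<^sup>2 * N)))"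
    using PP D L by (intro mult_left_mono add_left_mono) auto
  also have "\<dots> = D * (b - \<kappa>\<^sup>2 * a) + D * \<kappa>\<^sup>2 / L * (2 * V + 9 * (F / \<beta>\<^sup>2 + m\<^sup>2 * V / \<beta>\<^sup>2)) + 18 * D * \<kappa>\<^sup>2 * \<zeta>\<^sup>2 * N"
    using L by (simp add: field_simps)
  also have "D * \<kappa>\<^sup>2 / L * (2 * V + 9 * (F / \<beta>\<^sup>2 + m\<^sup>2 * V / \<beta>\<^sup>2)) \<le> coer_const * (V + F)"
  proof -
    define i j where "i = 1 / \<beta>\<^sup>2" and "j = m\<^sup>2 / \<beta>\<^sup>2"
    have ij: "F / \<beta>\<^sup>2 = i * F" "m\<^sup>2 * V / \<beta>\<^sup>2 = j * V" "9 / \<beta>\<^sup>2 = 9 * i" "9 * m\<^sup>2 / \<beta>\<^sup>2 = 9 * j"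
      by (simp_all add: i_def j_def)
    have "0 \<le> i * V" "0 \<le> j * F" "0 \<le> F" by (auto simp: V_def F_def i_def j_def)
    then have "2 * V + 9 * (F / \<beta>\<^sup>2 + m\<^sup>2 * V / \<beta>\<^sup>2) \<le> (2 + 9 / \<beta>\<^sup>2 + 9 * m\<^sup>2 / \<beta>\<^sup>2) * (V + F)"
      unfolding ij by (simp add: algebra_simps)
    then show ?thesis
      unfolding coer_const_def \<kappa>_def mult.assoc using D L by (intro mult_left_mono) (auto simp: mult_left_mono)
  qed
  finally have 1: "D * \<mu> * N \<le> D * (b - \<kappa>\<^sup>2 * a) + coer_const * (V + F) + 18 * D * \<kappa>\<^sup>2 * \<zeta>\<^sup>2 * N"
    by (simp add: mult.assoc)
  have 2: "D * (b - \<kappa>\<^sup>2 * a) \<le> quad y h k + 2 * \<eta> * N"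
    using quad_near[of y] by (simp add: a_def b_def N_def \<kappa>_def abs_le_iff)
  have "(2 * \<eta> + 18 * D * \<kappa>\<^sup>2 * \<zeta>\<^sup>2) * N \<le> (D * \<mu> / 2) * N"
    using small(1) ab by (intro mult_right_mono) (auto simp: \<mu>_def \<kappa>_def)
  then have "D * \<mu> / 2 * N \<le> quad y h k + coer_const * (V + F)"
    using 1 2 by (simp add: algebra_simps)
  then show ?thesis by (simp add: gap_def \<mu>_def \<kappa>_def N_def V_def F_def)
qed

end

end

lemma sob_const_nonneg: "L > 0 \<Longrightarrow> 0 \<le> sob_const L"
  by (simp add: sob_const_def)

context stable_wave
begin

abbreviation "dist_sq u g y \<equiv> h1_sq L (\<lambda>x. u x - \<phi> (x + y)) (\<lambda>x. g x - \<phi>' (x + y))"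

abbreviation "sin_mode u y \<equiv> pint L (\<lambda>x. (u x - \<phi> (x + y)) * sin (kap L * (x + y)))"

definition "sup_phi = \<bar>c\<bar> + D + \<eta>"

lemma phi_bound: "\<bar>\<phi> x\<bar> \<le> sup_phi"
  using b1[of x] D unfolding sup_phi_def by linarith

definition "higher_const = sup_phi * sob_const L + (sob_const L)\<^sup>2 / 4 + sob_const L / 2"

lemma higher_const_nonneg: "0 \<le> higher_const"
  using sob_const_nonneg[OF L] D eta_nonneg by (simp add: higher_const_def sup_phi_def)

context
  fixes h k :: "real \<Rightarrow> real"
  assumes h: "h1 L h k"
begin

lemma int_higher:
  "pintegrable L (\<lambda>x. \<phi> (x + y) * (h x * (h x)\<^sup>2))"
  "pintegrable L (\<lambda>x. (h x)\<^sup>2 * (h x)\<^sup>2)" "pintegrable L (\<lambda>x. h x * (k x)\<^sup>2)"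
proof -
  note b = h1_sup_bound[OF L h]
  have m: "h \<in> borel_measurable (per_measure L)" using sq[OF h] by (simp add: sq_int_def)
  have 1: "pintegrable L (\<lambda>x. h x * (h x)\<^sup>2)" "pintegrable L (\<lambda>x. h x * (k x)\<^sup>2)"
    by (rule integrable_AE_bounded_mult[OF b m] int_hk(3,4)[OF h])+
  have "pintegrable L (\<lambda>x. h x * (h x * (h x)\<^sup>2))"
    by (rule integrable_AE_bounded_mult[OF b m 1(1)])
  then show "pintegrable L (\<lambda>x. (h x)\<^sup>2 * (h x)\<^sup>2)" by (simp add: power2_eq_square mult.assoc)
  show "pintegrable L (\<lambda>x. \<phi> (x + y) * (h x * (h x)\<^sup>2))"
    by (rule integrable_continuous_mult[OF cont_shift(1) 1(1)])
  show "pintegrable L (\<lambda>x. h x * (k x)\<^sup>2)" by (rule 1(2))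
qed

text \<open>The sup bound takes a factor \<open>sqrt N\<close> out of the cubic terms; the quartic
  term yields a factor \<open>N\<close>, weakened to \<open>sqrt N\<close> by
  \<open>N \<le> 1\<close>. The order \<open>N^(3/2)\<close> is beaten by the quadratic form for
  small \<open>N\<close>.\<close>

lemma higher_bound:
  assumes N1: "h1_sq L h k \<le> 1"
  shows "\<bar>higher y h k\<bar> \<le> higher_const * (sqrt (h1_sq L h k) * h1_sq L h k)"
proof -
  define N where "N = h1_sq L h k"
  define C where "C = sob_const L"
  define s where "s = C * sqrt N"
  have N: "0 \<le> N" "N \<le> 1" using N1 by (auto simp: N_def h1_sq_nonneg)
  have C: "0 \<le> C" using sob_const_nonneg[OF L] by (simp add: C_def)
  have s: "0 \<le> s" using C N by (simp add: s_def)
  have B: "0 \<le> sup_phi" using phi_bound[of 0] by linarith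
  have "\<bar>higher y h k\<bar> \<le> pint L (\<lambda>x. (sup_phi * s + s\<^sup>2 / 4 + s / 2) * ((h x)\<^sup>2 + (k x)\<^sup>2))"
    unfolding higher_def
  proof (rule abs_integral_le)
    show "AE x in per_measure L. \<bar>\<phi> (x + y) * (h x * (h x)\<^sup>2) + (h x)\<^sup>2 * (h x)\<^sup>2 / 4 + h x * (k x)\<^sup>2 / 2\<bar>
      \<le> (sup_phi * s + s\<^sup>2 / 4 + s / 2) * ((h x)\<^sup>2 + (k x)\<^sup>2)"
      using h1_sup_bound[OF L h]
    proof eventually_elim
      case (elim x)
      then have hx: "\<bar>h x\<bar> \<le> s" by (simp add: s_def C_def N_def)
      have h2: "(h x)\<^sup>2 \<le> s\<^sup>2" using hx s by (simp add: abs_le_square_iff[symmetric])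
      have "\<bar>\<phi> (x + y) * (h x * (h x)\<^sup>2)\<bar> \<le> sup_phi * (s * (h x)\<^sup>2)"
        unfolding abs_mult using hx phi_bound[of "x + y"] B by (intro mult_mono) auto
      moreover have "(h x)\<^sup>2 * (h x)\<^sup>2 \<le> s\<^sup>2 * (h x)\<^sup>2" using h2 by (rule mult_right_mono) simp
      moreover have "\<bar>h x * (k x)\<^sup>2\<bar> \<le> s * (k x)\<^sup>2" unfolding abs_mult using hx by (intro mult_mono) (auto simp: s)
      moreover have "0 \<le> (sup_phi * s) * (k x)\<^sup>2" "0 \<le> s\<^sup>2 * (k x)\<^sup>2" "0 \<le> s * (h x)\<^sup>2" using s B by auto
      moreover have "(sup_phi * s + s\<^sup>2 / 4 + s / 2) * ((h x)\<^sup>2 + (k x)\<^sup>2)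
        = sup_phi * (s * (h x)\<^sup>2) + (sup_phi * s) * (k x)\<^sup>2 + s\<^sup>2 * (h x)\<^sup>2 / 4 + s\<^sup>2 * (k x)\<^sup>2 / 4 + s * (h x)\<^sup>2 / 2 + s * (k x)\<^sup>2 / 2"
        by (simp add: algebra_simps add_divide_distrib)
      moreover have "0 \<le> (h x)\<^sup>2 * (h x)\<^sup>2" by simp
      ultimately show ?case by linarith
    qed
  qed (use int_higher int_sq[OF h] in simp_all)
  also have "\<dots> = (sup_phi * s + s\<^sup>2 / 4 + s / 2) * N" by (simp add: N_def h1_sq_def)
  also have "\<dots> \<le> (higher_const * sqrt N) * N"
  proof (rule mult_right_mono[OF _ N(1)])
    have "sqrt N * sqrt N \<le> sqrt N * 1" using N by (intro mult_left_mono) auto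
    then have "C\<^sup>2 * (sqrt N * sqrt N) \<le> C\<^sup>2 * sqrt N" by (simp add: mult_left_mono)
    then show "sup_phi * s + s\<^sup>2 / 4 + s / 2 \<le> higher_const * sqrt N"
      unfolding s_def higher_const_def C_def[symmetric] by (simp add: algebra_simps power2_eq_square)
  qed
  finally show ?thesis by (simp add: N_def mult.assoc)
qed

lemma quad_bound: "\<bar>quad y h k\<bar> \<le> (D + D * (kap L)\<^sup>2 + 2 * \<eta>) * h1_sq L h k"
proof -
  define a b where "a = pint L (\<lambda>x. (h x)\<^sup>2)" and "b = pint L (\<lambda>x. (k x)\<^sup>2)"
  have ab: "0 \<le> a" "0 \<le> b" "h1_sq L h k = a + b" unfolding a_def b_def h1_sq_split[OF h] by auto
  have "\<bar>quad y h k - D * (b - (kap L)\<^sup>2 * a)\<bar> \<le> 2 * \<eta> * (a + b)"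
    using quad_near[OF h, of y] unfolding ab(3) a_def b_def .
  moreover have "\<bar>D * (b - (kap L)\<^sup>2 * a)\<bar> \<le> D * b + D * (kap L)\<^sup>2 * a"
  proof -
    have "0 \<le> D * b" "0 \<le> D * (kap L)\<^sup>2 * a" using D ab by auto
    then show ?thesis unfolding right_diff_distrib mult.assoc[symmetric] by linarith
  qed
  moreover have "0 \<le> D * a" "0 \<le> D * (kap L)\<^sup>2 * b" using D ab by auto
  moreover have "(D + D * (kap L)\<^sup>2 + 2 * \<eta>) * (a + b) = D * a + D * b + D * (kap L)\<^sup>2 * a + D * (kap L)\<^sup>2 * b + 2 * \<eta> * (a + b)"
    by (simp add: algebra_simps)
  ultimately show ?thesis unfolding ab(3) by linarith
qed

lemma lin_F_bound: "\<bar>lin_F y h k\<bar> \<le> (sup_phi + \<eta>) * sqrt L * sqrt (h1_sq L h k)"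
proof -
  have i: "pintegrable L (\<lambda>x. h x * \<phi> (x + y))" "pintegrable L (\<lambda>x. k x * \<phi>' (x + y))"
    by (rule sq_int_mult_continuous[OF sq(1)[OF h]] sq_int_mult_continuous[OF sq(2)[OF h]]; rule cont_shift)+
  have "\<bar>pint L (\<lambda>x. h x * \<phi> (x + y))\<bar> \<le> sup_phi * (sqrt L * sqrt (h1_sq L h k))"
    by (rule h1_pint_bounded_mult_le[OF L h cont_shift(1) phi_bound])
  moreover have "\<bar>pint L (\<lambda>x. k x * \<phi>' (x + y))\<bar> \<le> \<eta> * (sqrt L * sqrt (h1_sq L h k))"
  proof -
    have "\<bar>pint L (\<lambda>x. k x * \<phi>' (x + y))\<bar> \<le> pint L (\<lambda>x. \<eta> * \<bar>k x\<bar>)"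
    proof (rule abs_integral_le[OF i(2)])
      show "AE x in per_measure L. \<bar>k x * \<phi>' (x + y)\<bar> \<le> \<eta> * \<bar>k x\<bar>"
      proof (rule AE_I2)
        fix x
        have "\<bar>\<phi>' (x + y)\<bar> * \<bar>k x\<bar> \<le> \<eta> * \<bar>k x\<bar>" using b2 by (intro mult_right_mono) auto
        then show "\<bar>k x * \<phi>' (x + y)\<bar> \<le> \<eta> * \<bar>k x\<bar>" by (simp add: abs_mult mult.commute)
      qed
    qed (use int_hk[OF h] in simp)
    also have "\<dots> \<le> \<eta> * (sqrt L * sqrt (h1_sq L h k))"
      using h1_pint_abs_le(2)[OF L h] eta_nonneg by (simp add: mult_left_mono)
    finally show ?thesis .
  qed
  moreover have "lin_F y h k = pint L (\<lambda>x. h x * \<phi> (x + y)) + pint L (\<lambda>x. k x * \<phi>' (x + y))"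
    unfolding lin_F_def using i by simp
  moreover have "(sup_phi + \<eta>) * sqrt L * sqrt (h1_sq L h k) = sup_phi * (sqrt L * sqrt (h1_sq L h k)) + \<eta> * (sqrt L * sqrt (h1_sq L h k))"
    by (simp add: algebra_simps)
  ultimately show ?thesis by linarith
qed

end

lemma psi_smooth: "smooth_on UNIV (\<lambda>x. (\<phi> (x + y) - c) * \<phi>' (x + y))" "periodic L (\<lambda>x. (\<phi> (x + y) - c) * \<phi>' (x + y))"
proof -
  show "smooth_on UNIV (\<lambda>x. (\<phi> (x + y) - c) * \<phi>' (x + y))"
    by (rule smooth_on_algebra[OF open_UNIV])
      (intro gen_algebra.mult gen_algebra_diff gen_algebra.const gen_algebra.gen CollectI smooth_shift smooth smooth')
  show "periodic L (\<lambda>x. (\<phi> (x + y) - c) * \<phi>' (x + y))"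
    using periodic_shift[OF per, of y] periodic_shift[OF per'(1), of y] by (simp add: periodic_def)
qed

text \<open>The integrand is \<open>\<psi>' h + \<psi> k\<close> for the smooth periodic function
  \<open>\<psi> = (\<phi> - c) \<phi>'\<close>, so the definition of the weak derivative applies.
  This expresses that the wave is a critical point.\<close>

lemma linear_part_zero:
  assumes "h1 L h k"
  shows "pint L (\<lambda>x. ((\<phi>' (x + y))\<^sup>2 + (\<phi> (x + y) - c) * \<phi>'' (x + y)) * h x + (\<phi> (x + y) - c) * \<phi>' (x + y) * k x) = 0"
proof -
  have "deriv (\<lambda>x. (\<phi> (x + y) - c) * \<phi>' (x + y)) x = (\<phi>' (x + y))\<^sup>2 + (\<phi> (x + y) - c) * \<phi>'' (x + y)" for x
  proof (rule DERIV_imp_deriv)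
    have "((\<lambda>x. \<phi> (x + y)) has_real_derivative \<phi>' (x + y)) (at x)" "((\<lambda>x. \<phi>' (x + y)) has_real_derivative \<phi>'' (x + y)) (at x)"
      using d1[of "x + y"] d2[of "x + y"] by (simp_all add: DERIV_shift)
    then show "((\<lambda>x. (\<phi> (x + y) - c) * \<phi>' (x + y)) has_real_derivative (\<phi>' (x + y))\<^sup>2 + (\<phi> (x + y) - c) * \<phi>'' (x + y)) (at x)"
      by (auto intro!: derivative_eq_intros simp: power2_eq_square)
  qed
  then have "pint L (\<lambda>x. h x * ((\<phi>' (x + y))\<^sup>2 + (\<phi> (x + y) - c) * \<phi>'' (x + y)))
     = - pint L (\<lambda>x. k x * ((\<phi> (x + y) - c) * \<phi>' (x + y)))"
    using h1_parts[OF assms psi_smooth[of y]] by simp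
  moreover have "pintegrable L (\<lambda>x. h x * ((\<phi>' (x + y))\<^sup>2 + (\<phi> (x + y) - c) * \<phi>'' (x + y)))"
    "pintegrable L (\<lambda>x. k x * ((\<phi> (x + y) - c) * \<phi>' (x + y)))"
    by (rule sq_int_mult_continuous[OF sq(1)[OF assms]] sq_int_mult_continuous[OF sq(2)[OF assms]];
        intro continuous_intros cont_shift)+
  ultimately have "pint L (\<lambda>x. h x * ((\<phi>' (x + y))\<^sup>2 + (\<phi> (x + y) - c) * \<phi>'' (x + y)) + k x * ((\<phi> (x + y) - c) * \<phi>' (x + y))) = 0"
    by simp
  then show ?thesis by (simp add: mult.commute)
qed

definition "energy_G u = energy_E L u + c * energy_F L u - A * mass_V L u"

lemma energy_G_phi: "pint L (\<lambda>x. energy_density c A (\<phi> (x + y)) (\<phi>' (x + y))) = energy_G \<phi>"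
proof -
  have "pint L (\<lambda>x. energy_density c A (\<phi> (x + y)) (\<phi>' (x + y))) = pint L (\<lambda>x. energy_density c A (\<phi> x) (\<phi>' x))"
  proof (rule pint_shift[OF L])
    show "continuous_on UNIV (\<lambda>x. energy_density c A (\<phi> x) (\<phi>' x))"
      unfolding energy_density_def by (intro continuous_intros cont) auto
    show "periodic L (\<lambda>x. energy_density c A (\<phi> x) (\<phi>' x))"
      using per per' by (simp add: periodic_def)
  qed
  also have "\<dots> = energy_G \<phi>"
    using energy_density_integral[OF L h1_phi[of 0]] by (simp add: energy_G_def)
  finally show ?thesis .
qed

lemma energy_F_phi: "h1_sq L (\<lambda>x. \<phi> (x + y)) (\<lambda>x. \<phi>' (x + y)) = 2 * energy_F L \<phi>"
proof -
  have "h1_sq L (\<lambda>x. \<phi> (x + y)) (\<lambda>x. \<phi>' (x + y)) = pint L (\<lambda>x. (\<phi> x)\<^sup>2 + (\<phi>' x)\<^sup>2)"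
    unfolding h1_sq_def
    by (rule pint_shift[OF L]) (use per per' in \<open>auto intro!: continuous_intros cont simp: periodic_def\<close>)
  then show ?thesis using energy_F_eq[OF L h1_phi[of 0]] by (simp add: h1_sq_def)
qed

lemma mass_V_phi: "pint L (\<lambda>x. \<phi> (x + y)) = mass_V L \<phi>"
  unfolding mass_V_eq by (rule pint_shift[OF L cont(1) per])

context
  fixes u g h k :: "real \<Rightarrow> real" and y :: real
  assumes u: "h1 L u g"
    and hk: "h = (\<lambda>x. u x - \<phi> (x + y))" "k = (\<lambda>x. g x - \<phi>' (x + y))"
begin

lemma h1_hk: "h1 L h k" unfolding hk by (rule h1_diff[OF u h1_phi])

lemma energy_G_expand: "energy_G u = energy_G \<phi> + quad y h k / 2 - higher y h k"
proof -
  define Ed where "Ed = (\<lambda>x. energy_density c A (\<phi> (x + y)) (\<phi>' (x + y)))"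
  define q where "q = (\<lambda>x. (c - \<phi> (x + y)) * (k x)\<^sup>2 - 2 * (\<phi>' (x + y) * (h x * k x)) + (c - 3 * (\<phi> (x + y))\<^sup>2) * (h x)\<^sup>2)"
  define t where "t = (\<lambda>x. \<phi> (x + y) * (h x * (h x)\<^sup>2) + (h x)\<^sup>2 * (h x)\<^sup>2 / 4 + h x * (k x)\<^sup>2 / 2)"
  define l where "l = (\<lambda>x. ((\<phi>' (x + y))\<^sup>2 + (\<phi> (x + y) - c) * \<phi>'' (x + y)) * h x + (\<phi> (x + y) - c) * \<phi>' (x + y) * k x)"
  have "energy_G u = pint L (\<lambda>x. energy_density c A (u x) (g x))"
    unfolding energy_G_def by (rule energy_density_integral[OF L u])
  also have "\<dots> = pint L (\<lambda>x. Ed x + q x / 2 - t x - l x)"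
  proof (rule Bochner_Integration.integral_cong[OF refl])
    fix x
    have "u x = \<phi> (x + y) + h x" "g x = \<phi>' (x + y) + k x" by (auto simp: hk)
    then show "energy_density c A (u x) (g x) = Ed x + q x / 2 - t x - l x"
      using energy_density_expand[OF ode[of "x + y"], of "h x" "k x"] by (simp add: Ed_def q_def t_def l_def)
  qed
  also have "\<dots> = pint L Ed + pint L q / 2 - pint L t - pint L l"
  proof -
    have "pintegrable L Ed"
      unfolding Ed_def energy_density_def
      by (intro continuous_integrable_per_measure continuous_intros cont_shift) auto
    moreover have "pintegrable L q"
      unfolding q_def by (intro Bochner_Integration.integrable_add Bochner_Integration.integrable_diff
          Bochner_Integration.integrable_mult_right int_quad[OF h1_hk])
    moreover have "pintegrable L t"
      unfolding t_def by (intro Bochner_Integration.integrable_add Bochner_Integration.integrable_divide int_higher[OF h1_hk])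
    moreover have "pintegrable L l"
      unfolding l_def by (intro Bochner_Integration.integrable_add integrable_continuous_mult continuous_intros cont_shift int_hk[OF h1_hk])
    ultimately show ?thesis by simp
  qed
  also have "pint L l = 0" unfolding l_def by (rule linear_part_zero[OF h1_hk])
  also have "pint L Ed = energy_G \<phi>" unfolding Ed_def by (rule energy_G_phi)
  finally show ?thesis by (simp add: quad_def higher_def q_def t_def)
qed

lemma energy_F_expand: "energy_F L u = energy_F L \<phi> + lin_F y h k + h1_sq L h k / 2"
proof -
  have i: "pintegrable L (\<lambda>x. h x * \<phi> (x + y) + k x * \<phi>' (x + y))"
    by (intro Bochner_Integration.integrable_add;
        rule sq_int_mult_continuous[OF sq(1)[OF h1_hk]] sq_int_mult_continuous[OF sq(2)[OF h1_hk]]; rule cont_shift)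
  have j: "pintegrable L (\<lambda>x. (\<phi> (x + y))\<^sup>2 + (\<phi>' (x + y))\<^sup>2)"
    by (intro continuous_integrable_per_measure continuous_intros cont_shift)
  define P l n where "P = (\<lambda>x. (\<phi> (x + y))\<^sup>2 + (\<phi>' (x + y))\<^sup>2)"
    and "l = (\<lambda>x. h x * \<phi> (x + y) + k x * \<phi>' (x + y))" and "n = (\<lambda>x. (h x)\<^sup>2 + (k x)\<^sup>2)"
  have "h1_sq L u g = pint L (\<lambda>x. P x + 2 * l x + n x)"
    unfolding h1_sq_def P_def l_def n_def
    by (rule Bochner_Integration.integral_cong) (auto simp: hk power2_eq_square algebra_simps)
  also have "\<dots> = pint L P + 2 * pint L l + pint L n"
    using i j int_sq[OF h1_hk] unfolding P_def[symmetric] l_def[symmetric] n_def[symmetric] by simp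
  also have "\<dots> = 2 * energy_F L \<phi> + 2 * lin_F y h k + h1_sq L h k"
    unfolding energy_F_phi[of y, symmetric] lin_F_def h1_sq_def P_def l_def n_def ..
  finally show ?thesis by (simp add: energy_F_eq[OF L u])
qed

lemma mass_V_expand: "mass_V L u = mass_V L \<phi> + pint L h"
proof -
  have "pintegrable L u" "pintegrable L (\<lambda>x. \<phi> (x + y))"
    using sq(1)[OF u] sq_int_integrable by (auto intro!: continuous_integrable_per_measure cont_shift)
  then have "pint L h = pint L u - pint L (\<lambda>x. \<phi> (x + y))" unfolding hk by simp
  then show ?thesis by (simp add: mass_V_phi mass_V_eq)
qed

end

text \<open>The sum of the constants for the three functionals, so that one number bounds all
  deviations. Bounds linear in \<open>s\<close> suffice, because \<open>s \<le> 1\<close>.\<close>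

definition "dev_const = (D + D * (kap L)\<^sup>2 + 2 * \<eta>) / 2 + higher_const + sqrt L + (sup_phi + \<eta>) * sqrt L + 1"

lemma dev_const_pos: "0 < dev_const"
proof -
  have "0 \<le> sup_phi" using phi_bound[of 0] by linarith
  then have "0 \<le> (sup_phi + \<eta>) * sqrt L" "0 \<le> D * (kap L)\<^sup>2" using eta_nonneg L D by auto
  then show ?thesis
    using D eta_nonneg higher_const_nonneg L by (simp add: dev_const_def add_nonneg_pos)
qed

lemma functional_deviation:
  assumes u: "h1 L u g"
  defines "s \<equiv> sqrt (dist_sq u g 0)"
  assumes s1: "s \<le> 1"
  shows "\<bar>energy_G u - energy_G \<phi>\<bar> \<le> dev_const * s" "\<bar>energy_F L u - energy_F L \<phi>\<bar> \<le> dev_const * s"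
    "\<bar>mass_V L u - mass_V L \<phi>\<bar> \<le> dev_const * s"
proof -
  define h k N where "h = (\<lambda>x. u x - \<phi> (x + 0))" and "k = (\<lambda>x. g x - \<phi>' (x + 0))" and "N = h1_sq L h k"
  have hk: "h1 L h k" unfolding h_def k_def by (rule h1_diff[OF u h1_phi])
  have s: "s = sqrt N" by (simp add: s_def N_def h_def k_def)
  have N: "0 \<le> N" "N \<le> 1" "N = s * s" "0 \<le> s"
    using s1 h1_sq_nonneg[of L h k] by (auto simp: s N_def)
  have Ns: "N \<le> s" using N s1 mult_left_le[of s s] by simp
  have B: "0 \<le> sup_phi" using phi_bound[of 0] by linarith
  define c1 c2 c3 where "c1 = D + D * (kap L)\<^sup>2 + 2 * \<eta>" and "c2 = sqrt L" and "c3 = (sup_phi + \<eta>) * sqrt L"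
  have c: "0 \<le> c1" "0 \<le> c2" "0 \<le> c3" using D eta_nonneg L B by (auto simp: c1_def c2_def c3_def)
  have K: "dev_const * s = c1 / 2 * s + higher_const * s + c2 * s + c3 * s + s"
    by (simp add: dev_const_def c1_def c2_def c3_def algebra_simps)
  have pos: "0 \<le> c1 * s" "0 \<le> higher_const * s" "0 \<le> c2 * s" "0 \<le> c3 * s"
    using c N higher_const_nonneg by auto
  have "\<bar>quad 0 h k\<bar> \<le> c1 * N" using quad_bound[OF hk, of 0] by (simp add: c1_def N_def)
  also have "\<dots> \<le> c1 * s" by (rule mult_left_mono[OF Ns c(1)])
  finally have 1: "\<bar>quad 0 h k\<bar> \<le> c1 * s" .
  have "\<bar>higher 0 h k\<bar> \<le> higher_const * (s * N)"
    using higher_bound[OF hk, of 0] N by (simp add: N_def s)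
  also have "\<dots> \<le> higher_const * s" using N higher_const_nonneg by (intro mult_left_mono mult_left_le) auto
  finally have 2: "\<bar>higher 0 h k\<bar> \<le> higher_const * s" .
  show "\<bar>energy_G u - energy_G \<phi>\<bar> \<le> dev_const * s"
    using energy_G_expand[OF u h_def k_def] 1 2 pos N unfolding K by linarith
  have "\<bar>lin_F 0 h k\<bar> \<le> c3 * s" using lin_F_bound[OF hk, of 0] by (simp add: c3_def s N_def)
  then show "\<bar>energy_F L u - energy_F L \<phi>\<bar> \<le> dev_const * s"
    using energy_F_expand[OF u h_def k_def] pos N Ns unfolding K N_def[symmetric] by linarith
  have "\<bar>pint L (\<lambda>x. h x * 1)\<bar> \<le> 1 * (sqrt L * sqrt (h1_sq L h k))"
    by (rule h1_pint_bounded_mult_le[OF L hk]) (auto intro: continuous_intros)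
  then have "\<bar>pint L h\<bar> \<le> c2 * s" by (simp add: c2_def s N_def)
  then show "\<bar>mass_V L u - mass_V L \<phi>\<bar> \<le> dev_const * s"
    using mass_V_expand[OF u h_def k_def] pos N unfolding K by linarith
qed

text \<open>Below \<open>lya_radius\<close> the higher-order terms are absorbed by half of the spectral gap.\<close>

definition "lya_radius = min 1 (gap / (4 * (higher_const + coer_const + 1)))"

definition "lya_const = 2 * (2 * dev_const + 3 * coer_const * dev_const\<^sup>2) / gap"

lemma lya_radius: "lya_radius > 0" "lya_radius \<le> 1"
  "2 * higher_const * lya_radius + coer_const / 2 * lya_radius \<le> gap / 2"
proof -
  show q: "lya_radius > 0" "lya_radius \<le> 1"
    using gap_pos higher_const_nonneg coer_const_nonneg by (auto simp: lya_radius_def)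
  have "lya_radius \<le> gap / (4 * (higher_const + coer_const + 1))" by (simp add: lya_radius_def)
  then have "lya_radius * (4 * (higher_const + coer_const + 1)) \<le> gap"
    using higher_const_nonneg coer_const_nonneg by (subst (asm) pos_le_divide_eq) auto
  moreover have "0 \<le> lya_radius * coer_const" "0 \<le> lya_radius * higher_const"
    using q higher_const_nonneg coer_const_nonneg by auto
  ultimately show "2 * higher_const * lya_radius + coer_const / 2 * lya_radius \<le> gap / 2"
    using q by (simp add: algebra_simps)
qed

lemma lya_const_pos: "lya_const > 0"
  using gap_pos coer_const_nonneg dev_const_pos by (simp add: lya_const_def add_pos_nonneg)

text \<open>Apart from the sine condition and the a priori smallness, \<open>u\<close> enters only
  through conserved values. Since \<open>lin_F\<close> is the deviation of \<open>F\<close> minus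
  \<open>N / 2\<close>, its square contains a multiple of \<open>N^2\<close>; this accounts for the
  summand \<open>coer_const / 2 * lya_radius\<close> in \<open>lya_radius\<close>.\<close>

lemma lyapunov:
  assumes u: "h1 L u g" and s: "0 \<le> s" "s \<le> 1"
    and G: "\<bar>energy_G u - energy_G \<phi>\<bar> \<le> dev_const * s"
    and F: "\<bar>energy_F L u - energy_F L \<phi>\<bar> \<le> dev_const * s"
    and V: "\<bar>mass_V L u - mass_V L \<phi>\<bar> \<le> dev_const * s"
    and ms: "sin_mode u y = 0" and q: "sqrt (dist_sq u g y) \<le> lya_radius"
  shows "dist_sq u g y \<le> lya_const * s"
proof -
  define T M K where "T = higher_const" and "M = coer_const" and "K = dev_const"
  have nn: "0 \<le> T" "0 \<le> M" "0 < K"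
    using higher_const_nonneg coer_const_nonneg dev_const_pos by (auto simp: T_def M_def K_def)
  define q1 where "q1 = lya_radius"
  have q1: "q1 > 0" "q1 \<le> 1" "2 * T * q1 + M / 2 * q1 \<le> gap / 2"
    using lya_radius unfolding q1_def T_def M_def by auto
  define h k N where "h = (\<lambda>x. u x - \<phi> (x + y))" and "k = (\<lambda>x. g x - \<phi>' (x + y))" and "N = h1_sq L h k"
  have hk: "h1 L h k" unfolding h_def k_def by (rule h1_diff[OF u h1_phi])
  have sN: "0 \<le> N" "sqrt N \<le> q1" using q unfolding q1_def by (auto simp: N_def h_def k_def h1_sq_nonneg)
  then have N1: "N \<le> 1" "N \<le> q1"
  proof -
    have "sqrt N \<le> 1" using sN q1 by linarith
    then show "N \<le> 1" using sN by simp
    have "N = sqrt N * sqrt N" using sN by simp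
    also have "\<dots> \<le> sqrt N * 1" using \<open>sqrt N \<le> 1\<close> sN by (intro mult_left_mono) auto
    finally show "N \<le> q1" using sN by simp
  qed
  have "\<bar>higher y h k\<bar> \<le> T * (sqrt N * N)"
    using higher_bound[OF hk, of y] N1 by (simp add: N_def T_def)
  also have "\<dots> \<le> T * (q1 * N)" using sN nn by (intro mult_left_mono mult_right_mono) auto
  finally have 1: "\<bar>higher y h k\<bar> \<le> T * q1 * N" by (simp add: mult.assoc)
  have coer: "gap * N \<le> quad y h k + M * ((pint L h)\<^sup>2 + (lin_F y h k)\<^sup>2)"
    using quad_coercive[OF hk, of y] ms by (simp add: h_def N_def M_def)
  have quad: "quad y h k \<le> 2 * (K * s) + 2 * (T * q1 * N)"
    using energy_G_expand[OF u h_def k_def] G 1 unfolding K_def by linarith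
  have "\<bar>pint L h\<bar> \<le> K * s" using mass_V_expand[OF u h_def k_def] V by (simp add: K_def)
  then have V2: "(pint L h)\<^sup>2 \<le> K\<^sup>2 * s"
  proof -
    have "(pint L h)\<^sup>2 \<le> (K * s)\<^sup>2" using \<open>\<bar>pint L h\<bar> \<le> K * s\<close> power_mono[of "\<bar>pint L h\<bar>" "K * s" 2] by simp
    also have "\<dots> = K\<^sup>2 * (s * s)" by (simp add: power2_eq_square)
    also have "\<dots> \<le> K\<^sup>2 * s" using s by (intro mult_left_mono mult_left_le) auto
    finally show ?thesis .
  qed
  have F2: "(lin_F y h k)\<^sup>2 \<le> 2 * (K\<^sup>2 * s) + q1 / 2 * N"
  proof -
    have "\<bar>lin_F y h k\<bar> \<le> K * s + N / 2"
      using energy_F_expand[OF u h_def k_def] F sN unfolding K_def N_def[symmetric] by linarith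
    then have "(lin_F y h k)\<^sup>2 \<le> (K * s + N / 2)\<^sup>2"
      using power_mono[of "\<bar>lin_F y h k\<bar>" "K * s + N / 2" 2] by simp
    also have "\<dots> \<le> 2 * (K * s)\<^sup>2 + 2 * (N / 2)\<^sup>2"
      using sum_squares_bound[of "K * s" "N / 2"] by (simp add: power2_sum)
    also have "\<dots> = 2 * (K\<^sup>2 * (s * s)) + N * N / 2" by (simp add: power2_eq_square)
    also have "\<dots> \<le> 2 * (K\<^sup>2 * s) + q1 * N / 2"
      using s N1 sN by (intro add_mono mult_left_mono divide_right_mono mult_right_mono mult_left_le) auto
    finally show ?thesis by simp
  qed
  have "gap * N \<le> 2 * (K * s) + 2 * (T * q1 * N) + M * (K\<^sup>2 * s + (2 * (K\<^sup>2 * s) + q1 / 2 * N))"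
    using coer quad mult_left_mono[OF add_mono[OF V2 F2] nn(2)] by linarith
  also have "\<dots> = (2 * K + 3 * M * K\<^sup>2) * s + (2 * T * q1 + M / 2 * q1) * N"
    by (simp add: algebra_simps)
  also have "\<dots> \<le> (2 * K + 3 * M * K\<^sup>2) * s + gap / 2 * N"
    using q1(3) sN by (intro add_left_mono mult_right_mono) auto
  finally have "gap / 2 * N \<le> (2 * K + 3 * M * K\<^sup>2) * s" by linarith
  then have "N \<le> lya_const * s" using gap_pos by (simp add: lya_const_def K_def M_def field_simps)
  then show ?thesis by (simp add: N_def h_def k_def)
qed

end

section \<open>Modulation by the first Fourier mode\<close>

lemma pint_cos: "L > 0 \<Longrightarrow> pint L (\<lambda>x. cos (kap L * x)) = 0"
  and pint_cos_sq: "L > 0 \<Longrightarrow> pint L (\<lambda>x. cos (kap L * x) * cos (kap L * x)) = L / 2"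
proof -
  assume L: "L > 0"
  have c: "cos (kap L * x) = (cas L 1 x + cas L (-1) x) / 2" for x by (simp add: cas_def)
  show "pint L (\<lambda>x. cos (kap L * x)) = 0"
    unfolding c using L by (simp add: integrable_cas pint_cas)
  have i: "pintegrable L (\<lambda>x. cas L m x * cas L n x)" for m n
    by (intro sq_int_mult sq_int_cas[OF L])
  have "pint L (\<lambda>x. cos (kap L * x) * cos (kap L * x))
    = pint L (\<lambda>x. (cas L 1 x * cas L 1 x + 2 * (cas L 1 x * cas L (-1) x) + cas L (-1) x * cas L (-1) x) / 4)"
    unfolding c by (intro Bochner_Integration.integral_cong) (auto simp: field_simps)
  also have "\<dots> = L / 2" using i by (simp add: pint_cas_mult[OF L])
  finally show "pint L (\<lambda>x. cos (kap L * x) * cos (kap L * x)) = L / 2" .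
qed

context stable_wave
begin

text \<open>Without this the first mode has no phase. The leading part of the integral is
  \<open>\<beta> * L / 2\<close>, and the remainder is smaller because
  \<open>\<zeta> < 1 / 2\<close>.\<close>

lemma phi_cos_nonzero: "pint L (\<lambda>x. \<phi> x * cos (kap L * x)) \<noteq> 0"
proof -
  define e where "e = pint L (\<lambda>x. r x * cos (kap L * x))"
  have i: "pintegrable L (\<lambda>x. cos (kap L * x))" "pintegrable L (\<lambda>x. cos (kap L * x) * cos (kap L * x))"
    "pintegrable L (\<lambda>x. r x * cos (kap L * x))"
    by (intro continuous_integrable_per_measure continuous_intros cont_r)+
  have "pint L (\<lambda>x. \<phi> x * cos (kap L * x))
    = pint L (\<lambda>x. m * cos (kap L * x) + \<beta> * (cos (kap L * x) * cos (kap L * x)) + \<beta> * (r x * cos (kap L * x)))"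
    unfolding dec by (intro Bochner_Integration.integral_cong) (auto simp: algebra_simps)
  also have "\<dots> = \<beta> * (L / 2 + e)"
    using i by (simp add: pint_cos[OF L] pint_cos_sq[OF L] e_def distrib_left)
  finally have 1: "pint L (\<lambda>x. \<phi> x * cos (kap L * x)) = \<beta> * (L / 2 + e)" .
  have "\<bar>e\<bar> \<le> pint L (\<lambda>x. \<zeta>)"
    unfolding e_def
  proof (rule abs_integral_le)
    show "AE x in per_measure L. \<bar>r x * cos (kap L * x)\<bar> \<le> \<zeta>"
    proof (rule AE_I2)
      fix x
      have "\<bar>r x\<bar> * \<bar>cos (kap L * x)\<bar> \<le> \<zeta> * 1" using r(1)[of x] by (intro mult_mono) (auto simp: zeta_nonneg)
      then show "\<bar>r x * cos (kap L * x)\<bar> \<le> \<zeta>" by (simp add: abs_mult)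
    qed
  qed (use i in auto)
  also have "\<dots> = \<zeta> * L" using L by (simp add: measure_per_measure)
  also have "\<dots> < 1 / 2 * L" using small(2) L by (intro mult_strict_right_mono) auto
  finally show ?thesis unfolding 1 using \<beta> by auto
qed

lemma phi_sin_zero: "pint L (\<lambda>x. \<phi> (x + y) * sin (kap L * (x + y))) = 0"
proof -
  have s: "continuous_on UNIV (\<lambda>x. \<phi> x * sin (kap L * x))" by (intro continuous_intros cont)
  have p: "periodic L (\<lambda>x. \<phi> x * sin (kap L * x))"
    using per sin_shift_smooth(2)[of 0] by (simp add: periodic_def)
  have "pint L (\<lambda>x. \<phi> (x + y) * sin (kap L * (x + y))) = pint L (\<lambda>x. \<phi> x * sin (kap L * x))"
    by (rule pint_shift[OF L s p])
  also have "\<dots> = 0" by (rule pint_odd[OF L s p]) (simp add: even)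
  finally show ?thesis .
qed

lemma phi_cos_shift: "pint L (\<lambda>x. \<phi> (x + y) * cos (kap L * (x + y))) = pint L (\<lambda>x. \<phi> x * cos (kap L * x))"
proof (rule pint_shift[OF L])
  have "cos (kap L * (x + L)) = cos (kap L * x)" for x
    using kap_L[OF L] by (simp add: distrib_left)
  then show "periodic L (\<lambda>x. \<phi> x * cos (kap L * x))" using per by (simp add: periodic_def)
qed (intro continuous_intros cont)

lemma eta_le: "\<eta> \<le> D / 8"
proof -
  have "D * min (1/2) ((kap L)\<^sup>2) \<le> D * (1/2)" using D by (intro mult_left_mono) auto
  moreover have "0 \<le> 18 * D * (kap L)\<^sup>2 * \<zeta>\<^sup>2" using D by simp
  ultimately show ?thesis using small(1) by linarith
qed

definition "sup_phi'' = (\<bar>A\<bar> + sup_phi^3 + \<bar>c\<bar> * sup_phi + \<eta>\<^sup>2) / (D - \<eta>)"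

text \<open>The profile equation is solved for \<open>\<phi>''\<close>, dividing by
  \<open>\<phi> - c\<close>, whose modulus is at least \<open>D - \<eta> > 0\<close>. The bound
  makes translation of the wave Lipschitz in the \<open>H1\<close> norm.\<close>

lemma phi''_bound: "\<bar>\<phi>'' x\<bar> \<le> sup_phi''"
proof -
  have D': "0 < D - \<eta>" using eta_le D by linarith
  have "D - \<eta> \<le> \<bar>\<phi> x - c\<bar>" using b1[of x] by linarith
  then have "(D - \<eta>) * \<bar>\<phi>'' x\<bar> \<le> \<bar>\<phi> x - c\<bar> * \<bar>\<phi>'' x\<bar>" by (intro mult_right_mono) auto
  also have "\<dots> = \<bar>(\<phi> x - c) * \<phi>'' x\<bar>" by (simp add: abs_mult)
  also have "(\<phi> x - c) * \<phi>'' x = A + (\<phi> x)^3 - c * \<phi> x - (\<phi>' x)\<^sup>2 / 2" using ode[of x] by linarith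
  also have "\<bar>A + (\<phi> x)^3 - c * \<phi> x - (\<phi>' x)\<^sup>2 / 2\<bar> \<le> \<bar>A\<bar> + sup_phi^3 + \<bar>c\<bar> * sup_phi + \<eta>\<^sup>2"
  proof -
    have "\<bar>(\<phi> x)^3\<bar> \<le> sup_phi^3" unfolding power_abs using phi_bound[of x] by (intro power_mono) auto
    moreover have "\<bar>c * \<phi> x\<bar> \<le> \<bar>c\<bar> * sup_phi" unfolding abs_mult using phi_bound[of x] by (intro mult_left_mono) auto
    moreover have "(\<phi>' x)\<^sup>2 \<le> \<eta>\<^sup>2" using b2[of x] eta_nonneg by (simp add: abs_le_square_iff[symmetric])
    moreover have "0 \<le> (\<phi>' x)\<^sup>2" by simp
    ultimately show ?thesis by linarith
  qed
  finally show ?thesis using D' by (simp add: sup_phi''_def field_simps)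
qed

definition "shift_const = sqrt (L * (\<eta>\<^sup>2 + sup_phi''\<^sup>2))"

lemma Lipschitz_DERIV:
  fixes f f' :: "real \<Rightarrow> real"
  assumes "\<And>x. (f has_real_derivative f' x) (at x)" "\<And>x. \<bar>f' x\<bar> \<le> B"
  shows "(f x - f y)\<^sup>2 \<le> B\<^sup>2 * (x - y)\<^sup>2"
proof -
  have "norm (f x - f y) \<le> B * norm (x - y)"
    by (rule field_differentiable_bound[of UNIV f f']) (use assms in auto)
  then have "\<bar>f x - f y\<bar>\<^sup>2 \<le> (B * \<bar>x - y\<bar>)\<^sup>2" by (intro power_mono) auto
  then show ?thesis by (simp add: power_mult_distrib)
qed

lemma shift_distance:
  "sqrt (h1_sq L (\<lambda>x. \<phi> (x + y) - \<phi> (x + z)) (\<lambda>x. \<phi>' (x + y) - \<phi>' (x + z))) \<le> shift_const * \<bar>y - z\<bar>"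
proof -
  have "h1_sq L (\<lambda>x. \<phi> (x + y) - \<phi> (x + z)) (\<lambda>x. \<phi>' (x + y) - \<phi>' (x + z)) \<le> pint L (\<lambda>x. (\<eta>\<^sup>2 + sup_phi''\<^sup>2) * (y - z)\<^sup>2)"
    unfolding h1_sq_def
  proof (rule integral_mono)
    show "pintegrable L (\<lambda>x. (\<phi> (x + y) - \<phi> (x + z))\<^sup>2 + (\<phi>' (x + y) - \<phi>' (x + z))\<^sup>2)"
      by (intro continuous_integrable_per_measure continuous_intros cont_shift)
    fix x
    show "(\<phi> (x + y) - \<phi> (x + z))\<^sup>2 + (\<phi>' (x + y) - \<phi>' (x + z))\<^sup>2 \<le> (\<eta>\<^sup>2 + sup_phi''\<^sup>2) * (y - z)\<^sup>2"
      using Lipschitz_DERIV[OF d1 b2, of "x + y" "x + z"] Lipschitz_DERIV[OF d2 phi''_bound, of "x + y" "x + z"]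
      by (simp add: distrib_right)
  qed simp
  also have "\<dots> = L * (\<eta>\<^sup>2 + sup_phi''\<^sup>2) * (y - z)\<^sup>2" using L by (simp add: measure_per_measure)
  finally show ?thesis
    unfolding shift_const_def using real_sqrt_le_mono by (fastforce simp: real_sqrt_mult)
qed

text \<open>The phase of the first Fourier mode of \<open>u\<close> selects the translate.\<close>

definition "cos_mode = \<bar>pint L (\<lambda>x. \<phi> x * cos (kap L * x))\<bar>"

text \<open>A perturbation of this size leaves at least half of the first cosine
  coefficient.\<close>

definition "mod_radius = cos_mode / (2 * sqrt L)"

definition "mod_const = 1 + shift_const * (2 * sqrt L / (cos_mode * kap L))"

lemma mod_const_pos: "cos_mode > 0" "mod_radius > 0" "mod_const > 0"
proof -
  show 1: "cos_mode > 0" using phi_cos_nonzero by (simp add: cos_mode_def)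
  then show "mod_radius > 0" using L by (simp add: mod_radius_def)
  have "0 \<le> shift_const" using L by (simp add: shift_const_def)
  then show "mod_const > 0" using 1 L kap by (simp add: mod_const_def add_pos_nonneg)
qed

text \<open>Explicit instead of an implicit function argument: translation rotates the first-mode
  coefficients of \<open>u\<close>, and the rotation by \<open>arctan (S / P)\<close> makes the sine
  coefficient vanish. As \<open>P\<close> stays away from \<open>0\<close> and \<open>S\<close> is
  of order \<open>d\<close>, the translate moves by a distance of order \<open>d\<close>.\<close>

lemma modulation:
  assumes u: "h1 L u g" and d_le: "sqrt (dist_sq u g z) \<le> mod_radius"
  obtains y where "sin_mode u y = 0" "sqrt (dist_sq u g y) \<le> mod_const * sqrt (dist_sq u g z)"
proof -
  define P0 where "P0 = pint L (\<lambda>x. \<phi> x * cos (kap L * x))"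
  have P0: "\<bar>P0\<bar> > 0" "cos_mode = \<bar>P0\<bar>" using phi_cos_nonzero by (simp_all add: P0_def cos_mode_def)
  have sc: "0 \<le> shift_const" using L by (simp add: shift_const_def)
  define d where "d = sqrt (dist_sq u g z)"
  have d: "d \<le> mod_radius" "0 \<le> d" using d_le by (simp_all add: d_def h1_sq_nonneg)
  have hz: "h1 L (\<lambda>x. u x - \<phi> (x + z)) (\<lambda>x. g x - \<phi>' (x + z))" by (rule h1_diff[OF u h1_phi])
  define P S where "P = pint L (\<lambda>x. u x * cos (kap L * (x + z)))" and "S = pint L (\<lambda>x. u x * sin (kap L * (x + z)))"
  have iu: "pintegrable L (\<lambda>x. u x * cos (kap L * (x + y)))" "pintegrable L (\<lambda>x. u x * sin (kap L * (x + y)))" for y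
    by (rule sq_int_mult_continuous[OF sq(1)[OF u]]; intro continuous_intros)+
  have ip: "pintegrable L (\<lambda>x. \<phi> (x + y) * cos (kap L * (x + y)))" "pintegrable L (\<lambda>x. \<phi> (x + y) * sin (kap L * (x + y)))" for y
    by (intro continuous_integrable_per_measure continuous_intros cont_shift)+
  have "\<bar>pint L (\<lambda>x. (u x - \<phi> (x + z)) * cos (kap L * (x + z)))\<bar> \<le> 1 * (sqrt L * d)"
    unfolding d_def by (rule h1_pint_bounded_mult_le[OF L hz]) (auto intro!: continuous_intros)
  then have P: "\<bar>P - P0\<bar> \<le> sqrt L * d"
    using iu(1)[of z] ip(1)[of z] by (simp add: left_diff_distrib P_def P0_def phi_cos_shift)
  have "\<bar>pint L (\<lambda>x. (u x - \<phi> (x + z)) * sin (kap L * (x + z)))\<bar> \<le> 1 * (sqrt L * d)"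
    unfolding d_def by (rule h1_pint_bounded_mult_le[OF L hz]) (auto intro!: continuous_intros)
  then have S: "\<bar>S\<bar> \<le> sqrt L * d"
    using iu(2)[of z] ip(2)[of z] by (simp add: left_diff_distrib S_def phi_sin_zero)
  have "sqrt L * d \<le> sqrt L * mod_radius" using d L by (intro mult_left_mono) auto
  also have "\<dots> = \<bar>P0\<bar> / 2" using L by (simp add: mod_radius_def P0(2))
  finally have PP: "\<bar>P\<bar> \<ge> \<bar>P0\<bar> / 2" using P by linarith
  then have Pnz: "P \<noteq> 0" using P0(1) by auto
  define \<theta> where "\<theta> = arctan (S / P)"
  define y where "y = z - \<theta> / kap L"
  have "\<bar>\<theta>\<bar> \<le> \<bar>S / P\<bar>"
  proof -
    have "\<bar>arctan v\<bar> \<le> \<bar>v\<bar>" for v :: real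
    proof (cases "v \<ge> 0")
      case True
      then show ?thesis using arctan_le_self[of v] by simp
    next
      case False
      then show ?thesis using arctan_le_self[of "- v"] by (simp add: arctan_minus)
    qed
    then show ?thesis unfolding \<theta>_def .
  qed
  also have "\<dots> \<le> (sqrt L * d) / (\<bar>P0\<bar> / 2)"
    unfolding abs_divide using S PP P0(1) L d by (intro frac_le) auto
  finally have th: "\<bar>\<theta>\<bar> \<le> 2 * sqrt L / \<bar>P0\<bar> * d" by (simp add: field_simps)
  have yz: "\<bar>y - z\<bar> \<le> 2 * sqrt L / (\<bar>P0\<bar> * kap L) * d"
  proof -
    have "\<bar>y - z\<bar> = \<bar>\<theta>\<bar> / kap L" using kap by (simp add: y_def)
    also have "\<dots> \<le> (2 * sqrt L / \<bar>P0\<bar> * d) / kap L" using th kap by (intro divide_right_mono) auto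
    finally show ?thesis by (simp add: mult.commute)
  qed
  have "pint L (\<lambda>x. u x * sin (kap L * (x + y))) = 0"
  proof -
    have e: "kap L * (x + y) = kap L * (x + z) - \<theta>" for x using kap by (simp add: y_def field_simps)
    have "u x * sin (kap L * (x + y)) = cos \<theta> * (u x * sin (kap L * (x + z))) - sin \<theta> * (u x * cos (kap L * (x + z)))" for x
      unfolding e sin_diff by (simp add: right_diff_distrib mult_ac)
    then have "pint L (\<lambda>x. u x * sin (kap L * (x + y)))
      = pint L (\<lambda>x. cos \<theta> * (u x * sin (kap L * (x + z))) - sin \<theta> * (u x * cos (kap L * (x + z))))"
      by (simp only:)
    also have "\<dots> = cos \<theta> * S - sin \<theta> * P" using iu[of z] by (simp add: S_def P_def)
    also have "\<dots> = 0"
    proof -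
      have "tan \<theta> = S / P" unfolding \<theta>_def by (rule tan_arctan)
      moreover have "cos \<theta> \<noteq> 0" by (simp add: \<theta>_def)
      ultimately show ?thesis using Pnz by (simp add: tan_def field_simps)
    qed
    finally show ?thesis .
  qed
  then have 1: "pint L (\<lambda>x. (u x - \<phi> (x + y)) * sin (kap L * (x + y))) = 0"
    using iu(2)[of y] ip(2)[of y] by (simp add: left_diff_distrib phi_sin_zero)
  have "sqrt (h1_sq L (\<lambda>x. (u x - \<phi> (x + z)) - (\<phi> (x + y) - \<phi> (x + z))) (\<lambda>x. (g x - \<phi>' (x + z)) - (\<phi>' (x + y) - \<phi>' (x + z))))
     \<le> d + sqrt (h1_sq L (\<lambda>x. \<phi> (x + y) - \<phi> (x + z)) (\<lambda>x. \<phi>' (x + y) - \<phi>' (x + z)))"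
    unfolding d_def by (rule h1_sq_triangle[OF L hz h1_diff[OF h1_phi h1_phi]])
  then have "sqrt (dist_sq u g y) \<le> d + shift_const * \<bar>y - z\<bar>"
    using shift_distance[of y z] by simp
  also have "\<dots> \<le> mod_const * d"
    using mult_left_mono[OF yz sc] by (simp add: mod_const_def P0(2) algebra_simps)
  finally have "sqrt (dist_sq u g y) \<le> mod_const * sqrt (dist_sq u g z)" by (simp only: d_def)
  with 1 show ?thesis by (rule that)
qed

section \<open>Distance to the orbit along a solution\<close>

lemma phi_H1: "(\<lambda>x. \<phi> (x + y)) \<in> H1_per L"
  by (rule h1_imp_H1_per[OF h1_phi])

lemma H1_norm_diff_phi:
  assumes "u \<in> H1_per L"
  shows "H1_norm L (\<lambda>x. u x - \<phi> (x + y)) = sqrt (dist_sq u (weak_deriv L u) y)"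
  by (rule H1_norm_eq[OF L h1_diff[OF h1_weak_deriv[OF assms] h1_phi]])

lemma orbit_dist_le: "orbit_dist L u \<phi> \<le> H1_norm L (\<lambda>x. u x - \<phi> (x + y))"
  unfolding orbit_dist_def by (intro cINF_lower bdd_belowI2[of _ 0] H1_norm_nonneg) auto

lemma orbit_dist_Lipschitz:
  assumes "u \<in> H1_per L" "v \<in> H1_per L"
  shows "orbit_dist L u \<phi> \<le> orbit_dist L v \<phi> + H1_norm L (\<lambda>x. u x - v x)"
proof -
  have "orbit_dist L u \<phi> - H1_norm L (\<lambda>x. u x - v x) \<le> orbit_dist L v \<phi>"
    unfolding orbit_dist_def[of L v]
  proof (rule cINF_greatest)
    fix y
    show "orbit_dist L u \<phi> - H1_norm L (\<lambda>x. u x - v x) \<le> H1_norm L (\<lambda>x. v x - \<phi> (x + y))"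
      using orbit_dist_le[of u y] H1_norm_triangle[OF L assms phi_H1, of y] by linarith
  qed simp
  then show ?thesis by linarith
qed

lemma orbit_dist_continuous:
  assumes "H1_continuous L u"
  shows "continuous_on {0..} (\<lambda>t. orbit_dist L (u t) \<phi>)"
  unfolding continuous_on_def
proof
  fix t :: real assume t: "t \<in> {0..}"
  have H: "u s \<in> H1_per L" if "s \<in> {0..}" for s using assms that by (auto simp: H1_continuous_def)
  have lim: "((\<lambda>s. H1_norm L (\<lambda>x. u s x - u t x)) \<longlongrightarrow> 0) (at t within {0..})"
    using assms t by (auto simp: H1_continuous_def)
  have "((\<lambda>s. orbit_dist L (u s) \<phi> - orbit_dist L (u t) \<phi>) \<longlongrightarrow> 0) (at t within {0..})"
  proof (rule Lim_null_comparison[OF _ lim])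
    have "norm (orbit_dist L (u s) \<phi> - orbit_dist L (u t) \<phi>) \<le> H1_norm L (\<lambda>x. u s x - u t x)" if "s \<in> {0..}" for s
      using orbit_dist_Lipschitz[OF H[OF that] H[OF t]] orbit_dist_Lipschitz[OF H[OF t] H[OF that]]
        H1_norm_commute[OF L H[OF that] H[OF t]] by (simp add: abs_le_iff)
    then show "\<forall>\<^sub>F s in at t within {0..}. norm (orbit_dist L (u s) \<phi> - orbit_dist L (u t) \<phi>) \<le> H1_norm L (\<lambda>x. u s x - u t x)"
      by (auto simp: eventually_at intro!: exI[of _ 1])
  qed
  then show "((\<lambda>s. orbit_dist L (u s) \<phi>) \<longlongrightarrow> orbit_dist L (u t) \<phi>) (at t within {0..})"
    by (simp add: LIM_zero_iff)
qed

theorem stable: "conditionally_orbitally_stable L \<phi>"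
  unfolding conditionally_orbitally_stable_def
proof (intro allI impI)
  fix \<epsilon> :: real assume \<epsilon>: "\<epsilon> > 0"
  \<comment> \<open>Below \<open>\<eta>1\<close> the modulation lemma applies, and the translate
    that it returns lies within \<open>lya_radius\<close>, as modulation costs the factor
    \<open>mod_const\<close>.\<close>
  define \<eta>1 where "\<eta>1 = min mod_radius (lya_radius / mod_const)"
  have \<eta>1: "\<eta>1 > 0" "\<eta>1 \<le> mod_radius" using lya_radius mod_const_pos by (auto simp: \<eta>1_def)
  have \<eta>1': "mod_const * d \<le> lya_radius" if "d < \<eta>1" for d
  proof -
    have "d \<le> lya_radius / mod_const" using that by (simp add: \<eta>1_def)
    then show ?thesis using mod_const_pos(3) by (simp add: pos_le_divide_eq mult.commute)
  qed
  \<comment> \<open>Halving puts \<open>e\<close> strictly below \<open>\<eta>1\<close>, so that a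
    time at which the distance equals \<open>e\<close> is still subject to
    \<open>trap\<close>.\<close>
  define e where "e = min \<epsilon> \<eta>1 / 2"
  have e: "0 < e" "e < \<epsilon>" "e < \<eta>1" using \<epsilon> \<eta>1 by (auto simp: e_def)
  \<comment> \<open>\<open>1\<close> is for the linear deviation bounds, \<open>e\<close> for the
    initial distance, and \<open>e^2 / lya_const\<close> for the conclusion of
    \<open>lyapunov\<close>.\<close>
  define \<delta> where "\<delta> = min (min 1 e) (e\<^sup>2 / lya_const)"
  have \<delta>: "\<delta> > 0" using e lya_const_pos by (simp add: \<delta>_def)
  show "\<exists>\<delta>>0. \<forall>u0\<in>H1_per L. H1_norm L (\<lambda>x. u0 x - \<phi> x) < \<delta> \<longrightarrow>
    (\<forall>u. conservative_global_solution L u0 u \<longrightarrow> (\<forall>t\<ge>0. orbit_dist L (u t) \<phi> < \<epsilon>))"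
  proof (intro exI[of _ \<delta>] conjI \<delta> ballI impI allI)
    fix u0 u and t :: real
    assume u0: "u0 \<in> H1_per L" and close: "H1_norm L (\<lambda>x. u0 x - \<phi> x) < \<delta>"
      and sol: "conservative_global_solution L u0 u" and t: "0 \<le> t"
    define s where "s = H1_norm L (\<lambda>x. u0 x - \<phi> (x + 0))"
    have s: "0 \<le> s" "s \<le> 1" "s < e" "lya_const * s < e\<^sup>2"
      using close lya_const_pos by (auto simp: s_def \<delta>_def H1_norm_nonneg field_simps)
    have s': "s = sqrt (dist_sq u0 (weak_deriv L u0) 0)"
      unfolding s_def by (rule H1_norm_diff_phi[OF u0])
    note dev = functional_deviation[OF h1_weak_deriv[OF u0], folded s', OF s(2)]
    have hc: "H1_continuous L u" using sol by (simp add: conservative_global_solution_def)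
    have H: "u t \<in> H1_per L" if "0 \<le> t" for t using hc that by (simp add: H1_continuous_def)
    have cons: "energy_G (u t) = energy_G u0" "energy_F L (u t) = energy_F L u0" "mass_V L (u t) = mass_V L u0" if "0 \<le> t" for t
      using sol that by (simp_all add: conservative_global_solution_def energy_G_def)
    \<comment> \<open>The distance avoids the values in \<open>[e, \<eta>1)\<close> at all times. A
      translate \<open>z\<close> with distance below \<open>\<eta>1\<close> is enough here;
      modulation then supplies the right one.\<close>
    have trap: "orbit_dist L (u t) \<phi> < e" if t: "0 \<le> t" and small: "orbit_dist L (u t) \<phi> < \<eta>1" for t
    proof -
      have "bdd_below (range (\<lambda>y. H1_norm L (\<lambda>x. u t x - \<phi> (x + y))))"
        by (intro bdd_belowI2[of _ 0] H1_norm_nonneg)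
      then obtain z where "H1_norm L (\<lambda>x. u t x - \<phi> (x + z)) < \<eta>1"
        using small cINF_less_iff[of UNIV "\<lambda>y. H1_norm L (\<lambda>x. u t x - \<phi> (x + y))" \<eta>1]
        unfolding orbit_dist_def by auto
      then have z: "sqrt (dist_sq (u t) (weak_deriv L (u t)) z) < \<eta>1"
        by (simp add: H1_norm_diff_phi[OF H[OF t]])
      obtain y where y: "sin_mode (u t) y = 0" "sqrt (dist_sq (u t) (weak_deriv L (u t)) y)
          \<le> mod_const * sqrt (dist_sq (u t) (weak_deriv L (u t)) z)"
        using modulation[OF h1_weak_deriv[OF H[OF t]]] order_trans[OF less_imp_le[OF z] \<eta>1(2)] by blast
      have "dist_sq (u t) (weak_deriv L (u t)) y \<le> lya_const * s"
      proof (rule lyapunov[OF h1_weak_deriv[OF H[OF t]] s(1,2) _ _ _ y(1)])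
        show "sqrt (dist_sq (u t) (weak_deriv L (u t)) y) \<le> lya_radius"
          using y(2) \<eta>1'[OF z] by linarith
      qed (use dev cons[OF t] in simp_all)
      also have "\<dots> < e\<^sup>2" by (rule s(4))
      finally have "H1_norm L (\<lambda>x. u t x - \<phi> (x + y)) < e"
        using e unfolding H1_norm_diff_phi[OF H[OF t]] by (simp add: real_less_lsqrt h1_sq_nonneg)
      then show ?thesis using orbit_dist_le[of "u t" y] by linarith
    qed
    have start: "orbit_dist L (u 0) \<phi> < e"
    proof -
      have "AE x in per_measure L. u 0 x = u0 x"
        using sol by (auto simp: conservative_global_solution_def AE_per_measure elim: eventually_mono)
      then have "AE x in per_measure L. u 0 x - \<phi> (x + 0) = u0 x - \<phi> (x + 0)" by eventually_elim simp
      then have "H1_norm L (\<lambda>x. u 0 x - \<phi> (x + 0)) = H1_norm L (\<lambda>x. u0 x - \<phi> (x + 0))"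
        unfolding H1_norm_diff_phi[OF H[OF order_refl]] H1_norm_diff_phi[OF u0]
        by (intro arg_cong[where f = sqrt]
            h1_sq_cong[OF L h1_diff[OF h1_weak_deriv[OF H[OF order_refl]] h1_phi] h1_diff[OF h1_weak_deriv[OF u0] h1_phi]])
      then show ?thesis using orbit_dist_le[of "u 0" 0] s(3) by (simp add: s_def)
    qed
    \<comment> \<open>A continuous distance that starts below \<open>e\<close> and fails to stay
      there takes the value \<open>e\<close>, which \<open>trap\<close> excludes.\<close>
    have "orbit_dist L (u t) \<phi> < e"
    proof (rule ccontr)
      assume "\<not> orbit_dist L (u t) \<phi> < e"
      moreover have "continuous_on {0..t} (\<lambda>t. orbit_dist L (u t) \<phi>)"
        by (rule continuous_on_subset[OF orbit_dist_continuous[OF hc]]) auto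
      ultimately obtain \<tau> where "0 \<le> \<tau>" "\<tau> \<le> t" "orbit_dist L (u \<tau>) \<phi> = e"
        using IVT'[of "\<lambda>t. orbit_dist L (u t) \<phi>" 0 e t] start t by auto
      then show False using trap[of \<tau>] e by simp
    qed
    then show "orbit_dist L (u t) \<phi> < \<epsilon>" using e by linarith
  qed
qed

end

section \<open>Waves of small modulus\<close>

lemma periodic_reduce:
  assumes "L > 0" "periodic L f"
  shows "\<exists>x'\<in>{0..L}. f x = f x'"
proof -
  interpret periodic_fun_simple f L
    using assms(2) by unfold_locales (simp add: periodic_def)
  define n where "n = \<lfloor>x / L\<rfloor>"
  have "of_int n \<le> x / L" "x / L < of_int n + 1" unfolding n_def by linarith+
  then have "of_int n * L \<le> x" "x < (of_int n + 1) * L"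
    using assms(1) by (simp_all add: pos_le_divide_eq pos_divide_less_eq)
  then have "x - of_int n * L \<in> {0..L}" by (simp add: algebra_simps)
  moreover have "f x = f (x - of_int n * L)"
    by (rule minus_of_int[symmetric])
  ultimately show ?thesis by blast
qed

text \<open>Uniform continuity on a compact rectangle compares \<open>f (k, x)\<close> with
  \<open>f (0, x) = 0\<close>, and periodicity extends the bound from one period to all
  \<open>x\<close>.\<close>

lemma uniformly_small_near_zero:
  fixes f :: "real \<times> real \<Rightarrow> real"
  assumes L: "L > 0" and T: "open T" "0 \<in> T" and f: "continuous_on (T \<times> UNIV) f"
    and per: "\<And>k. k \<in> T \<Longrightarrow> periodic L (\<lambda>x. f (k, x))" and 0: "\<And>x. f (0, x) = 0" and e: "e > 0"
  shows "\<forall>\<^sub>F k in at_right 0. \<forall>x. \<bar>f (k, x)\<bar> \<le> e"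
proof -
  obtain \<rho> where \<rho>: "\<rho> > 0" "cball 0 \<rho> \<subseteq> T" using T open_contains_cball by blast
  have sub: "cball 0 \<rho> \<times> {0..L} \<subseteq> T \<times> UNIV" using \<rho> by auto
  have "uniformly_continuous_on (cball 0 \<rho> \<times> {0..L}) f"
    by (rule compact_uniformly_continuous[OF continuous_on_subset[OF f sub]]) (intro compact_Times compact_cball compact_Icc)
  then obtain \<delta> where \<delta>: "\<delta> > 0" "\<And>z z'. \<lbrakk>z \<in> cball 0 \<rho> \<times> {0..L}; z' \<in> cball 0 \<rho> \<times> {0..L}; dist z' z < \<delta>\<rbrakk> \<Longrightarrow> dist (f z') (f z) < e"
    using e unfolding uniformly_continuous_on_def by metis
  have small: "\<bar>f (k, x)\<bar> \<le> e" if k: "0 < k" "k < min \<rho> \<delta>" for k x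
  proof -
    have kT: "k \<in> T" using k \<rho> by auto
    obtain x' where x': "x' \<in> {0..L}" "f (k, x) = f (k, x')"
      using periodic_reduce[OF L per[OF kT]] by blast
    have "dist (f (k, x')) (f (0, x')) < e"
      by (rule \<delta>(2)) (use k x' \<rho> in \<open>auto simp: dist_Pair_Pair\<close>)
    then show ?thesis using x' 0 by (simp add: dist_real_def)
  qed
  then show ?thesis
    unfolding eventually_at_right_field using \<rho> \<delta> by (intro exI[of _ "min \<rho> \<delta>"]) auto
qed

text \<open>Written without division by \<open>wave_beta\<close>, which vanishes at
  \<open>k = 0\<close>; thus the remainder is defined and continuous there. The same holds for its
  \<open>x\<close>-derivative \<open>wave_r'\<close>.\<close>

definition wave_r :: "real \<Rightarrow> real \<Rightarrow> real \<Rightarrow> real" where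
  "wave_r L k x = cos (2 * wave_param.wave_am L k x) - cos (kap L * x)"

definition wave_r' :: "real \<Rightarrow> real \<Rightarrow> real \<Rightarrow> real" where
  "wave_r' L k x = kap L * sin (kap L * x)
     - sin (2 * wave_param.wave_am L k x) * (2 * (wave_param.wave_dn L k x * wave_param.lam L k))"

context wave_param
begin

lemma wave_phi_r: "wave_phi L k x = wave_mean + wave_beta * (cos (kap L * x) + wave_r L k x)"
  by (simp add: wave_phi_cos wave_r_def)

lemma wave_phi'_r: "wave_phi' x = wave_beta * (- (kap L * sin (kap L * x)) + wave_r' L k x)"
  by (simp add: wave_phi'_def wave_r'_def)

lemma wave_dn_periodic: "wave_dn (x + L) = wave_dn x"
  using wave_am_periodic[of x] by (simp add: wave_dn_def dn_def wave_am_def)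

lemma periodic_wave_r: "periodic L (wave_r L k)" "periodic L (wave_r' L k)"
proof -
  have "kap L * (x + L) = kap L * x + 2 * pi" for x using kap_L[OF L] by (simp add: distrib_left)
  moreover have "2 * wave_am (x + L) = 2 * wave_am x + 2 * pi" for x by (simp add: wave_am_periodic)
  ultimately show "periodic L (wave_r L k)" "periodic L (wave_r' L k)"
    unfolding periodic_def wave_r_def wave_r'_def wave_dn_periodic by simp_all
qed

lemma periodic_wave_phi': "periodic L wave_phi'"
  by (rule periodic_deriv[OF wave_phi_has_derivative periodic_wave_phi])

end

context
  fixes L :: real
  assumes L: "L > 2 * pi"
begin

lemma L_pos: "L > 0" using L pi_gt_zero by linarith

interpretation k0: wave_param L 0
  by unfold_locales (use L_pos in auto)

lemma wave_am_0: "k0.wave_am x = kap L * x / 2"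
  by (simp add: k0.wave_am_def jacobi_am_0_left ellK_0 kap_def)

lemma wave_r_0: "wave_r L 0 x = 0"
  by (simp add: wave_r_def wave_am_0)

lemma wave_r'_0: "wave_r' L 0 x = 0"
proof -
  have "k0.lam = kap L / 2" by (simp add: k0.lam_def ellK_0 kap_def)
  then show ?thesis by (simp add: wave_r'_def wave_am_0 k0.wave_dn_def dn_def)
qed

lemma wave_beta_0: "k0.wave_beta = 0" by (simp add: k0.wave_beta_def)

text \<open>At \<open>k = 0\<close> one has \<open>R = 9 L^4 - 128 pi^4\<close>, and
  \<open>L > 2 * pi\<close> gives \<open>128 pi^4 < 8 L^4\<close>.\<close>

lemma wave_R_0: "wave_R L 0 > 0"
proof -
  have "(2 * pi)^4 < L^4" using L by (intro power_strict_mono) auto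
  then have "16 * pi^4 < L^4" by (simp add: power_mult_distrib)
  moreover have "0 \<le> pi^4" by simp
  ultimately have "128 * pi^4 < 9 * L^4" by linarith
  then show ?thesis by (simp add: wave_R_def ellK_0 power_divide)
qed

lemma wave_c_0_pos: "wave_c L 0 > 0"
proof -
  have "wave_R L 0 < (3 * L\<^sup>2)\<^sup>2" by (simp add: wave_R_def ellK_0 power_mult_distrib)
  then have "sqrt (wave_R L 0) < 3 * L\<^sup>2" using L_pos by (simp add: real_less_lsqrt wave_R_0 less_imp_le)
  then show ?thesis using L_pos by (simp add: wave_c_def)
qed

lemma wave_c_0: "(wave_c L 0)\<^sup>2 - 3 * wave_c L 0 = - 2 * (kap L)^4"
  using wave_c_relation[OF L_pos less_imp_le[OF wave_R_0]]
  by (simp add: ellK_0 kap_def power_divide power_mult_distrib)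

lemma wave_mean_0: "k0.wave_mean = - (2 * (kap L)\<^sup>2 / 3) - wave_c L 0 / 3"
proof -
  have s: "sqrt (wave_R L 0) = L\<^sup>2 * (3 - 2 * wave_c L 0)" using L_pos by (simp add: wave_c_def field_simps)
  show ?thesis
    unfolding k0.wave_mean_def wave_beta_0 s using L_pos
    by (simp add: ellK_0 kap_def power_divide power_mult_distrib field_simps)
qed

lemma wave_phi_0: "wave_phi L 0 x = k0.wave_mean"
  by (simp add: k0.wave_phi_cos wave_beta_0)

text \<open>The limit of \<open>c - \<phi>\<close>, equal to \<open>(4 c + 2 \<kappa>^2) / 3\<close>
  with \<open>c\<close> taken at \<open>k = 0\<close>; it becomes \<open>D\<close> in
  \<open>stable_wave\<close>.\<close>

definition "gap0 = wave_c L 0 - k0.wave_mean"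

lemma gap0_pos: "gap0 > 0"
  using wave_c_0_pos by (simp add: gap0_def wave_mean_0 add_pos_nonneg)

text \<open>At \<open>k = 0\<close> the first Fourier mode lies in the kernel of the linearisation.\<close>

lemma bifurcation_condition: "wave_c L 0 - 3 * k0.wave_mean\<^sup>2 + gap0 * (kap L)\<^sup>2 = 0"
proof -
  define c q where "c = wave_c L 0" and "q = (kap L)\<^sup>2"
  have "c\<^sup>2 - 3 * c = - 2 * q\<^sup>2" using wave_c_0 by (simp add: c_def q_def flip: power_mult)
  moreover have "c - 3 * (- (2 * q / 3) - c / 3)\<^sup>2 + (c - (- (2 * q / 3) - c / 3)) * q = - (c\<^sup>2 - 3 * c + 2 * q\<^sup>2) / 3"
    by (simp add: power2_eq_square field_simps)
  ultimately show ?thesis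
    unfolding gap0_def wave_mean_0 c_def[symmetric] q_def[symmetric] by (simp only:) simp
qed

lemma wave_R_continuous: "isCont (wave_R L) 0"
proof -
  have "isCont ellK 0"
    unfolding ellK_eq_ellI[abs_def] by (rule DERIV_isCont[OF ellI_has_derivative_k]) simp
  then show ?thesis unfolding wave_R_def[abs_def] by (intro continuous_intros)
qed

lemma wave_family_exists: "\<exists>T. wave_family L T \<and> 0 \<in> T"
proof -
  have "\<forall>\<^sub>F k in nhds 0. wave_R L k > 0"
    using wave_R_continuous wave_R_0 by (simp add: isCont_def order_tendstoD(1) tendsto_at_iff_tendsto_nhds)
  then obtain S where S: "open S" "0 \<in> S" "\<And>k. k \<in> S \<Longrightarrow> wave_R L k > 0"
    by (auto simp: eventually_nhds)
  have "wave_family L (S \<inter> {-1<..<1})"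
    by unfold_locales (use S L_pos in \<open>auto intro: open_Int\<close>)
  then show ?thesis using S by auto
qed

text \<open>Each closeness condition of \<open>stable_wave\<close> says that a function continuous
  in \<open>(k, x)\<close>, periodic in \<open>x\<close> and zero at \<open>k = 0\<close> is
  uniformly small, so all of them hold for small positive \<open>k\<close>. Positivity of
  \<open>k\<close> keeps the amplitude nonzero.\<close>

lemma small_amplitude_stability:
  "\<exists>k1>0. k1 < 1 \<and> smooth_on ({0<..<k1} \<times> UNIV) (\<lambda>(k, x). wave_phi L k x) \<and>
    (\<forall>k. 0 < k \<and> k < k1 \<longrightarrow> wave_R L k > 0 \<and> (\<forall>x. wave_phi L k x - wave_c L k < 0) \<and>
      conditionally_orbitally_stable L (wave_phi L k))"
proof -
  obtain T where T0: "wave_family L T" "0 \<in> T" using wave_family_exists by blast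
  interpret wave_family L T by (rule T0(1))
  define \<kappa> where "\<kappa> = kap L"
  have \<kappa>: "\<kappa> > 0" using kap_pos[OF L_pos] by (simp add: \<kappa>_def)
  define \<mu> where "\<mu> = min (1/2) (\<kappa>\<^sup>2)"
  have \<mu>: "\<mu> > 0" "\<mu> \<le> 1/2" using \<kappa> by (auto simp: \<mu>_def)
  \<comment> \<open>The budget \<open>gap0 * \<mu> / 2\<close> is split evenly:
    \<open>2 * \<eta>\<close> is half of it, and \<open>72 = 4 * 18\<close> in
    \<open>\<zeta>\<close> bounds the other term by the other half. The bound \<open>1/4\<close>
    keeps \<open>\<zeta>\<close> below \<open>1/2\<close>.\<close>
  define \<eta> where "\<eta> = gap0 * \<mu> / 8"
  define \<zeta> where "\<zeta> = min (1/4) (sqrt (\<mu> / (72 * \<kappa>\<^sup>2)))"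
  have \<eta>: "\<eta> > 0" using gap0_pos \<mu> by (simp add: \<eta>_def)
  have \<eta>D: "\<eta> < gap0"
  proof -
    have "gap0 * \<mu> \<le> gap0 * 1" using gap0_pos \<mu> by (intro mult_left_mono) auto
    then show ?thesis using gap0_pos by (simp add: \<eta>_def)
  qed
  have \<zeta>: "\<zeta> > 0" "\<zeta> < 1/2" using \<mu> \<kappa> by (auto simp: \<zeta>_def)
  have "\<zeta>\<^sup>2 \<le> (sqrt (\<mu> / (72 * \<kappa>\<^sup>2)))\<^sup>2" using \<zeta> by (intro power_mono) (auto simp: \<zeta>_def)
  then have "\<zeta>\<^sup>2 \<le> \<mu> / (72 * \<kappa>\<^sup>2)" using \<mu> by simp
  then have "18 * gap0 * \<kappa>\<^sup>2 * \<zeta>\<^sup>2 \<le> 18 * gap0 * \<kappa>\<^sup>2 * (\<mu> / (72 * \<kappa>\<^sup>2))"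
    using gap0_pos by (intro mult_left_mono) auto
  also have "\<dots> = gap0 * \<mu> / 4" using \<kappa> by (simp add: field_simps)
  finally have small: "2 * \<eta> + 18 * gap0 * \<kappa>\<^sup>2 * \<zeta>\<^sup>2 \<le> gap0 * \<mu> / 2"
    unfolding \<eta>_def by linarith

  have openT: "open T" by (rule T(1))
  have wp: "wave_param L k" if "k \<in> T" for k
    using T(2) that L_pos by unfold_locales (auto simp: abs_less_iff)
  have c_phi: "continuous_on (T \<times> UNIV) (\<lambda>z. wave_phi L (fst z) (snd z))"
    using smooth_wave_family unfolding smooth_on_def case_prod_unfold
    by (metis higher_differentiable_on.simps(1))
  have c_gen: "continuous_on (T \<times> UNIV) j_sin" "continuous_on (T \<times> UNIV) j_cos" "continuous_on (T \<times> UNIV) j_dn"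
    "continuous_on (T \<times> UNIV) (j_K 0)" "continuous_on (T \<times> UNIV) j_R"
    by (intro continuous_alg gens_alg)+
  have c_c: "continuous_on (T \<times> (UNIV :: real set)) (\<lambda>z. wave_c L (fst z))"
  proof -
    have "continuous_on (T \<times> (UNIV :: real set)) (\<lambda>z. (3/2 * L\<^sup>2 - 1/2 * j_R z) / L\<^sup>2)"
      by (intro continuous_intros c_gen) (use L_pos in auto)
    then show ?thesis by (simp add: wave_c_def j_R_def)
  qed
  have cs: "cos (2 * wave_param.wave_am L (fst z) (snd z)) = (j_cos z)\<^sup>2 - (j_sin z)\<^sup>2"
    and sn: "sin (2 * wave_param.wave_am L (fst z) (snd z)) = 2 * j_sin z * j_cos z"
    and dl: "wave_param.wave_dn L (fst z) (snd z) = j_dn z" "wave_param.lam L (fst z) = 2 * j_K 0 z / L"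
    if "z \<in> T \<times> UNIV" for z
  proof -
    interpret k: wave_param L "fst z" using wp that by auto
    show "cos (2 * k.wave_am (snd z)) = (j_cos z)\<^sup>2 - (j_sin z)\<^sup>2" "sin (2 * k.wave_am (snd z)) = 2 * j_sin z * j_cos z"
      by (simp_all add: j_sin_def j_cos_def j_am_def k.wave_am_def cos_double sin_double)
    show "k.wave_dn (snd z) = j_dn z" "k.lam = 2 * j_K 0 z / L"
      by (simp_all add: k.wave_dn_def j_dn_def k.lam_def j_K_def ellK_eq_ellI)
  qed
  have c_r: "continuous_on (T \<times> UNIV) (\<lambda>z. wave_r L (fst z) (snd z))"
  proof -
    have "continuous_on (T \<times> UNIV) (\<lambda>z. (j_cos z)\<^sup>2 - (j_sin z)\<^sup>2 - cos (kap L * snd z))"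
      by (intro continuous_intros c_gen)
    then show ?thesis by (rule continuous_on_eq) (simp add: wave_r_def cs)
  qed
  have c_r': "continuous_on (T \<times> UNIV) (\<lambda>z. wave_r' L (fst z) (snd z))"
  proof -
    have "continuous_on (T \<times> UNIV) (\<lambda>z. kap L * sin (kap L * snd z) - 2 * j_sin z * j_cos z * (2 * (j_dn z * (2 * j_K 0 z / L))))"
      by (intro continuous_intros c_gen) (use L_pos in auto)
    then show ?thesis by (rule continuous_on_eq) (simp add: wave_r'_def sn dl)
  qed
  \<comment> \<open>The derivative of the wave written in functions known to be continuous in
    \<open>(k, x)\<close>; the factor \<open>(fst z)^2\<close> makes it vanish at
    \<open>k = 0\<close>.\<close>
  define phi' where "phi' = (\<lambda>z. - 16 * (j_K 0 z)\<^sup>2 * (fst z)\<^sup>2 / L\<^sup>2 * (- (kap L * sin (kap L * snd z)) + wave_r' L (fst z) (snd z)))"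
  have phi'_eq: "phi' (k, x) = wave_param.wave_phi' L k x" if "k \<in> T" for k x
  proof -
    interpret k: wave_param L k using wp that by auto
    show ?thesis by (simp add: k.wave_phi'_r phi'_def k.wave_beta_def j_K_def ellK_eq_ellI)
  qed
  have c_phi': "continuous_on (T \<times> UNIV) phi'"
    unfolding phi'_def by (intro continuous_intros c_gen c_r') (use L_pos in auto)

  have per_phi: "periodic L (wave_phi L k)" "periodic L (wave_r L k)" "periodic L (wave_r' L k)"
    "periodic L (\<lambda>x. phi' (k, x))" if "k \<in> T" for k
  proof -
    interpret k: wave_param L k using wp that by auto
    show "periodic L (wave_phi L k)" "periodic L (wave_r L k)" "periodic L (wave_r' L k)" "periodic L (\<lambda>x. phi' (k, x))"
      using k.periodic_wave_phi k.periodic_wave_r k.periodic_wave_phi' that by (simp_all add: phi'_eq)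
  qed

  note ev = uniformly_small_near_zero[OF L_pos openT T0(2)]
  have "\<forall>\<^sub>F k in at_right 0. \<forall>x. \<bar>(\<lambda>z. wave_c L (fst z) - wave_phi L (fst z) (snd z) - gap0) (k, x)\<bar> \<le> \<eta>"
    by (rule ev[OF _ _ _ \<eta>]) (use per_phi in \<open>auto intro!: continuous_intros c_c c_phi simp: periodic_def wave_phi_0 gap0_def\<close>)
  moreover have "\<forall>\<^sub>F k in at_right 0. \<forall>x. \<bar>phi' (k, x)\<bar> \<le> \<eta>"
    by (rule ev[OF c_phi' _ _ \<eta>]) (use per_phi in \<open>auto simp: phi'_def\<close>)
  moreover have "\<forall>\<^sub>F k in at_right 0. \<forall>x. \<bar>(\<lambda>z. wave_c L (fst z) - 3 * (wave_phi L (fst z) (snd z))\<^sup>2 + gap0 * (kap L)\<^sup>2) (k, x)\<bar> \<le> \<eta>"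
    by (rule ev[OF _ _ _ \<eta>]) (use per_phi bifurcation_condition in \<open>auto intro!: continuous_intros c_c c_phi simp: periodic_def wave_phi_0\<close>)
  moreover have "\<forall>\<^sub>F k in at_right 0. \<forall>x. \<bar>(\<lambda>z. wave_r L (fst z) (snd z)) (k, x)\<bar> \<le> \<zeta>"
    by (rule ev[OF c_r _ _ \<zeta>(1)]) (use per_phi in \<open>auto simp: wave_r_0\<close>)
  moreover have "\<forall>\<^sub>F k in at_right 0. \<forall>x. \<bar>(\<lambda>z. wave_r' L (fst z) (snd z)) (k, x)\<bar> \<le> \<zeta>"
    by (rule ev[OF c_r' _ _ \<zeta>(1)]) (use per_phi in \<open>auto simp: wave_r'_0\<close>)
  moreover have "\<forall>\<^sub>F k in at_right 0. k \<in> T"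
    using eventually_nhds_in_open[OF openT T0(2)] by (simp add: eventually_at_filter eventually_mono)
  ultimately have "\<forall>\<^sub>F k in at_right 0. k \<in> T \<and> (\<forall>x. \<bar>wave_c L k - wave_phi L k x - gap0\<bar> \<le> \<eta> \<and> \<bar>phi' (k, x)\<bar> \<le> \<eta> \<and>
      \<bar>wave_c L k - 3 * (wave_phi L k x)\<^sup>2 + gap0 * (kap L)\<^sup>2\<bar> \<le> \<eta> \<and> \<bar>wave_r L k x\<bar> \<le> \<zeta> \<and> \<bar>wave_r' L k x\<bar> \<le> \<zeta>)"
    by eventually_elim simp
  then obtain k1 where k1: "k1 > 0" and all: "\<And>k. 0 < k \<Longrightarrow> k < k1 \<Longrightarrow> k \<in> T \<and> (\<forall>x. \<bar>wave_c L k - wave_phi L k x - gap0\<bar> \<le> \<eta> \<and> \<bar>phi' (k, x)\<bar> \<le> \<eta> \<and>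
      \<bar>wave_c L k - 3 * (wave_phi L k x)\<^sup>2 + gap0 * (kap L)\<^sup>2\<bar> \<le> \<eta> \<and> \<bar>wave_r L k x\<bar> \<le> \<zeta> \<and> \<bar>wave_r' L k x\<bar> \<le> \<zeta>)"
    unfolding eventually_at_right_field by blast
  show ?thesis
  \<comment> \<open>The cap \<open>1/2\<close> keeps the new bound below \<open>1\<close>.\<close>
  proof (intro exI[of _ "min k1 (1/2)"] conjI allI impI)
    show "0 < min k1 (1/2)" "min k1 (1/2) < 1" using k1 by auto
    have "{0<..<min k1 (1/2)} \<times> UNIV \<subseteq> T \<times> (UNIV :: real set)" using all by auto
    then show "smooth_on ({0<..<min k1 (1/2)} \<times> UNIV) (\<lambda>(k, x). wave_phi L k x)"
      by (rule smooth_on_subset[OF smooth_wave_family])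
  next
    fix k assume "0 < k \<and> k < min k1 (1/2)"
    then have k: "0 < k" "k < k1" by auto
    note a = all[OF k]
    interpret k: wave_param L k using wp a by blast
    show R: "wave_R L k > 0" using local.R a by blast
    show "wave_phi L k x - wave_c L k < 0" for x
      using a[THEN conjunct2, rule_format, of x] \<eta>D by linarith
    have "stable_wave L (wave_c L k) (wave_A L k) gap0 \<eta> \<zeta> k.wave_beta k.wave_mean
      (wave_phi L k) k.wave_phi' k.wave_phi'' (wave_r L k) (wave_r' L k)"
    proof
      have kT: "k \<in> T" using a by blast
      have "\<bar>phi' (k, x)\<bar> \<le> \<eta>" for x using a by blast
      then show "\<bar>k.wave_phi' x\<bar> \<le> \<eta>" for x by (simp add: phi'_eq[OF kT])
      show "wave_phi L k x = k.wave_mean + k.wave_beta * (cos (kap L * x) + wave_r L k x)" for x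
        by (rule k.wave_phi_r)
      show "k.wave_phi' x = k.wave_beta * (- (kap L * sin (kap L * x)) + wave_r' L k x)" for x
        by (rule k.wave_phi'_r)
      show "k.wave_beta \<noteq> 0" using k L_pos ellK_pos[OF k.k] by (simp add: k.wave_beta_def)
      show "2 * \<eta> + 18 * gap0 * (kap L)\<^sup>2 * \<zeta>\<^sup>2 \<le> gap0 * min (1/2) ((kap L)\<^sup>2) / 2"
        using small by (simp add: \<kappa>_def \<mu>_def)
    qed (use a \<zeta> R in \<open>auto simp: L_pos gap0_pos k.smooth_wave_phi k.periodic_wave_phi k.wave_phi_has_derivative
          k.wave_phi'_has_derivative k.wave_ode k.wave_phi_minus\<close>)
    then show "conditionally_orbitally_stable L (wave_phi L k)" by (rule stable_wave.stable)
  qed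
qed

end

theorem theorem2p8:
  shows "\<exists>L0>0. \<forall>L>L0. \<exists>k1. 0 < k1 \<and> k1 < 1 \<and>
    smooth_on ({0<..<k1} \<times> UNIV) (\<lambda>(k, x). wave_phi L k x) \<and>
    (\<forall>k. 0 < k \<and> k < k1 \<longrightarrow>
       wave_R L k > 0 \<and>
       periodic L (wave_phi L k) \<and>
       smooth_on UNIV (wave_phi L k) \<and>
       (\<forall>x. (wave_phi L k x - wave_c L k) * deriv (deriv (wave_phi L k)) x
             + (deriv (wave_phi L k) x)\<^sup>2 / 2 - (wave_phi L k x)^3
             + wave_c L k * wave_phi L k x = wave_A L k) \<and>
       (\<forall>x\<in>{0..L}. wave_phi L k x - wave_c L k < 0) \<and>
       (wave_c L k)\<^sup>2 - 3 * wave_c L k + 32 * pi^4 / L^4 < 0 \<and>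
       conditionally_orbitally_stable L (wave_phi L k))"
proof (rule exI[of _ "2 * pi"], rule conjI, simp, intro allI impI, goal_cases)
  case (1 L)
  then have L: "L > 0" using pi_gt_zero by linarith
  obtain k1 where k1: "0 < k1" "k1 < 1" "smooth_on ({0<..<k1} \<times> UNIV) (\<lambda>(k, x). wave_phi L k x)"
    and stab: "\<And>k. 0 < k \<and> k < k1 \<Longrightarrow> wave_R L k > 0 \<and> (\<forall>x. wave_phi L k x - wave_c L k < 0) \<and>
      conditionally_orbitally_stable L (wave_phi L k)"
    using small_amplitude_stability[OF 1] by blast
  show ?case
  proof (intro exI[of _ k1] conjI allI impI k1)
    fix k assume k01: "0 < k \<and> k < k1"
    interpret wave_param L k by unfold_locales (use k01 k1 L in auto)
    note st = stab[OF k01]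
    show R: "wave_R L k > 0" using st by blast
    show "periodic L (wave_phi L k)" by (rule periodic_wave_phi)
    show "smooth_on UNIV (wave_phi L k)" by (rule smooth_wave_phi)
    show "(wave_phi L k x - wave_c L k) * deriv (deriv (wave_phi L k)) x
        + (deriv (wave_phi L k) x)\<^sup>2 / 2 - (wave_phi L k x)^3 + wave_c L k * wave_phi L k x = wave_A L k" for x
      unfolding deriv_wave_phi deriv_wave_phi' by (rule wave_ode[OF less_imp_le[OF R]])
    show "\<forall>x\<in>{0..L}. wave_phi L k x - wave_c L k < 0" using st by blast
    show "(wave_c L k)\<^sup>2 - 3 * wave_c L k + 32 * pi^4 / L^4 < 0"
      using k01 k1(2) by (intro wave_c_inequality[OF L less_imp_le[OF R]]) auto
    show "conditionally_orbitally_stable L (wave_phi L k)" using st by blast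
  qed
qed

end
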